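(* Let $B_1,\dots,B_m$ be arbitrary $n\times n$ complex matrices, $n\ge 2$. (1) If $m\ge 3$, then $$\sum_{r,s=1}^m\|[B_r,B_s]\|^2\le \frac43\left(\sum_{r=1}^m\|B_r\|^2\right)^2 .$$ For $1\le r\le m$ let $B_r^1=\frac12(B_r+B_r^* )$ and $B_r^2=\frac12(B_r-B_r^* )$. Equality holds if and only if $\sum_{r=1}^m[B_r,B_r^*]=0$ and there exists $(P,R)\in K(n,2m)$ such that $$(P,R)\cdot(B_1^1,\dots,B_m^1,\mathbf{i}B_1^2,\dots,\mathbf{i}B_m^2)=(\mathrm{diag}(H_1,0),\mathrm{diag}(H_2,0),\mathrm{diag}(H_3,0),0,\dots,0),$$ where for some real $\lambda\ge 0$, $$H_1=\begin{pmatrix}\lambda&0\\0&-\lambda\end{pmatrix},\quad H_2=\begin{pmatrix}0&\lambda\\\lambda&0\end{pmatrix},\quad H_3=\begin{pmatrix}0&-\lambda\mathbf{i}\\\lambda\mathbf{i}&0\end{pmatrix}.$$ (2) If $m=2$, then $$\sum_{r,s=1}^2\|[B_r,B_s]\|^2\le\left(\sum_{r=1}^2\|B_r\|^2\right)^2 .$$ Equality holds if and only if there exists a unitary matrix $U$ such that $B_1=U^*\mathrm{diag}(\widetilde{B_1},0)U$ and $B_2=U^*\mathrm{diag}(\widetilde{B_2},0)U$, where $\widetilde{B_1},\widetilde{B_2}\in M(2,\mathbb{C})$ satisfy $\|\widetilde{B_1}\|=\|\widetilde{B_2}\|$, $\langle\widetilde{B_1},\widetilde{B_2}\rangle=0$,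 and $\mathrm{tr}(\widetilde{B_1})=\mathrm{tr}(\widetilde{B_2})=0$.
   Context: $M(n,\mathbb{C})$ is the space of $n\times n$ complex matrices; $[A,B]=AB-BA$; $A^*=\overline{A}^t$ is the conjugate transpose; $\|B\|^2=\mathrm{tr}(BB^* )$ is the squared Frobenius norm; $\langle A,B\rangle=\mathrm{tr}(AB^* )$ is the Hermitian (Frobenius) inner product. $\mathbf{i}$ is the imaginary unit. $\mathrm{diag}(H,0)$ denotes the $n\times n$ block diagonal matrix with upper-left block $H$ and all other entries zero (the zero block may be empty). For positive integers $n,k$, $K(n,k):=U(n)\times O(k)$ (unitary group times real orthogonal group), acting on $k$-tuples of $n\times n$ matrices by $$(P,R)\cdot(A_1,\dots,A_k):=\left(\sum_{j=1}^kR_{j1}P^*A_jP,\dots,\sum_{j=1}^kR_{jk}P^*A_jP\right),\qquad R=(R_{jl})\in O(k).$$ *)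

theory Defs
  imports Complex_Main "Jordan_Normal_Form.Schur_Decomposition"
begin

definition mat_trace :: "complex mat \<Rightarrow> complex" where
  "mat_trace A = (\<Sum>i<dim_row A. A $$ (i, i))"

definition mat_commutator :: "complex mat \<Rightarrow> complex mat \<Rightarrow> complex mat" where
  "mat_commutator A B = A * B - B * A"

definition frob_inner :: "complex mat \<Rightarrow> complex mat \<Rightarrow> complex" where
  "frob_inner A B = mat_trace (A * mat_adjoint B)"

text \<open>The trace of \<open>A * mat_adjoint A\<close> is a nonnegative real number, so taking \<open>Re\<close> loses
  nothing: see \<open>frob_norm_squared\<close> below.\<close>

definition frob_norm :: "complex mat \<Rightarrow> real" where
  "frob_norm A = sqrt (Re (frob_inner A A))"

lemma frob_inner_self:
  "frob_inner A A = of_real (\<Sum>i<dim_row A. \<Sum>j<dim_col A. (cmod (A $$ (i, j)))\<^sup>2)"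
proof -
  have "(A * mat_adjoint A) $$ (i, i) = of_real (\<Sum>j<dim_col A. (cmod (A $$ (i, j)))\<^sup>2)"
    if "i < dim_row A" for i
    using that
    by (simp add: mat_adjoint_def mat_of_rows_def scalar_prod_def atLeast0LessThan
        complex_norm_square del: of_real_power)
  then show ?thesis
    by (simp add: frob_inner_def mat_trace_def)
qed

lemma frob_norm_squared: "of_real ((frob_norm A)\<^sup>2) = mat_trace (A * mat_adjoint A)"
proof -
  have "mat_trace (A * mat_adjoint A)
      = of_real (\<Sum>i<dim_row A. \<Sum>j<dim_col A. (cmod (A $$ (i, j)))\<^sup>2)"
    using frob_inner_self[of A] by (simp only: frob_inner_def)
  moreover have "0 \<le> (\<Sum>i<dim_row A. \<Sum>j<dim_col A. (cmod (A $$ (i, j)))\<^sup>2)"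
    by (intro sum_nonneg) simp
  ultimately show ?thesis
    unfolding frob_norm_def frob_inner_def by (simp only: Re_complex_of_real real_sqrt_pow2)
qed

text \<open>The type of matrices is not a \<open>comm_monoid_add\<close> (there is no zero independent of the
  dimensions), so sums of \<open>n \<times> n\<close> matrices are taken entrywise.\<close>

definition mat_sum :: "nat \<Rightarrow> ('i \<Rightarrow> complex mat) \<Rightarrow> 'i set \<Rightarrow> complex mat" where
  "mat_sum n f I = mat n n (\<lambda>ij. \<Sum>r\<in>I. f r $$ ij)"

definition herm_part :: "complex mat \<Rightarrow> complex mat" where
  "herm_part B = (1 / 2) \<cdot>\<^sub>m (B + mat_adjoint B)"

definition skew_part :: "complex mat \<Rightarrow> complex mat" where
  "skew_part B = (1 / 2) \<cdot>\<^sub>m (B - mat_adjoint B)"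

definition unitary_matrices :: "nat \<Rightarrow> complex mat set" where
  "unitary_matrices n = {P \<in> carrier_mat n n. mat_adjoint P * P = 1\<^sub>m n \<and> P * mat_adjoint P = 1\<^sub>m n}"

definition orthogonal_matrices :: "nat \<Rightarrow> real mat set" where
  "orthogonal_matrices k =
     {R \<in> carrier_mat k k. transpose_mat R * R = 1\<^sub>m k \<and> R * transpose_mat R = 1\<^sub>m k}"

definition K_group :: "nat \<Rightarrow> nat \<Rightarrow> (complex mat \<times> real mat) set" where
  "K_group n k = unitary_matrices n \<times> orthogonal_matrices k"

text \<open>A \<open>k\<close>-tuple of matrices is a list of length \<open>k\<close>, its positions counted from \<open>0\<close> like the
  rows and columns of \<open>R\<close>.\<close>

definition K_action ::
  "nat \<Rightarrow> complex mat \<times> real mat \<Rightarrow> complex mat list \<Rightarrow> complex mat list" where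
  "K_action n = (\<lambda>(P, R) As.
     map (\<lambda>l. mat_sum n
            (\<lambda>j. of_real (R $$ (j, l)) \<cdot>\<^sub>m (mat_adjoint P * As ! j * P)) {..<length As})
       [0..<length As])"

text \<open>\<open>diag(H, 0)\<close> of size \<open>n\<close>, for \<open>H\<close> of size at most \<open>n\<close>; the zero block may be empty.\<close>

definition diag_zero :: "nat \<Rightarrow> complex mat \<Rightarrow> complex mat" where
  "diag_zero n H = diag_block_mat [H, 0\<^sub>m (n - dim_row H) (n - dim_col H)]"

end

theory Submission
  imports Defs
begin

text \<open>
  Part (2) is the inequality of Boettcher and Wenzel, \<open>|[X, Y]|^2 \<le> 2 |X|^2 |Y|^2\<close>. With
  \<open>G = Y Y* + Y* Y\<close> one has \<open>|[X, Y]|^2 + |X* Y + Y X*|^2 = tr ((X* X + X X*) G)\<close>, and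
  the Cauchy-Schwarz inequality bounds \<open>|X* Y + Y X*|\<close> from below by \<open>|tr (X* G)| / |Y|\<close>. So
  \<open>|[X, Y]|^2\<close> is at most \<open>4 |Y|^2\<close> times the variance of \<open>X\<close> in the state \<open>G / (2 |Y|^2)\<close>, and this variance
  is at most \<open>|X|^2 / 2\<close> once \<open>G\<close> is diagonal. In the equality case \<open>G\<close> has exactly two nonzero eigenvalues,
  which confines \<open>X\<close> and \<open>Y\<close> to a block of size two.

  For part (1) the sum over \<open>B_1, ..., B_m\<close> equals the corresponding sum over the \<open>2 m\<close> Hermitian
  matrices \<open>B_r^1\<close>, \<open>i B_r^2\<close> minus half the squared norm of the sum of the \<open>[B_r, B_r*]\<close>. Both sides of the
  Hermitian inequality are invariant under orthogonal mixing, so one may assume that the Hermitian matrices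
  \<open>A_r\<close> are orthogonal with decreasing \<open>a_r = |A_r|^2\<close>. For diagonal \<open>A_r\<close> with eigenvalues \<open>l_i\<close> and
  \<open>S = a_r\<close>, the excesses \<open>(l_i - l_j)^2 - S\<close> that are positive add up to at most \<open>2 S\<close>, whence
  \<open>\<Sum>s. |[A_r, A_s]|^2\<close> is at most \<open>a_r\<close> times the sum of the other \<open>a_s\<close> plus the two largest of them.
  Summing over \<open>r\<close> leaves a quadratic inequality in the three largest \<open>a_r\<close>, whose defect is a sum of squares.
\<close>

section \<open>The spectral theorem\<close>

text \<open>The threshold \<open>S\<close> for the excesses is natural because
  \<open>(l_i - l_j)^2\<close> never exceeds \<open>2 S\<close>: a single excess is at most
  \<open>S\<close>, and a total of \<open>2 S\<close> is worth two full excesses. Bessel's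
  inequality spreads this total over the orthogonal \<open>A_s\<close>, and at best the two largest
  receive a full share each; hence exactly two norms appear, and hence the family is first made
  orthogonal, by diagonalizing its Gram matrix, which is real because the matrices are Hermitian.
  The constant 4/3 is the value of three matrices of equal squared norm \<open>a\<close> whose pairs
  all attain the Boettcher-Wenzel bound: six ordered pairs give \<open>12 a^2 = 4/3 (3 a)^2\<close>.
  Two matrices have one commutator up to sign, and \<open>4 x y \<le> (x + y)^2\<close> gives the
  constant 1. The equality cases are read off from defects written as sums of nonnegative terms;
  eigenvalues are sorted by absolute value there, so that the two nonzero ones occupy the indices 0
  and 1, where the theorem wants the block.\<close>

lemma mult_carrier_square: "A \<in> carrier_mat n n \<Longrightarrow> B \<in> carrier_mat n n \<Longrightarrow> A * B \<in> carrier_mat n n"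
  by (rule mult_carrier_mat)

lemma assoc_mult_square:
  fixes A :: "'a::semiring_0 mat"
  shows "A \<in> carrier_mat n n \<Longrightarrow> B \<in> carrier_mat n n \<Longrightarrow> C \<in> carrier_mat n n \<Longrightarrow> A * B * C = A * (B * C)"
  by (rule assoc_mult_mat)

lemma mat_adjoint_carrier [simp]: "A \<in> carrier_mat r c \<Longrightarrow> mat_adjoint A \<in> carrier_mat c r"
  by (auto simp: mat_adjoint_def)

lemma mat_adjoint_dim [simp]:
  "dim_row (mat_adjoint A) = dim_col A" "dim_col (mat_adjoint A) = dim_row A"
  by (auto simp: mat_adjoint_def)

lemma mat_adjoint_index [simp]:
  "i < dim_col A \<Longrightarrow> j < dim_row A \<Longrightarrow> mat_adjoint A $$ (i, j) = conjugate (A $$ (j, i))"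
  by (simp add: mat_adjoint_def mat_of_rows_def)

lemma mat_adjoint_mult:
  fixes A :: "'a::conjugatable_field mat"
  assumes "A \<in> carrier_mat r k" "B \<in> carrier_mat k c"
  shows "mat_adjoint (A * B) = mat_adjoint B * mat_adjoint A"
  using assms
  by (intro eq_matI) (auto simp: scalar_prod_def sum_conjugate conjugate_dist_mul mult.commute intro!: sum.cong)

lemma mat_adjoint_adjoint [simp]: "mat_adjoint (mat_adjoint (A :: 'a::conjugatable_field mat)) = A"
  by (intro eq_matI) auto

lemma mat_adjoint_one [simp]: "mat_adjoint (1\<^sub>m n :: 'a::conjugatable_ordered_field mat) = 1\<^sub>m n"
proof -
  have "conjugate (1::'a) = 1"
    by (metis conjugate_dist_mul conjugate_id mult.right_neutral mult_1)
  then show ?thesis by (intro eq_matI) auto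
qed

lemma mat_adjoint_four_block:
  fixes A :: "'a::conjugatable_field mat"
  assumes "A \<in> carrier_mat a a" "D \<in> carrier_mat d d"
  shows "mat_adjoint (four_block_mat A (0\<^sub>m a d) (0\<^sub>m d a) D) =
    four_block_mat (mat_adjoint A) (0\<^sub>m a d) (0\<^sub>m d a) (mat_adjoint D)"
  using assms by (intro eq_matI) (auto simp: not_less)

text \<open>An ordered field with conjugation need not contain the square root that normalizes a
  vector; \<open>unit_mult\<close> supplies it, so that one proof serves the complex and the real
  spectral theorem. Gram-Schmidt leaves the first vector of the completed basis alone, hence the
  first column remains a multiple of \<open>v\<close>.\<close>

lemma unitary_with_first_column:
  fixes v :: "'a::conjugatable_ordered_field vec"
  assumes unit_mult: "\<forall>v :: 'a vec. v \<noteq> 0\<^sub>v (dim_vec v) \<longrightarrow> (\<exists>c. c * conjugate c * (v \<bullet>c v) = 1)"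
    and v: "v \<in> carrier_vec n" "v \<noteq> 0\<^sub>v n"
  obtains W c where "W \<in> carrier_mat n n" "mat_adjoint W * W = 1\<^sub>m n" "col W 0 = c \<cdot>\<^sub>v v"
proof -
  interpret cof_vec_space n "TYPE('a)" .
  define ws where "ws = gram_schmidt n (basis_completion v)"
  have n: "n > 0" using v by (metis carrier_vecD eq_vecI gr0I index_zero_vec(2) less_nat_zero_code)
  note b = basis_completion[OF v]
  obtain vs where bv: "basis_completion v = v # vs"
    using b(6,7) n by (cases "basis_completion v") auto
  from gram_schmidt_result[OF b(2) b(4) b(5) refl, folded ws_def]
  have ws: "set ws \<subseteq> carrier_vec n" "corthogonal ws" "length ws = n"
    by (auto simp: b(6))
  have hd: "ws ! 0 = v"
    using gram_schmidt_hd[OF v(1), of vs, folded bv] ws(3) n unfolding ws_def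
    by (metis hd_conv_nth length_greater_0_conv)
  have wsi: "ws ! i \<in> carrier_vec n" if "i < n" for i using ws that by (metis nth_mem subsetD)
  have nz: "ws ! i \<noteq> 0\<^sub>v n" if "i < n" for i
  proof
    assume "ws ! i = 0\<^sub>v n"
    then have "ws ! i \<bullet>c ws ! i = 0" by simp
    then show False using corthogonalD[OF ws(2), of i i] that ws(3) by simp
  qed
  have "\<exists>c. c * conjugate c * (ws ! i \<bullet>c ws ! i) = 1" if "i < n" for i
    by (rule unit_mult[rule_format]) (use nz[OF that] carrier_vecD[OF wsi[OF that]] in simp)
  then obtain c where c: "\<And>i. i < n \<Longrightarrow> c i * conjugate (c i) * (ws ! i \<bullet>c ws ! i) = 1"
    by metis
  define W where "W = mat n n (\<lambda>(i,j). c j * ws ! j $ i)"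
  have W: "W \<in> carrier_mat n n" by (simp add: W_def)
  have "mat_adjoint W * W = 1\<^sub>m n"
  proof (rule eq_matI)
    fix i j assume "i < dim_row (1\<^sub>m n :: 'a mat)" "j < dim_col (1\<^sub>m n :: 'a mat)"
    then have ij: "i < n" "j < n" by auto
    have "(mat_adjoint W * W) $$ (i, j) = (\<Sum>k\<in>{0..<n}. conjugate (c i * ws ! i $ k) * (c j * ws ! j $ k))"
      using ij W by (simp add: scalar_prod_def W_def)
    also have "\<dots> = c j * conjugate (c i) * (ws ! j \<bullet>c ws ! i)"
      using ij wsi[of i] wsi[of j]
      by (auto simp: scalar_prod_def sum_distrib_left conjugate_dist_mul mult_ac intro!: sum.cong)
    also have "\<dots> = 1\<^sub>m n $$ (i, j)"
      using ij c[of i] corthogonalD[OF ws(2), of j i] ws(3) by auto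
    finally show "(mat_adjoint W * W) $$ (i, j) = 1\<^sub>m n $$ (i, j)" .
  qed (use W in auto)
  moreover have "col W 0 = c 0 \<cdot>\<^sub>v v"
    using n v W by (intro eq_vecI) (auto simp: W_def hd)
  ultimately show ?thesis using W that by blast
qed

text \<open>Induction by deflation: conjugation with a unitary matrix whose first column is an
  eigenvector for \<open>e\<close> makes the first column of the matrix \<open>e\<close> times a
  unit vector, self-adjointness clears the first row, and the remaining block has the characteristic
  polynomial with the factor of \<open>e\<close> removed. The diagonal follows the list
  \<open>es\<close>, so the caller fixes the order of the eigenvalues by permuting the list.\<close>

lemma hermitian_diagonalization_ordered_field:
  fixes A :: "'a::conjugatable_ordered_field mat"
  assumes unit_mult: "\<forall>v :: 'a vec. v \<noteq> 0\<^sub>v (dim_vec v) \<longrightarrow> (\<exists>c. c * conjugate c * (v \<bullet>c v) = 1)"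
    and "A \<in> carrier_mat n n" "mat_adjoint A = A" "char_poly A = (\<Prod>e\<leftarrow>es. [:- e, 1:])"
  shows "\<exists>P\<in>carrier_mat n n. mat_adjoint P * P = 1\<^sub>m n \<and> mat_adjoint P * A * P = mat_diag n (\<lambda>i. es ! i)"
  using assms(2-)
proof (induction es arbitrary: n A)
  case Nil
  with degree_monic_char_poly[of A n] have "n = 0" by simp
  with Nil show ?case by (intro bexI[of _ "1\<^sub>m n"]) (auto simp: mat_diag_def)
next
  case (Cons e es)
  note A = Cons.prems(1) and herm = Cons.prems(2)
  have cp: "char_poly A = [:-e, 1:] * (\<Prod>e\<leftarrow>es. [:- e, 1:])" using Cons.prems(3) by simp
  have "eigenvalue A e" unfolding eigenvalue_root_char_poly[OF A] cp by simp
  then obtain v where v: "v \<in> carrier_vec n" "v \<noteq> 0\<^sub>v n" and Av: "A *\<^sub>v v = e \<cdot>\<^sub>v v"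
    using A unfolding eigenvalue_def eigenvector_def by auto
  obtain W c where W: "W \<in> carrier_mat n n" and WW: "mat_adjoint W * W = 1\<^sub>m n" and c: "col W 0 = c \<cdot>\<^sub>v v"
    by (rule unitary_with_first_column[OF unit_mult v])
  have WW': "W * mat_adjoint W = 1\<^sub>m n"
    using mat_mult_left_right_inverse[OF mat_adjoint_carrier[OF W] W WW] .
  have n: "n > 0" using v by (metis carrier_vecD eq_vecI gr0I index_zero_vec(2) less_nat_zero_code)
  then obtain d where d: "n = Suc d" by (cases n) auto
  define A' where "A' = mat_adjoint W * A * W"
  have aW: "mat_adjoint W \<in> carrier_mat n n" using W by simp
  have A': "A' \<in> carrier_mat n n" using A W unfolding A'_def by auto
  have herm': "mat_adjoint A' = A'"
    unfolding A'_def
    by (simp add: mat_adjoint_mult[OF aW mult_carrier_mat[OF A W]] mat_adjoint_mult[OF A W] herm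
        assoc_mult_mat[OF aW A W])
  have "col A' 0 = e \<cdot>\<^sub>v unit_vec n 0"
  proof -
    have "col A' 0 = mat_adjoint W *\<^sub>v (A *\<^sub>v col W 0)"
      unfolding A'_def assoc_mult_mat[OF aW A W] col_mult2[OF aW mult_carrier_mat[OF A W] n] col_mult2[OF A W n] ..
    also have "A *\<^sub>v col W 0 = e \<cdot>\<^sub>v col W 0"
      unfolding c using A v Av by (simp add: mult_mat_vec smult_smult_assoc mult.commute)
    also have "mat_adjoint W *\<^sub>v (e \<cdot>\<^sub>v col W 0) = e \<cdot>\<^sub>v col (mat_adjoint W * W) 0"
      using n W mult_mat_vec[OF aW, of "col W 0" e] by (simp add: col_mult2[OF aW W])
    also have "\<dots> = e \<cdot>\<^sub>v unit_vec n 0" unfolding WW using n by simp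
    finally show ?thesis .
  qed
  then have first: "A' $$ (i, 0) = (if i = 0 then e else 0)" if "i < n" for i
    using A' n that by (metis carrier_matD(1) carrier_matD(2) index_col index_smult_vec(1) index_unit_vec(1,3) mult.right_neutral mult_zero_right)
  have first': "A' $$ (0, i) = 0" if "i < n" "i > 0" for i
    using first[of i] that A' n arg_cong[OF herm', of "\<lambda>M. M $$ (0, i)"] by simp
  define A3 where "A3 = mat d d (\<lambda>(i,j). A' $$ (Suc i, Suc j))"
  have A3: "A3 \<in> carrier_mat d d" by (simp add: A3_def)
  have herm3: "mat_adjoint A3 = A3"
  proof (rule eq_matI)
    fix i j assume "i < dim_row A3" "j < dim_col A3"
    then show "mat_adjoint A3 $$ (i, j) = A3 $$ (i, j)"
      using arg_cong[OF herm', of "\<lambda>M. M $$ (Suc i, Suc j)"] A' d by (simp add: A3_def)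
  qed (auto simp: A3_def)
  define E where "E = mat 1 1 (\<lambda>_. e)"
  have E: "E \<in> carrier_mat 1 1" by (simp add: E_def)
  have block: "A' = four_block_mat E (0\<^sub>m 1 d) (0\<^sub>m d 1) A3"
    using A' d first first' by (intro eq_matI) (auto simp: E_def A3_def)
  have "similar_mat_wit A' A (mat_adjoint W) W"
    by (rule similar_mat_witI[of _ _ n]) (use WW WW' A A' W A'_def in auto)
  then have "char_poly A' = char_poly A" by (intro char_poly_similar) (auto simp: similar_mat_def)
  moreover have "char_poly A' = char_poly E * char_poly A3"
    unfolding block by (rule char_poly_four_block_zeros_col[OF E _ A3]) simp
  moreover have "char_poly E = [: -e,1 :]"
    by (simp add: E_def char_poly_defs det_def sign_def)
  ultimately have "char_poly A3 = (\<Prod>e\<leftarrow>es. [:- e, 1:])"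
    using cp by (metis mult_cancel_left pCons_eq_0_iff zero_neq_one)
  from Cons.IH[OF A3 herm3 this] obtain P' where P': "P' \<in> carrier_mat d d" and PP': "mat_adjoint P' * P' = 1\<^sub>m d"
    and diag': "mat_adjoint P' * A3 * P' = mat_diag d (\<lambda>i. es ! i)" by blast
  have aP': "mat_adjoint P' \<in> carrier_mat d d" using P' by simp
  \<comment> \<open>The unitary matrix of the smaller block, extended by a 1 in the corner;
    \<open>W * Q\<close> will diagonalize \<open>A\<close>.\<close>
  define Q where "Q = four_block_mat (1\<^sub>m 1) (0\<^sub>m 1 d) (0\<^sub>m d 1) P'"
  have Q: "Q \<in> carrier_mat n n" unfolding Q_def d using P' by (metis four_block_carrier_mat one_carrier_mat plus_1_eq_Suc)
  have aQeq: "mat_adjoint Q = four_block_mat (1\<^sub>m 1) (0\<^sub>m 1 d) (0\<^sub>m d 1) (mat_adjoint P')"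
    unfolding Q_def using mat_adjoint_four_block[OF one_carrier_mat P', of 1] by simp
  have aQ: "mat_adjoint Q \<in> carrier_mat n n" using Q by simp
  have QQ: "mat_adjoint Q * Q = 1\<^sub>m n"
    unfolding aQeq unfolding Q_def
    by (subst mult_four_block_mat[where ?nr1.0=1 and ?n1.0=1 and ?n2.0=d and ?nr2.0=d and ?nc1.0=1 and ?nc2.0=d])
       (use P' aP' PP' d in \<open>auto intro!: eq_matI\<close>)
  have QAQ: "mat_adjoint Q * A' * Q = mat_diag n (\<lambda>i. (e # es) ! i)"
  proof -
    have "mat_adjoint Q * A' = four_block_mat E (0\<^sub>m 1 d) (0\<^sub>m d 1) (mat_adjoint P' * A3)"
      unfolding aQeq block
      by (subst mult_four_block_mat[where ?nr1.0=1 and ?n1.0=1 and ?n2.0=d and ?nr2.0=d and ?nc1.0=1 and ?nc2.0=d])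
         (use P' aP' E A3 in auto)
    then have "mat_adjoint Q * A' * Q = four_block_mat E (0\<^sub>m 1 d) (0\<^sub>m d 1) (mat_adjoint P' * A3 * P')"
      unfolding Q_def
      by (simp, subst mult_four_block_mat[where ?nr1.0=1 and ?n1.0=1 and ?n2.0=d and ?nr2.0=d and ?nc1.0=1 and ?nc2.0=d])
         (use P' aP' E A3 in auto)
    also have "\<dots> = mat_diag n (\<lambda>i. (e # es) ! i)"
      unfolding diag' by (intro eq_matI) (auto simp: E_def mat_diag_def d nth_Cons split: nat.splits)
    finally show ?thesis .
  qed
  have adj: "mat_adjoint (W * Q) = mat_adjoint Q * mat_adjoint W" using W Q by (rule mat_adjoint_mult)
  have "mat_adjoint (W * Q) * (W * Q) = mat_adjoint Q * (mat_adjoint W * W) * Q"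
    unfolding adj using W Q aW aQ by (simp add: assoc_mult_square[of _ n] mult_carrier_square[of _ n])
  then have 1: "mat_adjoint (W * Q) * (W * Q) = 1\<^sub>m n" unfolding WW right_mult_one_mat[OF aQ] QQ .
  have "mat_adjoint (W * Q) * A * (W * Q) = mat_adjoint Q * A' * Q"
    unfolding adj A'_def using W Q aW aQ A by (simp add: assoc_mult_square[of _ n] mult_carrier_square[of _ n])
  with 1 QAQ show ?case using W Q by (intro bexI[of _ "W * Q"]) auto
qed

text \<open>Over the complex numbers: the eigenvalues of a Hermitian matrix are real.\<close>

lemma diagonal_conjugate_invariant:
  fixes A :: "'a::conjugatable_ordered_field mat"
  assumes "A \<in> carrier_mat n n" "P \<in> carrier_mat n n" "mat_adjoint A = A"
    "mat_adjoint P * A * P = mat_diag n f" "i < n"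
  shows "conjugate (f i) = f i"
proof -
  have aP: "mat_adjoint P \<in> carrier_mat n n" using assms(2) by simp
  have "mat_adjoint (mat_adjoint P * A * P) = mat_adjoint P * A * P"
    by (simp add: mat_adjoint_mult[OF aP mult_carrier_mat[OF assms(1,2)]] mat_adjoint_mult[OF assms(1,2)]
        assms(3) assoc_mult_mat[OF aP assms(1,2)])
  then have "mat_adjoint (mat_diag n f) $$ (i, i) = mat_diag n f $$ (i, i)"
    using assms(4) by simp
  then show ?thesis using assms(5) by (simp add: mat_diag_def)
qed

lemma unit_multiple_complex: "\<forall>v :: complex vec. v \<noteq> 0\<^sub>v (dim_vec v) \<longrightarrow> (\<exists>c. c * conjugate c * (v \<bullet>c v) = 1)"
proof (intro allI impI)
  fix v :: "complex vec" assume "v \<noteq> 0\<^sub>v (dim_vec v)"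
  then have "v \<bullet>c v > 0" using conjugate_square_greater_0_vec carrier_vec_dim_vec by blast
  then obtain r where r: "v \<bullet>c v = of_real r" "r > 0"
    using that[of "Re (v \<bullet>c v)"] by (auto simp: less_complex_def complex_eq_iff)
  have "1 / sqrt r * (1 / sqrt r) * r = 1" using r(2) by simp
  then have "complex_of_real (1 / sqrt r) * of_real (1 / sqrt r) * of_real r = 1"
    by (metis of_real_1 of_real_mult)
  then have "of_real (1 / sqrt r) * conjugate (of_real (1 / sqrt r)) * (v \<bullet>c v) = (1::complex)"
    unfolding r(1) by simp
  then show "\<exists>c. c * conjugate c * (v \<bullet>c v) = 1" by blast
qed

lemma unit_multiple_real: "\<forall>v :: real vec. v \<noteq> 0\<^sub>v (dim_vec v) \<longrightarrow> (\<exists>c. c * conjugate c * (v \<bullet>c v) = 1)"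
proof (intro allI impI)
  fix v :: "real vec" assume "v \<noteq> 0\<^sub>v (dim_vec v)"
  then have "v \<bullet>c v > 0" using conjugate_square_greater_0_vec carrier_vec_dim_vec by blast
  then have "1 / sqrt (v \<bullet>c v) * conjugate (1 / sqrt (v \<bullet>c v)) * (v \<bullet>c v) = 1"
    by simp
  then show "\<exists>c. c * conjugate c * (v \<bullet>c v) = 1" by blast
qed

text \<open>The factorization of a characteristic polynomial is blind to order, so the eigenvalues
  may be sorted before the matrix is diagonalized.\<close>

lemma prod_list_sort_key: "(\<Prod>e\<leftarrow>sort_key k es. [:- e, 1:]) = (\<Prod>e\<leftarrow>es. [:- e, 1 :: 'a::comm_ring_1:])"
  unfolding prod_mset_prod_list[symmetric] mset_map mset_sort ..

lemma sorted_sort_key_nth: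
  fixes k :: "'a \<Rightarrow> real"
  assumes "i \<le> j" "j < length xs"
  shows "k (sort_key (\<lambda>x. - k x) xs ! j) \<le> k (sort_key (\<lambda>x. - k x) xs ! i)"
  using sorted_nth_mono[OF sorted_sort_key[of "\<lambda>x. - k x" xs], of i j] assms by simp

lemma char_poly_length:
  assumes "A \<in> carrier_mat n n" "char_poly A = (\<Prod>e\<leftarrow>es. [:- e, 1 :: 'a::field:])"
  shows "length es = n"
  using assms(2) degree_monic_char_poly[OF assms(1)] degree_linear_factors[of uminus es] by simp

text \<open>Sorting by absolute value puts the nonzero eigenvalues in front; in the equality cases
  this moves the support to the indices 0 and 1.\<close>

theorem hermitian_spectral:
  assumes A: "A \<in> carrier_mat n n" "mat_adjoint A = A"
  obtains P \<mu> where "P \<in> unitary_matrices n"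
    "mat_adjoint P * A * P = mat_diag n (\<lambda>i. complex_of_real (\<mu> i))"
    "\<forall>i j. i \<le> j \<longrightarrow> j < n \<longrightarrow> \<bar>\<mu> j\<bar> \<le> \<bar>\<mu> i\<bar>"
proof -
  obtain es0 where es0: "char_poly A = (\<Prod>a\<leftarrow>es0. [:- a, 1:])"
    using char_poly_factorized[OF A(1)] by blast
  define es where "es = sort_key (\<lambda>x. - cmod x) es0"
  have es: "char_poly A = (\<Prod>a\<leftarrow>es. [:- a, 1:])" unfolding es_def prod_list_sort_key es0 ..
  obtain P where P: "P \<in> carrier_mat n n" "mat_adjoint P * P = 1\<^sub>m n"
    and diag: "mat_adjoint P * A * P = mat_diag n (\<lambda>i. es ! i)"
    using hermitian_diagonalization_ordered_field[OF unit_multiple_complex A es] by (elim bexE conjE)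
  have "P * mat_adjoint P = 1\<^sub>m n"
    using mat_mult_left_right_inverse[OF mat_adjoint_carrier[OF P(1)] P(1) P(2)] .
  then have U: "P \<in> unitary_matrices n" using P by (simp add: unitary_matrices_def)
  have re: "Im (es ! i) = 0" if "i < n" for i
    using diagonal_conjugate_invariant[OF A(1) P(1) A(2) diag that] by (simp add: complex_eq_iff)
  have "mat_adjoint P * A * P = mat_diag n (\<lambda>i. complex_of_real (Re (es ! i)))"
    unfolding diag by (intro eq_matI) (auto simp: mat_diag_def complex_eq_iff re)
  moreover have "\<bar>Re (es ! j)\<bar> \<le> \<bar>Re (es ! i)\<bar>" if "i \<le> j" "j < n" for i j
  proof -
    have "cmod (es ! j) \<le> cmod (es ! i)"
      unfolding es_def using that char_poly_length[OF A(1) es0] by (intro sorted_sort_key_nth) auto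
    then show ?thesis using re[of i] re[of j] that by (simp add: cmod_eq_Re)
  qed
  ultimately show ?thesis by (intro that[OF U]) auto
qed

text \<open>The point is that the characteristic polynomial splits over the reals: the complexified
  matrix is Hermitian, so its roots are real, and the factorization is pulled back coefficient by
  coefficient. Deflation over the reals then yields an orthogonal matrix. The decreasing order
  becomes that of the squared norms when \<open>G\<close> is a Gram matrix.\<close>

theorem symmetric_spectral:
  fixes G :: "real mat"
  assumes G: "G \<in> carrier_mat n n" "transpose_mat G = G"
  obtains R \<mu> where "R \<in> orthogonal_matrices n"
    "transpose_mat R * G * R = mat_diag n \<mu>"
    "\<forall>i j. i \<le> j \<longrightarrow> j < n \<longrightarrow> \<mu> j \<le> \<mu> i"
proof -
  have adj_real: "mat_adjoint M = transpose_mat M" for M :: "real mat"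
    by (intro eq_matI) auto
  have Gc: "map_mat complex_of_real G \<in> carrier_mat n n" using G by simp
  have Gh: "mat_adjoint (map_mat complex_of_real G) = map_mat complex_of_real G"
  proof (rule eq_matI)
    fix i j assume "i < dim_row (map_mat complex_of_real G)" "j < dim_col (map_mat complex_of_real G)"
    then show "mat_adjoint (map_mat complex_of_real G) $$ (i, j) = map_mat complex_of_real G $$ (i, j)"
      using G(1) arg_cong[OF G(2), of "\<lambda>M. M $$ (i, j)"] by simp
  qed (use G(1) in auto)
  obtain cs where cs: "char_poly (map_mat complex_of_real G) = (\<Prod>a\<leftarrow>cs. [:- a, 1:])"
    using char_poly_factorized[OF Gc] by blast
  obtain P where P: "P \<in> carrier_mat n n"
    and diag: "mat_adjoint P * map_mat complex_of_real G * P = mat_diag n (\<lambda>i. cs ! i)"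
    using hermitian_diagonalization_ordered_field[OF unit_multiple_complex Gc Gh cs] by (elim bexE conjE)
  have re: "Im (cs ! i) = 0" if "i < n" for i
    using diagonal_conjugate_invariant[OF Gc P Gh diag that] by (simp add: complex_eq_iff)
  have len: "length cs = n" using char_poly_length[OF Gc cs] .
  have "map (complex_of_real \<circ> Re) cs = cs" using re len by (intro nth_equalityI) (auto simp: complex_eq_iff)
  then have cs': "cs = map complex_of_real (map Re cs)" by (metis map_map)
  have split: "map_poly complex_of_real (\<Prod>a\<leftarrow>rs. [:- a, 1:]) = (\<Prod>a\<leftarrow>map complex_of_real rs. [:- a, 1:])" for rs
    
  proof (induction rs)
    case (Cons a rs)
    have "coeff (\<Prod>a\<leftarrow>map complex_of_real rs. [:- a, 1:]) k = of_real (coeff (\<Prod>a\<leftarrow>rs. [:- a, 1:]) k)" for k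
      unfolding Cons[symmetric] by (rule of_real_hom.coeff_map_poly_hom)
    then show ?case
      by (intro poly_eqI) (simp add: coeff_pCons del: map_map split: nat.split)
  qed simp
  have "map_poly complex_of_real (char_poly G) = map_poly complex_of_real (\<Prod>a\<leftarrow>map Re cs. [:- a, 1:])"
    unfolding split cs'[symmetric] of_real_hom.char_poly_hom[OF G(1), symmetric] by (rule cs)
  then have "coeff (char_poly G) k = coeff (\<Prod>a\<leftarrow>map Re cs. [:- a, 1:]) k" for k
    by (metis of_real_hom.coeff_map_poly_hom of_real_eq_iff)
  then have es0: "char_poly G = (\<Prod>a\<leftarrow>map Re cs. [:- a, 1:])"
    by (rule poly_eqI)
  have Gsym: "mat_adjoint G = G" by (simp add: adj_real G(2))
  define es where "es = sort_key (\<lambda>x. - x) (map Re cs)"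
  have es: "char_poly G = (\<Prod>a\<leftarrow>es. [:- a, 1:])" unfolding es_def prod_list_sort_key es0 ..
  obtain R where R: "R \<in> carrier_mat n n" "mat_adjoint R * R = 1\<^sub>m n"
    and diag: "mat_adjoint R * G * R = mat_diag n (\<lambda>i. es ! i)"
    using hermitian_diagonalization_ordered_field[OF unit_multiple_real G(1) Gsym es] by (elim bexE conjE)
  have "R * mat_adjoint R = 1\<^sub>m n"
    using mat_mult_left_right_inverse[OF mat_adjoint_carrier[OF R(1)] R(1) R(2)] .
  then have "R \<in> orthogonal_matrices n" using R by (simp add: orthogonal_matrices_def adj_real)
  moreover have "es ! j \<le> es ! i" if "i \<le> j" "j < n" for i j
    using sorted_sort_key_nth[of i j "map Re cs" "\<lambda>x. x"] that len by (simp add: es_def)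
  ultimately show ?thesis using diag[unfolded adj_real] by (intro that[of R "\<lambda>i. es ! i"]) auto
qed

section \<open>Traces, Frobenius norms and unitary conjugation\<close>

abbreviation (input) norm_sq :: "complex mat \<Rightarrow> real" where
  "norm_sq A \<equiv> (frob_norm A)\<^sup>2"

abbreviation (input) comm_sq :: "complex mat \<Rightarrow> complex mat \<Rightarrow> real" where
  "comm_sq A B \<equiv> (frob_norm (mat_commutator A B))\<^sup>2"

lemma mat_adjoint_minus:
  fixes A :: "complex mat"
  assumes "A \<in> carrier_mat r c" "B \<in> carrier_mat r c"
  shows "mat_adjoint (A - B) = mat_adjoint A - mat_adjoint B"
  using assms by (intro eq_matI) auto

lemma mat_adjoint_add:
  fixes A :: "complex mat"
  assumes "A \<in> carrier_mat r c" "B \<in> carrier_mat r c"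
  shows "mat_adjoint (A + B) = mat_adjoint A + mat_adjoint B"
  using assms by (intro eq_matI) auto

lemma mat_trace_add:
  "A \<in> carrier_mat n n \<Longrightarrow> B \<in> carrier_mat n n \<Longrightarrow> mat_trace (A + B) = mat_trace A + mat_trace B"
  by (simp add: mat_trace_def sum.distrib)

lemma mat_trace_mult_sum:
  assumes "A \<in> carrier_mat n k" "B \<in> carrier_mat k n"
  shows "mat_trace (A * B) = (\<Sum>i<n. \<Sum>j<k. A $$ (i, j) * B $$ (j, i))"
  using assms by (simp add: mat_trace_def scalar_prod_def atLeast0LessThan)

lemma mat_trace_comm:
  assumes "A \<in> carrier_mat n k" "B \<in> carrier_mat k n"
  shows "mat_trace (A * B) = mat_trace (B * A)"
  unfolding mat_trace_mult_sum[OF assms] mat_trace_mult_sum[OF assms(2,1)]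
  by (subst sum.swap) (simp add: mult.commute)

lemma mat_trace_adjoint: "A \<in> carrier_mat n n \<Longrightarrow> mat_trace (mat_adjoint A) = cnj (mat_trace A)"
  by (simp add: mat_trace_def)

lemma mat_trace_diff_mult:
  assumes "A \<in> carrier_mat n n" "B \<in> carrier_mat n n" "C \<in> carrier_mat n n" "D \<in> carrier_mat n n"
  shows "mat_trace ((A - B) * (C - D)) =
    mat_trace (A * C) - mat_trace (A * D) - mat_trace (B * C) + mat_trace (B * D)"
proof -
  have "A - B \<in> carrier_mat n n" "C - D \<in> carrier_mat n n" using assms by auto
  then show ?thesis
    using assms by (simp add: mat_trace_mult_sum[of _ n n] ring_distribs sum.distrib sum_subtractf)
qed

lemma mat_trace_add_mult:
  assumes "A \<in> carrier_mat n n" "B \<in> carrier_mat n n" "C \<in> carrier_mat n n" "D \<in> carrier_mat n n"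
  shows "mat_trace ((A + B) * (C + D)) =
    mat_trace (A * C) + mat_trace (A * D) + mat_trace (B * C) + mat_trace (B * D)"
proof -
  have "A + B \<in> carrier_mat n n" "C + D \<in> carrier_mat n n" using assms by auto
  then show ?thesis
    using assms by (simp add: mat_trace_mult_sum[of _ n n] ring_distribs sum.distrib)
qed

lemma mat_trace_cyclic:
  assumes "A \<in> carrier_mat n n" "B \<in> carrier_mat n n" "C \<in> carrier_mat n n" "D \<in> carrier_mat n n"
  shows "mat_trace (A * B * (C * D)) = mat_trace (B * C * (D * A))"
  using assms mat_trace_comm[of A n n "B * (C * D)"]
  by (simp add: assoc_mult_square[of _ n] mult_carrier_square[of _ n])

lemma mat_commutator_carrier [simp]:
  "A \<in> carrier_mat n n \<Longrightarrow> B \<in> carrier_mat n n \<Longrightarrow> mat_commutator A B \<in> carrier_mat n n"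
  unfolding mat_commutator_def by (intro minus_carrier_mat mult_carrier_square[of _ n])

lemma frob_norm_sum:
  assumes "A \<in> carrier_mat n k"
  shows "norm_sq A = (\<Sum>i<n. \<Sum>j<k. (cmod (A $$ (i, j)))\<^sup>2)"
  using assms by (simp add: frob_norm_def frob_inner_self sum_nonneg)

lemma frob_norm_nonneg [simp]: "0 \<le> frob_norm A"
  by (simp add: frob_norm_def frob_inner_self sum_nonneg)

lemma frob_norm_trace: "norm_sq A = Re (mat_trace (A * mat_adjoint A))"
  by (simp flip: frob_norm_squared)

lemma frob_inner_sum:
  assumes "A \<in> carrier_mat n k" "B \<in> carrier_mat n k"
  shows "frob_inner A B = (\<Sum>i<n. \<Sum>j<k. A $$ (i, j) * cnj (B $$ (i, j)))"
  unfolding frob_inner_def using assms by (simp add: mat_trace_mult_sum[of _ n k])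

lemma frob_norm_eq_0:
  assumes "A \<in> carrier_mat n k" "frob_norm A = 0"
  shows "A = 0\<^sub>m n k"
proof -
  have "(\<Sum>i<n. \<Sum>j<k. (cmod (A $$ (i, j)))\<^sup>2) = 0" using frob_norm_sum[OF assms(1)] assms(2) by simp
  then have "\<forall>i<n. \<forall>j<k. A $$ (i, j) = 0"
    by (simp add: sum_nonneg_eq_0_iff sum_nonneg)
  then show ?thesis using assms(1) by (intro eq_matI) auto
qed

lemma frob_norm_adjoint: "A \<in> carrier_mat n n \<Longrightarrow> frob_norm (mat_adjoint A) = frob_norm A"
  unfolding frob_norm_def frob_inner_def by (simp add: mat_trace_comm[of _ n n])

lemma frob_norm_commutator_commute:
  assumes "A \<in> carrier_mat n n" "B \<in> carrier_mat n n"
  shows "frob_norm (mat_commutator B A) = frob_norm (mat_commutator A B)"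
proof -
  have AB: "A * B \<in> carrier_mat n n" "B * A \<in> carrier_mat n n" using assms by auto
  have "comm_sq B A = comm_sq A B"
    unfolding frob_norm_sum[OF mat_commutator_carrier[OF assms]] frob_norm_sum[OF mat_commutator_carrier[OF assms(2,1)]]
    unfolding mat_commutator_def using AB by (simp add: norm_minus_commute del: index_mult_mat)
  then show ?thesis by simp
qed

lemma frob_norm_parallelogram:
  assumes "A \<in> carrier_mat n n" "B \<in> carrier_mat n n"
  shows "norm_sq (A + B) + norm_sq (A - B) = 2 * norm_sq A + 2 * norm_sq B"
proof -
  have "(cmod (a + b))\<^sup>2 + (cmod (a - b))\<^sup>2 = 2 * (cmod a)\<^sup>2 + 2 * (cmod b)\<^sup>2" for a b
    unfolding cmod_power2 by (simp add: power2_eq_square algebra_simps)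
  moreover have "A + B \<in> carrier_mat n n" "A - B \<in> carrier_mat n n" using assms by auto
  ultimately show ?thesis
    unfolding frob_norm_sum[OF assms(1)] frob_norm_sum[OF assms(2)] sum_distrib_left
    by (simp only: frob_norm_sum sum.distrib[symmetric]) (intro sum.cong refl, use assms in auto)
qed

lemma frob_norm_smult: "norm_sq (a \<cdot>\<^sub>m A) = (cmod a)\<^sup>2 * norm_sq A"
  by (simp add: frob_norm_sum[OF carrier_matI[OF refl refl]] norm_mult power_mult_distrib sum_distrib_left)

text \<open>Two of the four traces in the expansion are conjugates of each other; they merge into
  twice the real part of the trace of \<open>X * Y * (X' * Y')\<close>, a term that also occurs in
  the anticommutator expansion.\<close>

lemma frob_norm_commutator_trace:
  assumes X: "X \<in> carrier_mat n n" and Y: "Y \<in> carrier_mat n n"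
  defines "X' \<equiv> mat_adjoint X" and "Y' \<equiv> mat_adjoint Y"
  shows "comm_sq X Y =
    Re (mat_trace (X' * X * (Y * Y')) + mat_trace (X * X' * (Y' * Y)) - 2 * mat_trace (X * Y * (X' * Y')))"
proof -
  have X': "X' \<in> carrier_mat n n" and Y': "Y' \<in> carrier_mat n n" using X Y by (auto simp: X'_def Y'_def)
  note c = mult_carrier_square[of _ n, where ?'a=complex]
  have "mat_adjoint (mat_commutator X Y) = Y' * X' - X' * Y'"
    unfolding mat_commutator_def X'_def Y'_def
    by (simp add: mat_adjoint_minus[OF c[OF X Y] c[OF Y X]] mat_adjoint_mult[OF X Y] mat_adjoint_mult[OF Y X])
  then have "comm_sq X Y = Re (mat_trace ((X * Y - Y * X) * (Y' * X' - X' * Y')))"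
    unfolding frob_norm_trace by (simp add: mat_commutator_def)
  also have "mat_trace ((X * Y - Y * X) * (Y' * X' - X' * Y')) =
    mat_trace (X * Y * (Y' * X')) - mat_trace (X * Y * (X' * Y')) - mat_trace (Y * X * (Y' * X')) + mat_trace (Y * X * (X' * Y'))"
    by (rule mat_trace_diff_mult[OF c[OF X Y] c[OF Y X] c[OF Y' X'] c[OF X' Y']])
  also have "mat_trace (Y * X * (Y' * X')) = cnj (mat_trace (X * Y * (X' * Y')))"
  proof -
    have "mat_adjoint (X * Y * (X' * Y')) = Y * X * (Y' * X')"
      unfolding mat_adjoint_mult[OF c[OF X Y] c[OF X' Y']] mat_adjoint_mult[OF X Y] mat_adjoint_mult[OF X' Y']
      by (simp add: X'_def Y'_def)
    then show ?thesis using mat_trace_adjoint[OF c[OF c[OF X Y] c[OF X' Y']]] by simp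
  qed
  also have "mat_trace (X * Y * (Y' * X')) = mat_trace (X' * X * (Y * Y'))"
    using mat_trace_cyclic[OF X' X Y Y'] by simp
  also have "mat_trace (Y * X * (X' * Y')) = mat_trace (X * X' * (Y' * Y))"
    using mat_trace_cyclic[OF Y X X' Y'] by simp
  finally show ?thesis by simp
qed

lemma frob_norm_anticommutator_trace:
  assumes X: "X \<in> carrier_mat n n" and Y: "Y \<in> carrier_mat n n"
  defines "X' \<equiv> mat_adjoint X" and "Y' \<equiv> mat_adjoint Y"
  shows "norm_sq (X' * Y + Y * X') =
    Re (mat_trace (X * X' * (Y * Y')) + mat_trace (X' * X * (Y' * Y)) + 2 * mat_trace (X * Y * (X' * Y')))"
proof -
  have X': "X' \<in> carrier_mat n n" and Y': "Y' \<in> carrier_mat n n" using X Y by (auto simp: X'_def Y'_def)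
  note c = mult_carrier_square[of _ n, where ?'a=complex]
  have "mat_adjoint (X' * Y + Y * X') = Y' * X + X * Y'"
    by (simp add: mat_adjoint_add[OF c[OF X' Y] c[OF Y X']] mat_adjoint_mult[OF X' Y] mat_adjoint_mult[OF Y X'])
       (simp add: X'_def Y'_def)
  then have "norm_sq (X' * Y + Y * X') = Re (mat_trace ((X' * Y + Y * X') * (Y' * X + X * Y')))"
    unfolding frob_norm_trace by simp
  also have "mat_trace ((X' * Y + Y * X') * (Y' * X + X * Y')) =
    mat_trace (X' * Y * (Y' * X)) + mat_trace (X' * Y * (X * Y')) + mat_trace (Y * X' * (Y' * X)) + mat_trace (Y * X' * (X * Y'))"
    by (rule mat_trace_add_mult[OF c[OF X' Y] c[OF Y X'] c[OF Y' X] c[OF X Y']])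
  also have "mat_trace (Y * X' * (Y' * X)) = mat_trace (X * Y * (X' * Y'))"
    using mat_trace_cyclic[OF X Y X' Y'] by simp
  also have "mat_trace (X' * Y * (X * Y')) = cnj (mat_trace (X * Y * (X' * Y')))"
  proof -
    have "mat_adjoint (X * Y * (X' * Y')) = Y * X * (Y' * X')"
      unfolding mat_adjoint_mult[OF c[OF X Y] c[OF X' Y']] mat_adjoint_mult[OF X Y] mat_adjoint_mult[OF X' Y']
      by (simp add: X'_def Y'_def)
    then show ?thesis using mat_trace_adjoint[OF c[OF c[OF X Y] c[OF X' Y']]] mat_trace_cyclic[OF X' Y X Y'] by simp
  qed
  also have "mat_trace (X' * Y * (Y' * X)) = mat_trace (X * X' * (Y * Y'))"
    using mat_trace_cyclic[OF X X' Y Y'] by simp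
  also have "mat_trace (Y * X' * (X * Y')) = mat_trace (X' * X * (Y' * Y))"
    using mat_trace_cyclic[OF Y X' X Y'] by simp
  finally show ?thesis by simp
qed

text \<open>The mixed traces of the two expansions have opposite signs and cancel; the four that
  remain are the expansion of the product on the right.\<close>

lemma frob_norm_commutator_add_anticommutator:
  assumes X: "X \<in> carrier_mat n n" and Y: "Y \<in> carrier_mat n n"
  shows "comm_sq X Y + norm_sq (mat_adjoint X * Y + Y * mat_adjoint X) =
    Re (mat_trace ((mat_adjoint X * X + X * mat_adjoint X) * (Y * mat_adjoint Y + mat_adjoint Y * Y)))"
proof -
  have X': "mat_adjoint X \<in> carrier_mat n n" and Y': "mat_adjoint Y \<in> carrier_mat n n" using X Y by auto
  note c = mult_carrier_square[of _ n, where ?'a=complex]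
  show ?thesis
    unfolding frob_norm_commutator_trace[OF X Y] frob_norm_anticommutator_trace[OF X Y]
      mat_trace_add_mult[OF c[OF X' X] c[OF X X'] c[OF Y Y'] c[OF Y' Y]] by simp
qed

text \<open>Passing from \<open>Y\<close> to its adjoint conjugates the mixed trace and exchanges
  \<open>Y * mat_adjoint Y\<close> with \<open>mat_adjoint Y * Y\<close> in the others. The
  self-commutators in the equality condition of part (1) originate here.\<close>

lemma frob_norm_commutator_adjoint:
  assumes X: "X \<in> carrier_mat n n" and Y: "Y \<in> carrier_mat n n"
  shows "comm_sq X (mat_adjoint Y) = comm_sq X Y +
    Re (mat_trace (mat_commutator X (mat_adjoint X) * mat_commutator Y (mat_adjoint Y)))"
proof -
  note c = mult_carrier_square[of _ n, where ?'a=complex]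
  define X' where "X' = mat_adjoint X"
  define Y' where "Y' = mat_adjoint Y"
  have X': "X' \<in> carrier_mat n n" and Y': "Y' \<in> carrier_mat n n" using X Y by (auto simp: X'_def Y'_def)
  have "mat_trace (X * Y' * (X' * Y)) = cnj (mat_trace (X * Y * (X' * Y')))"
  proof -
    have "mat_adjoint (X * Y * (X' * Y')) = Y * X * (Y' * X')"
      unfolding mat_adjoint_mult[OF c[OF X Y] c[OF X' Y']] mat_adjoint_mult[OF X Y] mat_adjoint_mult[OF X' Y']
      by (simp add: X'_def Y'_def)
    then show ?thesis
      using mat_trace_adjoint[OF c[OF c[OF X Y] c[OF X' Y']]] mat_trace_cyclic[OF Y X Y' X'] by simp
  qed
  moreover have "mat_trace ((X * X' - X' * X) * (Y * Y' - Y' * Y)) =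
    mat_trace (X * X' * (Y * Y')) - mat_trace (X * X' * (Y' * Y)) - mat_trace (X' * X * (Y * Y')) + mat_trace (X' * X * (Y' * Y))"
    by (rule mat_trace_diff_mult[OF c[OF X X'] c[OF X' X] c[OF Y Y'] c[OF Y' Y]])
  ultimately show ?thesis
    unfolding frob_norm_commutator_trace[OF X Y] frob_norm_commutator_trace[OF X Y'[unfolded Y'_def]]
    by (simp add: mat_commutator_def X'_def Y'_def)
qed

section \<open>Unitary matrices and unitary conjugation\<close>

lemma unitary_carrier: "P \<in> unitary_matrices n \<Longrightarrow> P \<in> carrier_mat n n"
  by (simp add: unitary_matrices_def)

lemma unitary_adjoint: "P \<in> unitary_matrices n \<Longrightarrow> mat_adjoint P \<in> unitary_matrices n"
  by (simp add: unitary_matrices_def)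

lemma unitary_mult:
  assumes "P \<in> unitary_matrices n" "Q \<in> unitary_matrices n"
  shows "P * Q \<in> unitary_matrices n"
proof -
  have P: "P \<in> carrier_mat n n" "mat_adjoint P * P = 1\<^sub>m n" "P * mat_adjoint P = 1\<^sub>m n"
    and Q: "Q \<in> carrier_mat n n" "mat_adjoint Q * Q = 1\<^sub>m n" "Q * mat_adjoint Q = 1\<^sub>m n"
    using assms by (auto simp: unitary_matrices_def)
  have P': "mat_adjoint P \<in> carrier_mat n n" and Q': "mat_adjoint Q \<in> carrier_mat n n" using P Q by auto
  have "mat_adjoint Q * mat_adjoint P * (P * Q) = mat_adjoint Q * (mat_adjoint P * P) * Q"
    using P(1) Q(1) P' Q' by (simp add: assoc_mult_square[of _ n] mult_carrier_square[of _ n])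
  moreover have "P * Q * (mat_adjoint Q * mat_adjoint P) = P * (Q * mat_adjoint Q) * mat_adjoint P"
    using P(1) Q(1) P' Q' by (simp add: assoc_mult_square[of _ n] mult_carrier_square[of _ n])
  ultimately show ?thesis
    unfolding unitary_matrices_def mem_Collect_eq mat_adjoint_mult[OF P(1) Q(1)]
    using P(1) Q(1) P' Q' by (simp add: P Q mult_carrier_square[of _ n])
qed

definition unitary_conj :: "complex mat \<Rightarrow> complex mat \<Rightarrow> complex mat" where
  "unitary_conj P A = mat_adjoint P * A * P"

context
  fixes P :: "complex mat" and n :: nat
  assumes P: "P \<in> unitary_matrices n"
begin

lemma unitary_conj_carrier: "A \<in> carrier_mat n n \<Longrightarrow> unitary_conj P A \<in> carrier_mat n n"
  using unitary_carrier[OF P] by (simp add: unitary_conj_def mult_carrier_square[of _ n])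

lemma unitary_conj_mult:
  assumes "A \<in> carrier_mat n n" "B \<in> carrier_mat n n"
  shows "unitary_conj P (A * B) = unitary_conj P A * unitary_conj P B"
proof -
  note c = unitary_carrier[OF P] mat_adjoint_carrier[OF unitary_carrier[OF P]]
  have "unitary_conj P A * unitary_conj P B = mat_adjoint P * A * (P * mat_adjoint P) * B * P"
    using c assms by (simp add: unitary_conj_def assoc_mult_square[of _ n] mult_carrier_square[of _ n])
  also have "\<dots> = mat_adjoint P * A * B * P"
    using P c assms by (simp add: unitary_matrices_def mult_carrier_square[of _ n])
  also have "\<dots> = unitary_conj P (A * B)"
    using c assms by (simp add: unitary_conj_def assoc_mult_square[of _ n] mult_carrier_square[of _ n])
  finally show ?thesis ..
qed

lemma unitary_conj_minus:
  assumes "A \<in> carrier_mat n n" "B \<in> carrier_mat n n"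
  shows "unitary_conj P (A - B) = unitary_conj P A - unitary_conj P B"
  using unitary_carrier[OF P] assms
  by (simp add: unitary_conj_def mult_minus_distrib_mat[of _ n n] minus_mult_distrib_mat[of _ n n]
      mult_carrier_square[of _ n])

lemma unitary_conj_commutator:
  assumes "A \<in> carrier_mat n n" "B \<in> carrier_mat n n"
  shows "unitary_conj P (mat_commutator A B) = mat_commutator (unitary_conj P A) (unitary_conj P B)"
  using assms by (simp add: mat_commutator_def unitary_conj_mult unitary_conj_minus mult_carrier_square[of _ n])

lemma unitary_conj_adjoint:
  assumes "A \<in> carrier_mat n n"
  shows "mat_adjoint (unitary_conj P A) = unitary_conj P (mat_adjoint A)"
proof -
  note c = unitary_carrier[OF P] mat_adjoint_carrier[OF unitary_carrier[OF P]]
  show ?thesis unfolding unitary_conj_def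
    by (simp add: mat_adjoint_mult[OF mult_carrier_mat[OF c(2) assms] c(1)] mat_adjoint_mult[OF c(2) assms]
       assoc_mult_mat[OF c(2) mat_adjoint_carrier[OF assms] c(1)])
qed

lemma unitary_conj_trace:
  assumes "A \<in> carrier_mat n n"
  shows "mat_trace (unitary_conj P A) = mat_trace A"
proof -
  note c = unitary_carrier[OF P] mat_adjoint_carrier[OF unitary_carrier[OF P]]
  have "mat_trace (unitary_conj P A) = mat_trace (P * (mat_adjoint P * A))"
    unfolding unitary_conj_def by (rule mat_trace_comm[OF mult_carrier_mat[OF c(2) assms] c(1)])
  also have "P * (mat_adjoint P * A) = A"
    using P assms unfolding assoc_mult_mat[OF c assms, symmetric] by (simp add: unitary_matrices_def)
  finally show ?thesis .
qed

lemma unitary_conj_inner: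
  assumes "A \<in> carrier_mat n n" "B \<in> carrier_mat n n"
  shows "frob_inner (unitary_conj P A) (unitary_conj P B) = frob_inner A B"
  using assms unfolding frob_inner_def
  by (simp add: unitary_conj_adjoint unitary_conj_trace mult_carrier_square[of _ n] flip: unitary_conj_mult)

lemma unitary_conj_norm: "A \<in> carrier_mat n n \<Longrightarrow> frob_norm (unitary_conj P A) = frob_norm A"
  by (simp add: frob_norm_def unitary_conj_inner)

lemma unitary_conj_commutator_norm:
  assumes "A \<in> carrier_mat n n" "B \<in> carrier_mat n n"
  shows "frob_norm (mat_commutator (unitary_conj P A) (unitary_conj P B)) = frob_norm (mat_commutator A B)"
  using assms by (simp add: unitary_conj_norm flip: unitary_conj_commutator)

text \<open>Left unfolded because the required form \<open>mat_adjoint U * D * U\<close> is met with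
  \<open>U = mat_adjoint P\<close>.\<close>

lemma unitary_conj_inverse:
  assumes "A \<in> carrier_mat n n"
  shows "mat_adjoint (mat_adjoint P) * unitary_conj P A * mat_adjoint P = A"
proof -
  note c = unitary_carrier[OF P] mat_adjoint_carrier[OF unitary_carrier[OF P]]
  have "mat_adjoint (mat_adjoint P) * unitary_conj P A * mat_adjoint P = (P * mat_adjoint P) * A * (P * mat_adjoint P)"
    using c assms by (simp add: unitary_conj_def assoc_mult_square[of _ n] mult_carrier_square[of _ n])
  then show ?thesis using P assms by (simp add: unitary_matrices_def)
qed

end

section \<open>The inequality of Boettcher and Wenzel\<close>

lemma cmod_add_sq: "(cmod (a + b))\<^sup>2 = (cmod a)\<^sup>2 + (cmod b)\<^sup>2 + 2 * Re (a * cnj b)"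
  unfolding cmod_power2 by (simp add: power2_eq_square algebra_simps)

lemma cmod_diff_sq: "(cmod (a - b))\<^sup>2 = (cmod a)\<^sup>2 + (cmod b)\<^sup>2 - 2 * Re (a * cnj b)"
  unfolding cmod_power2 by (simp add: power2_eq_square algebra_simps)

lemma cmod_sum_sq:
  "(cmod (\<Sum>i\<in>I. f i))\<^sup>2 = (\<Sum>i\<in>I. \<Sum>j\<in>I. Re (f i * cnj (f j)))"
proof -
  have "(cmod (\<Sum>i\<in>I. f i))\<^sup>2 = Re ((\<Sum>i\<in>I. f i) * cnj (\<Sum>i\<in>I. f i))"
    by (simp only: complex_norm_square[symmetric] Re_complex_of_real)
  then show ?thesis by (simp only: cnj_sum sum_product Re_sum)
qed

lemma cauchy_schwarz_complex:
  fixes f g :: "'a \<Rightarrow> complex"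
  shows "(cmod (\<Sum>x\<in>A. f x * cnj (g x)))\<^sup>2 \<le> (\<Sum>x\<in>A. (cmod (f x))\<^sup>2) * (\<Sum>x\<in>A. (cmod (g x))\<^sup>2)"
proof (cases "finite A \<and> (\<Sum>x\<in>A. (cmod (g x))\<^sup>2) \<noteq> 0")
  case False
  then show ?thesis
    by (cases "finite A") (auto simp: sum_nonneg_eq_0_iff)
next
  case True
  define F where "F = (\<Sum>x\<in>A. (cmod (f x))\<^sup>2)"
  define G where "G = (\<Sum>x\<in>A. (cmod (g x))\<^sup>2)"
  define c where "c = (\<Sum>x\<in>A. f x * cnj (g x))"
  have G: "G > 0" using True unfolding G_def by (metis order_le_less sum_nonneg zero_le_power2)
  \<comment> \<open>\<open>G * f x - c * g x\<close> is \<open>G\<close> times the component of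
    \<open>f\<close> orthogonal to \<open>g\<close>.\<close>
  have "0 \<le> (\<Sum>x\<in>A. (cmod (G * f x - c * g x))\<^sup>2)" by (simp add: sum_nonneg)
  also have "\<dots> = (\<Sum>x\<in>A. G\<^sup>2 * (cmod (f x))\<^sup>2 + (cmod c)\<^sup>2 * (cmod (g x))\<^sup>2 - 2 * G * Re (cnj c * (f x * cnj (g x))))"
    by (intro sum.cong refl) (simp add: cmod_diff_sq norm_mult power_mult_distrib, simp add: algebra_simps)
  also have "\<dots> = G\<^sup>2 * F + (cmod c)\<^sup>2 * G - 2 * G * Re (cnj c * c)"
    unfolding F_def G_def[symmetric] c_def[symmetric] sum.distrib sum_subtractf sum_distrib_left[symmetric] Re_sum[symmetric] ..
  also have "Re (cnj c * c) = (cmod c)\<^sup>2"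
    unfolding cmod_power2 by (simp add: power2_eq_square)
  finally have "0 \<le> G * (F * G - (cmod c)\<^sup>2)" by (simp add: power2_eq_square algebra_simps)
  then show ?thesis using G by (simp add: zero_le_mult_iff F_def G_def c_def)
qed

lemma frob_inner_cauchy_schwarz:
  assumes "A \<in> carrier_mat n n" "B \<in> carrier_mat n n"
  shows "(cmod (frob_inner A B))\<^sup>2 \<le> norm_sq A * norm_sq B"
  using cauchy_schwarz_complex[of "\<lambda>ij. A $$ ij" "\<lambda>ij. B $$ ij" "{..<n} \<times> {..<n}"] assms
  by (simp add: frob_inner_sum[of _ n n] frob_norm_sum[of _ n n] sum.cartesian_product split_def)

text \<open>With the weights \<open>p i = g i / (2 N)\<close> this is the variance bound
  \<open>Var X \<le> norm X ^ 2 / 2\<close>, written as a sum of nonnegative terms from which the equality case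
  is read off.\<close>

lemma weighted_variance_identity:
  fixes g :: "nat \<Rightarrow> real" and X :: "nat \<Rightarrow> nat \<Rightarrow> complex"
  assumes "(\<Sum>i<n. g i) = 2 * N"
  shows "2 * N\<^sup>2 * (\<Sum>i<n. \<Sum>j<n. (cmod (X i j))\<^sup>2) - N * (\<Sum>i<n. \<Sum>j<n. (g i + g j) * (cmod (X i j))\<^sup>2)
      + (cmod (\<Sum>i<n. g i * X i i))\<^sup>2 =
    (\<Sum>i<n. \<Sum>j<n. if i = j then 2 * ((N - g i) * cmod (X i i))\<^sup>2
      else N * (2 * N - g i - g j) * (cmod (X i j))\<^sup>2 + g i * g j * (cmod (X i i + X j j))\<^sup>2 / 2)"
    (is "?L = ?R")
proof -
  let ?a = "\<lambda>i j. (cmod (X i j))\<^sup>2"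
  have diag: "cmod (X i i + X i i) = 2 * cmod (X i i)" for i
    by (metis mult_2 norm_mult norm_numeral)
  \<comment> \<open>At \<open>i = j\<close> the expression for \<open>i \<noteq> j\<close> exceeds
    the diagonal one by \<open>2 * N * g i * ?a i i\<close>. This surplus finally cancels against a
    part of the expanded squares of \<open>cmod (X i i + X j j)\<close>.\<close>
  have "?R = (\<Sum>i<n. \<Sum>j<n. N * (2 * N - g i - g j) * ?a i j + g i * g j * (cmod (X i i + X j j))\<^sup>2 / 2
      - (if i = j then 2 * N * g i * ?a i i else 0))"
    by (intro sum.cong refl) (auto simp: diag power2_eq_square algebra_simps)
  also have "\<dots> = (\<Sum>i<n. \<Sum>j<n. N * (2 * N - g i - g j) * ?a i j)
      + (\<Sum>i<n. \<Sum>j<n. g i * g j * (cmod (X i i + X j j))\<^sup>2 / 2) - (\<Sum>i<n. 2 * N * g i * ?a i i)"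
    by (simp add: sum.distrib sum_subtractf)
  also have "(\<Sum>i<n. \<Sum>j<n. N * (2 * N - g i - g j) * ?a i j) =
      (\<Sum>i<n. \<Sum>j<n. 2 * N\<^sup>2 * ?a i j - N * ((g i + g j) * ?a i j))"
    by (intro sum.cong refl) (simp add: power2_eq_square algebra_simps)
  also have "\<dots> = 2 * N\<^sup>2 * (\<Sum>i<n. \<Sum>j<n. ?a i j) - N * (\<Sum>i<n. \<Sum>j<n. (g i + g j) * ?a i j)"
    by (simp add: sum_subtractf sum_distrib_left)
  also have "(\<Sum>i<n. \<Sum>j<n. g i * g j * (cmod (X i i + X j j))\<^sup>2 / 2) =
      (\<Sum>i<n. \<Sum>j<n. (g i * ?a i i) * g j / 2 + g i * (g j * ?a j j) / 2 + Re ((g i * X i i) * cnj (g j * X j j)))"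
    by (intro sum.cong refl) (simp add: cmod_add_sq algebra_simps)
  also have "\<dots> = (\<Sum>i<n. g i * ?a i i) * (\<Sum>j<n. g j) / 2 + (\<Sum>i<n. g i) * (\<Sum>j<n. g j * ?a j j) / 2
      + (cmod (\<Sum>i<n. g i * X i i))\<^sup>2"
    unfolding cmod_sum_sq sum_product by (simp only: sum.distrib sum_divide_distrib)
  also have "\<dots> = (\<Sum>i<n. 2 * N * g i * ?a i i) + (cmod (\<Sum>i<n. g i * X i i))\<^sup>2"
    unfolding assms by (simp add: sum_distrib_left mult_ac)
  finally show ?thesis by simp
qed

lemma sum_two_nat:
  fixes f :: "nat \<Rightarrow> real"
  assumes "\<And>k. k < n \<Longrightarrow> 0 \<le> f k" "i < n" "j < n" "i \<noteq> j"
  shows "f i + f j \<le> (\<Sum>k<n. f k)"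
proof -
  have "sum f {i, j} \<le> sum f {..<n}" using assms by (intro sum_mono2) auto
  then show ?thesis using assms(4) by simp
qed

context
  fixes n :: nat and X Y :: "complex mat" and g :: "nat \<Rightarrow> real"
  assumes X: "X \<in> carrier_mat n n" and Y: "Y \<in> carrier_mat n n"
    and g: "Y * mat_adjoint Y + mat_adjoint Y * Y = mat_diag n (\<lambda>i. complex_of_real (g i))"
begin

text \<open>A vanishing weight thus clears row and column \<open>i\<close> of \<open>Y\<close>; this
  is how \<open>Y\<close> is confined in the equality case.\<close>

lemma diag_weight:
  assumes "i < n"
  shows "g i = (\<Sum>j<n. (cmod (Y $$ (i, j)))\<^sup>2 + (cmod (Y $$ (j, i)))\<^sup>2)"
proof -
  have "complex_of_real (g i) = (Y * mat_adjoint Y + mat_adjoint Y * Y) $$ (i, i)"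
    unfolding g using assms by (simp add: mat_diag_def)
  also have "\<dots> = complex_of_real (\<Sum>j<n. (cmod (Y $$ (i, j)))\<^sup>2 + (cmod (Y $$ (j, i)))\<^sup>2)"
    using assms Y by (simp add: scalar_prod_def atLeast0LessThan sum.distrib complex_norm_square mult.commute
        del: of_real_power)
  finally show ?thesis using of_real_eq_iff by blast
qed

lemma diag_weight_nonneg: "i < n \<Longrightarrow> 0 \<le> g i"
  by (simp add: diag_weight sum_nonneg)

lemma diag_weight_sum: "(\<Sum>i<n. g i) = 2 * norm_sq Y"
proof -
  have "(\<Sum>i<n. g i) = (\<Sum>i<n. \<Sum>j<n. (cmod (Y $$ (i, j)))\<^sup>2) + (\<Sum>i<n. \<Sum>j<n. (cmod (Y $$ (j, i)))\<^sup>2)"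
    by (simp add: diag_weight sum.distrib)
  also have "(\<Sum>i<n. \<Sum>j<n. (cmod (Y $$ (j, i)))\<^sup>2) = (\<Sum>i<n. \<Sum>j<n. (cmod (Y $$ (i, j)))\<^sup>2)"
    by (rule sum.swap)
  finally show ?thesis by (simp add: frob_norm_sum[OF Y])
qed

text \<open>This keeps the coefficient of \<open>(cmod (X $$ (i, j)))\<^sup>2\<close> in
  \<open>bw_term\<close> nonnegative.\<close>

lemma diag_weight_pair: "i < n \<Longrightarrow> j < n \<Longrightarrow> i \<noteq> j \<Longrightarrow> g i + g j \<le> 2 * norm_sq Y"
  using sum_two_nat[of n g i j] diag_weight_nonneg diag_weight_sum by simp

text \<open>As the weight matrix is diagonal, only the diagonal of
  \<open>mat_adjoint X * X + X * mat_adjoint X\<close> enters the trace.\<close>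

lemma bw_norm_sum:
  "comm_sq X Y + norm_sq (mat_adjoint X * Y + Y * mat_adjoint X) =
    (\<Sum>i<n. \<Sum>j<n. (g i + g j) * (cmod (X $$ (i, j)))\<^sup>2)"
proof -
  let ?M = "mat_adjoint X * X + X * mat_adjoint X"
  have M: "?M \<in> carrier_mat n n" using X by (intro add_carrier_mat mult_carrier_square[of _ n]) auto
  have entry: "?M $$ (i, i) = of_real (\<Sum>j<n. (cmod (X $$ (j, i)))\<^sup>2 + (cmod (X $$ (i, j)))\<^sup>2)" if "i < n" for i
    using that X by (simp add: scalar_prod_def atLeast0LessThan sum.distrib complex_norm_square mult.commute
        del: of_real_power)
  have "mat_trace (?M * mat_diag n (\<lambda>i. complex_of_real (g i))) =
      (\<Sum>i<n. of_real (\<Sum>j<n. (cmod (X $$ (j, i)))\<^sup>2 + (cmod (X $$ (i, j)))\<^sup>2) * of_real (g i))"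
    unfolding mat_diag_mult_right[OF M] mat_trace_def
    by (simp del: index_mult_mat index_add_mat of_real_sum add: entry)
  also have "\<dots> = of_real (\<Sum>i<n. (\<Sum>j<n. (cmod (X $$ (j, i)))\<^sup>2 + (cmod (X $$ (i, j)))\<^sup>2) * g i)"
    by simp
  finally have "Re (mat_trace (?M * (Y * mat_adjoint Y + mat_adjoint Y * Y))) =
      (\<Sum>i<n. (\<Sum>j<n. (cmod (X $$ (j, i)))\<^sup>2 + (cmod (X $$ (i, j)))\<^sup>2) * g i)"
    unfolding g by (simp only: Re_complex_of_real)
  also have "\<dots> = (\<Sum>i<n. \<Sum>j<n. g i * (cmod (X $$ (j, i)))\<^sup>2) + (\<Sum>i<n. \<Sum>j<n. g i * (cmod (X $$ (i, j)))\<^sup>2)"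
    by (simp add: sum.distrib sum_distrib_left algebra_simps)
  also have "(\<Sum>i<n. \<Sum>j<n. g i * (cmod (X $$ (j, i)))\<^sup>2) = (\<Sum>i<n. \<Sum>j<n. g j * (cmod (X $$ (i, j)))\<^sup>2)"
    by (rule sum.swap)
  finally show ?thesis
    unfolding frob_norm_commutator_add_anticommutator[OF X Y] by (simp add: sum.distrib algebra_simps)
qed

text \<open>By cyclicity the left side is the trace of \<open>mat_adjoint X\<close> times the weight
  matrix: up to conjugation and scaling the mean value that the variance subtracts.\<close>

lemma bw_inner: "frob_inner (mat_adjoint X * Y + Y * mat_adjoint X) Y = cnj (\<Sum>i<n. g i * X $$ (i, i))"
proof -
  have X': "mat_adjoint X \<in> carrier_mat n n" and Y': "mat_adjoint Y \<in> carrier_mat n n" using X Y by auto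
  note c = mult_carrier_square[of _ n, where ?'a=complex]
  have "frob_inner (mat_adjoint X * Y + Y * mat_adjoint X) Y =
      mat_trace (mat_adjoint X * Y * mat_adjoint Y) + mat_trace (Y * mat_adjoint X * mat_adjoint Y)"
    unfolding frob_inner_def add_mult_distrib_mat[OF c[OF X' Y] c[OF Y X'] Y']
    by (rule mat_trace_add[OF c[OF c[OF X' Y] Y'] c[OF c[OF Y X'] Y']])
  also have "mat_trace (Y * mat_adjoint X * mat_adjoint Y) = mat_trace (mat_adjoint X * mat_adjoint Y * Y)"
    unfolding assoc_mult_mat[OF Y X' Y'] by (rule mat_trace_comm[OF Y c[OF X' Y']])
  also have "mat_trace (mat_adjoint X * Y * mat_adjoint Y) + mat_trace (mat_adjoint X * mat_adjoint Y * Y) =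
      mat_trace (mat_adjoint X * (Y * mat_adjoint Y + mat_adjoint Y * Y))"
    unfolding mult_add_distrib_mat[OF X' c[OF Y Y'] c[OF Y' Y]]
      mat_trace_add[OF c[OF X' c[OF Y Y']] c[OF X' c[OF Y' Y]]]
      assoc_mult_mat[OF X' Y Y'] assoc_mult_mat[OF X' Y' Y] ..
  also have "\<dots> = cnj (\<Sum>i<n. g i * X $$ (i, i))"
    unfolding g mat_diag_mult_right[OF X'] mat_trace_def using X by (simp add: mult.commute)
  finally show ?thesis .
qed

text \<open>The summands of \<open>weighted_variance_identity\<close> for
  \<open>N = norm_sq Y\<close>.\<close>

definition bw_term :: "nat \<Rightarrow> nat \<Rightarrow> real" where
  "bw_term i j = (if i = j then 2 * ((norm_sq Y - g i) * cmod (X $$ (i, i)))\<^sup>2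
      else norm_sq Y * (2 * norm_sq Y - g i - g j) * (cmod (X $$ (i, j)))\<^sup>2
        + g i * g j * (cmod (X $$ (i, i) + X $$ (j, j)))\<^sup>2 / 2)"

lemma bw_term_nonneg: "i < n \<Longrightarrow> j < n \<Longrightarrow> 0 \<le> bw_term i j"
  using diag_weight_pair[of i j] by (auto simp: bw_term_def diag_weight_nonneg intro!: add_nonneg_nonneg)

text \<open>The defect splits into the variance terms and the gap in the Cauchy-Schwarz inequality,
  both nonnegative, so equality makes both vanish. The factor \<open>norm_sq Y\<close> avoids a
  division.\<close>

lemma bw_defect:
  "norm_sq Y * (2 * norm_sq X * norm_sq Y - comm_sq X Y) =
    (\<Sum>i<n. \<Sum>j<n. bw_term i j) +
    (norm_sq (mat_adjoint X * Y + Y * mat_adjoint X) * norm_sq Y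
      - (cmod (frob_inner (mat_adjoint X * Y + Y * mat_adjoint X) Y))\<^sup>2)"
  using weighted_variance_identity[OF diag_weight_sum, of "\<lambda>i j. X $$ (i, j)", folded bw_term_def]
  unfolding bw_inner complex_mod_cnj bw_norm_sum[symmetric] frob_norm_sum[OF X, symmetric]
  by (simp add: power2_eq_square algebra_simps)

lemma bw_anticommutator_carrier: "mat_adjoint X * Y + Y * mat_adjoint X \<in> carrier_mat n n"
  using X Y by (intro add_carrier_mat mult_carrier_square[of _ n]) auto

lemma bw_inequality_diagonal:
  "norm_sq Y * comm_sq X Y \<le> norm_sq Y * (2 * norm_sq X * norm_sq Y)"
proof -
  have "0 \<le> (\<Sum>i<n. \<Sum>j<n. bw_term i j)" by (intro sum_nonneg bw_term_nonneg) auto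
  then show ?thesis
    using bw_defect frob_inner_cauchy_schwarz[OF bw_anticommutator_carrier Y] by (simp add: algebra_simps)
qed

end

lemma frob_norm_zero [simp]: "frob_norm (0\<^sub>m n k) = 0"
  using frob_norm_sum[OF zero_carrier_mat[of n k]] by simp

lemma frob_inner_conj_sym:
  assumes "A \<in> carrier_mat n n" "B \<in> carrier_mat n n"
  shows "frob_inner B A = cnj (frob_inner A B)"
  using assms by (simp add: frob_inner_sum[of _ n n] mult.commute)

text \<open>Vanishing of every \<open>bw_term\<close> ties the nonzero entries of \<open>X\<close>
  to the weights; as the weights add up to \<open>2 * N\<close>, exactly two of them survive, and
  the order puts them at 0 and 1. The Cauchy-Schwarz gap gives \<open>W = 0\<close>, from which
  orthogonality follows by taking the trace.\<close>

lemma bw_equality_diagonal: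
  fixes g :: "nat \<Rightarrow> real"
  assumes n: "n \<ge> 2" and X: "X \<in> carrier_mat n n" and Y: "Y \<in> carrier_mat n n"
    and g: "Y * mat_adjoint Y + mat_adjoint Y * Y = mat_diag n (\<lambda>i. complex_of_real (g i))"
    and sorted: "\<forall>i j. i \<le> j \<longrightarrow> j < n \<longrightarrow> \<bar>g j\<bar> \<le> \<bar>g i\<bar>"
    and nonzero: "frob_norm X \<noteq> 0" "frob_norm Y \<noteq> 0"
    and eq: "comm_sq X Y = 2 * norm_sq X * norm_sq Y"
  shows "\<And>i j. i < n \<Longrightarrow> j < n \<Longrightarrow> \<not> (i < 2 \<and> j < 2) \<Longrightarrow> X $$ (i, j) = 0 \<and> Y $$ (i, j) = 0"
    and "mat_trace X = 0" and "frob_inner X Y = 0"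
proof -
  define N where "N = norm_sq Y"
  have N: "N > 0" using nonzero by (simp add: N_def)
  define W where "W = mat_adjoint X * Y + Y * mat_adjoint X"
  have W: "W \<in> carrier_mat n n" unfolding W_def by (rule bw_anticommutator_carrier[OF X Y g])
  note g0 = diag_weight_nonneg[OF X Y g]
  note gsum = diag_weight_sum[OF X Y g, folded N_def]
  note T0 = bw_term_nonneg[OF X Y g]
  have "(\<Sum>i<n. \<Sum>j<n. bw_term X Y g i j) + (norm_sq W * N - (cmod (frob_inner W Y))\<^sup>2) = 0"
    using bw_defect[OF X Y g] eq unfolding N_def W_def by simp
  moreover have "0 \<le> (\<Sum>i<n. \<Sum>j<n. bw_term X Y g i j)" by (intro sum_nonneg T0) auto
  moreover have "0 \<le> norm_sq W * N - (cmod (frob_inner W Y))\<^sup>2"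
    using frob_inner_cauchy_schwarz[OF W Y] by (simp add: N_def)
  ultimately have Tsum: "(\<Sum>i<n. \<Sum>j<n. bw_term X Y g i j) = 0"
    and gap: "norm_sq W * N = (cmod (frob_inner W Y))\<^sup>2" by auto
  have T: "bw_term X Y g i j = 0" if "i < n" "j < n" for i j
  proof -
    have "(\<Sum>j<n. bw_term X Y g i j) = 0"
      using Tsum that(1) by (subst (asm) sum_nonneg_eq_0_iff) (auto intro!: sum_nonneg T0)
    then show ?thesis using that by (subst (asm) sum_nonneg_eq_0_iff) (auto intro!: T0)
  qed
  \<comment> \<open>Three rules follow: a nonzero diagonal entry of \<open>X\<close> forces weight
    \<open>N\<close>, a nonzero entry off the diagonal forces \<open>g i + g j = 2 * N\<close>, and
    two diagonal entries at nonzero weights are opposite.\<close>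
  have t1: "g i = N" if "i < n" "X $$ (i, i) \<noteq> 0" for i
    using T[OF that(1) that(1)] that(2) by (simp add: bw_term_def[OF X Y g] N_def)
  have t: "N * (2 * N - g i - g j) * (cmod (X $$ (i, j)))\<^sup>2 = 0 \<and>
      g i * g j * (cmod (X $$ (i, i) + X $$ (j, j)))\<^sup>2 / 2 = 0" if ij: "i < n" "j < n" "i \<noteq> j" for i j
  proof (rule add_nonneg_eq_0_iff[THEN iffD1])
    show "0 \<le> N * (2 * N - g i - g j) * (cmod (X $$ (i, j)))\<^sup>2"
      using diag_weight_pair[OF X Y g ij] N by (simp add: N_def)
    show "0 \<le> g i * g j * (cmod (X $$ (i, i) + X $$ (j, j)))\<^sup>2 / 2" using g0 ij by simp
    show "N * (2 * N - g i - g j) * (cmod (X $$ (i, j)))\<^sup>2 +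
        g i * g j * (cmod (X $$ (i, i) + X $$ (j, j)))\<^sup>2 / 2 = 0"
      using T[OF ij(1,2)] ij(3) by (simp add: bw_term_def[OF X Y g] N_def)
  qed
  have t2: "g i + g j = 2 * N" if "i < n" "j < n" "i \<noteq> j" "X $$ (i, j) \<noteq> 0" for i j
    using t[OF that(1-3)] that(4) N by simp
  have t3: "X $$ (i, i) + X $$ (j, j) = 0" if "i < n" "j < n" "i \<noteq> j" "g i \<noteq> 0" "g j \<noteq> 0" for i j
    using t[OF that(1-3)] that(4,5) by simp
  have Yz: "Y $$ (i, j) = 0 \<and> Y $$ (j, i) = 0" if "i < n" "j < n" "g i = 0" for i j
  proof -
    have "(\<Sum>j<n. (cmod (Y $$ (i, j)))\<^sup>2 + (cmod (Y $$ (j, i)))\<^sup>2) = 0"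
      using diag_weight[OF X Y g that(1)] that(3) by simp
    then have "(cmod (Y $$ (i, j)))\<^sup>2 + (cmod (Y $$ (j, i)))\<^sup>2 = 0"
      using that(2) by (subst (asm) sum_nonneg_eq_0_iff) auto
    then show ?thesis by (simp add: add_nonneg_eq_0_iff)
  qed
  \<comment> \<open>Equality in Cauchy-Schwarz: \<open>W\<close> is zero as soon as its inner
    product with \<open>Y\<close> is.\<close>
  have W0: "W = 0\<^sub>m n n" if "(\<Sum>i<n. g i * X $$ (i, i)) = 0"
  proof (rule frob_norm_eq_0[OF W])
    have "frob_inner W Y = 0" unfolding W_def bw_inner[OF X Y g] that by simp
    then show "frob_norm W = 0" using gap N by simp
  qed
  obtain a b where ab: "a < n" "b < n" "X $$ (a, b) \<noteq> 0"
  proof -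
    have "\<exists>a<n. \<exists>b<n. X $$ (a, b) \<noteq> 0"
    proof (rule ccontr)
      assume "\<not> ?thesis"
      then have "norm_sq X = 0" unfolding frob_norm_sum[OF X] by simp
      then show False using nonzero by simp
    qed
    then show ?thesis using that by blast
  qed
  \<comment> \<open>If some diagonal entry of \<open>X\<close> is nonzero, then
    \<open>g i = N\<close>, so another index \<open>j\<close> has nonzero weight; the entry there is
    opposite, hence nonzero, and \<open>g j = N\<close> as well. If the diagonal is zero, the entry
    at \<open>(a, b)\<close> provides the pair, once it is excluded that one index carries
    everything.\<close>
  have two: "\<exists>i j. i < n \<and> j < n \<and> i \<noteq> j \<and> g i > 0 \<and> g j > 0 \<and> g i + g j = 2 * N"
  proof (cases "\<exists>i<n. X $$ (i, i) \<noteq> 0")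
    case True
    then obtain i where i: "i < n" "X $$ (i, i) \<noteq> 0" by blast
    have "\<exists>j<n. j \<noteq> i \<and> g j \<noteq> 0"
    proof (rule ccontr)
      assume "\<not> ?thesis"
      then have "(\<Sum>j<n. g j) = (\<Sum>j<n. if j = i then g i else 0)" by (intro sum.cong) auto
      then show False using gsum t1[OF i] i N by simp
    qed
    then obtain j where j: "j < n" "j \<noteq> i" "g j \<noteq> 0" by blast
    have "X $$ (i, i) + X $$ (j, j) = 0" using t3[OF i(1) j(1)] j t1[OF i] N by simp
    then have "X $$ (j, j) \<noteq> 0" using i(2) by auto
    then have "g j = N" using t1 j by blast
    then show ?thesis using t1[OF i] i j N by (intro exI[of _ i] exI[of _ j]) auto
  next
    case False
    then have x0: "X $$ (i, i) = 0" if "i < n" for i using that by blast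
    have W0': "W = 0\<^sub>m n n" by (rule W0) (simp add: x0)
    have neq: "a \<noteq> b" using ab x0 by auto
    have gab: "g a + g b = 2 * N" using t2[OF ab(1,2) neq ab(3)] .
    \<comment> \<open>If index \<open>i\<close> carried the whole weight, \<open>Y\<close> would be
      supported on the entry \<open>(i, i)\<close> alone, and \<open>W = 0\<close> at
      \<open>(i, k)\<close> and \<open>(k, i)\<close> would clear both entries of
      \<open>X\<close>.\<close>
    have zero: "X $$ (i, k) = 0 \<and> X $$ (k, i) = 0" if i: "i < n" "k < n" "i \<noteq> k" "g i = 2 * N" "g k = 0" for i k
    proof -
      have "g l = 0" if "l < n" "l \<noteq> i" for l
        using diag_weight_pair[OF X Y g that(1) i(1) that(2)] g0[OF that(1)] i(4) by (simp add: N_def)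
      then have Y0: "Y $$ (l, p) = 0" "Y $$ (p, l) = 0" if "l < n" "l \<noteq> i" "p < n" for l p
        using Yz that by blast+
      have "2 * N = 2 * (cmod (Y $$ (i, i)))\<^sup>2"
      proof -
        have "g i = (\<Sum>j<n. if j = i then 2 * (cmod (Y $$ (i, i)))\<^sup>2 else 0)"
          unfolding diag_weight[OF X Y g i(1)] using Y0 i(1) by (intro sum.cong) auto
        then show ?thesis using i by simp
      qed
      then have Yi: "Y $$ (i, i) \<noteq> 0" using N by auto
      have "0 = W $$ (i, k)" unfolding W0' using i by simp
      also have "\<dots> = (\<Sum>l<n. cnj (X $$ (l, i)) * Y $$ (l, k)) + (\<Sum>l<n. Y $$ (i, l) * cnj (X $$ (k, l)))"
        unfolding W_def using X Y i by (simp add: scalar_prod_def atLeast0LessThan)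
      also have "(\<Sum>l<n. cnj (X $$ (l, i)) * Y $$ (l, k)) = 0"
        using Y0(2)[OF i(2)] i(3) by (intro sum.neutral) auto
      also have "(\<Sum>l<n. Y $$ (i, l) * cnj (X $$ (k, l))) = (\<Sum>l<n. if l = i then Y $$ (i, i) * cnj (X $$ (k, i)) else 0)"
        using Y0(2) i(1) by (intro sum.cong) auto
      finally have 1: "X $$ (k, i) = 0" using Yi i(1) by simp
      have "0 = W $$ (k, i)" unfolding W0' using i by simp
      also have "\<dots> = (\<Sum>l<n. cnj (X $$ (l, k)) * Y $$ (l, i)) + (\<Sum>l<n. Y $$ (k, l) * cnj (X $$ (i, l)))"
        unfolding W_def using X Y i by (simp add: scalar_prod_def atLeast0LessThan)
      also have "(\<Sum>l<n. Y $$ (k, l) * cnj (X $$ (i, l))) = 0"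
        using Y0(1)[OF i(2)] i(3) by (intro sum.neutral) auto
      also have "(\<Sum>l<n. cnj (X $$ (l, k)) * Y $$ (l, i)) = (\<Sum>l<n. if l = i then cnj (X $$ (i, k)) * Y $$ (i, i) else 0)"
        using Y0(1) i(1) by (intro sum.cong) auto
      finally have 2: "X $$ (i, k) = 0" using Yi i(1) by simp
      show ?thesis using 1 2 by blast
    qed
    have "g a \<noteq> 0"
    proof
      assume "g a = 0"
      then show False using zero[of b a] gab ab neq by auto
    qed
    moreover have "g b \<noteq> 0"
    proof
      assume "g b = 0"
      then show False using zero[of a b] gab ab neq by auto
    qed
    ultimately show ?thesis using g0[OF ab(1)] g0[OF ab(2)] gab ab neq by (intro exI[of _ a] exI[of _ b]) auto
  qed
  then obtain p q where pq: "p < n" "q < n" "p \<noteq> q" "g p > 0" "g q > 0" "g p + g q = 2 * N" by blast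
  have rest: "g k = 0" if k: "k < n" "k \<noteq> p" "k \<noteq> q" for k
  proof -
    have "sum g {p, q, k} \<le> sum g {..<n}" using k pq g0 by (intro sum_mono2) auto
    then have "g p + (g q + g k) \<le> 2 * N" using k pq gsum by simp
    then show ?thesis using pq(6) g0[OF k(1)] by simp
  qed
  \<comment> \<open>All other weights are zero, so the order leaves the two positive ones no place
    but 0 and 1.\<close>
  have in0: "0 = p \<or> 0 = q"
  proof (rule ccontr)
    assume "\<not> ?thesis"
    then have "g 0 = 0" using rest[of 0] n by auto
    then show False using sorted[rule_format, of 0 p] pq by simp
  qed
  have in1: "1 = p \<or> 1 = q"
  proof (rule ccontr)
    assume as: "\<not> ?thesis"
    then have z: "g 1 = 0" using rest[of 1] n by auto
    have "p \<ge> 1 \<or> q \<ge> 1" using pq(3) by auto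
    then show False using sorted[rule_format, of 1 p] sorted[rule_format, of 1 q] pq z by auto
  qed
  have g01: "g 0 > 0" "g 1 > 0" "g 0 + g 1 = 2 * N" using in0 in1 pq by auto
  have g2: "g k = 0" if "k < n" "k \<ge> 2" for k using rest[OF that(1)] in0 in1 that by auto
  \<comment> \<open>Strict because \<open>g 0\<close> and \<open>g 1\<close> are both positive;
    hence \<open>g i + g j = 2 * N\<close> fails when one of the weights is zero.\<close>
  have le: "g k < 2 * N" if "k < n" for k
    using that g01 g2[of k] N by (cases "k \<ge> 2") (auto simp: not_le numeral_2_eq_2 less_Suc_eq)
  show "X $$ (i, j) = 0 \<and> Y $$ (i, j) = 0" if ij: "i < n" "j < n" "\<not> (i < 2 \<and> j < 2)" for i j
  proof
    have z: "g i = 0 \<or> g j = 0" using g2 ij by (meson not_less)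
    show "X $$ (i, j) = 0"
    proof (rule ccontr)
      assume nz: "X $$ (i, j) \<noteq> 0"
      show False
      proof (cases "i = j")
        case True
        then show False using t1[OF ij(1)] nz z N by auto
      next
        case False
        then show False using t2[OF ij(1,2) False nz] z le[OF ij(1)] le[OF ij(2)] by auto
      qed
    qed
    show "Y $$ (i, j) = 0" using z Yz ij by blast
  qed
  note supp = this
  have split: "(\<Sum>i<n. f i) = f 0 + f 1" if "\<And>i. i < n \<Longrightarrow> i \<ge> 2 \<Longrightarrow> f i = 0" for f :: "nat \<Rightarrow> complex"
  proof -
    have "(\<Sum>i<n. f i) = (\<Sum>i\<in>{..<2}. f i)" using n that by (intro sum.mono_neutral_right) auto
    then show ?thesis by (simp add: numeral_2_eq_2)
  qed
  have x01: "X $$ (0, 0) + X $$ (1, 1) = 0" using t3[of 0 1] g01 n by simp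
  have "mat_trace X = X $$ (0, 0) + X $$ (1, 1)"
    unfolding mat_trace_def using X supp by (simp add: split)
  then show "mat_trace X = 0" using x01 by simp
  \<comment> \<open>Either the diagonal of \<open>X\<close> vanishes on the block, or both weights
    equal \<open>N\<close> and the opposite entries cancel. Thus \<open>W = 0\<close>, and its trace
    is twice an inner product.\<close>
  have "(\<Sum>i<n. g i * X $$ (i, i)) = g 0 * X $$ (0, 0) + g 1 * X $$ (1, 1)"
    using g2 by (intro split) simp
  also have "\<dots> = 0"
  proof (cases "X $$ (0, 0) = 0")
    case True
    then show ?thesis using x01 by simp
  next
    case False
    then have "X $$ (1, 1) \<noteq> 0" using x01 by auto
    then have "g 0 = N" "g 1 = N" using t1[of 0] t1[of 1] False n by auto
    then show ?thesis using x01 by (simp flip: distrib_left)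
  qed
  finally have "W = 0\<^sub>m n n" by (rule W0)
  then have "mat_trace W = 0" by (simp add: mat_trace_def)
  moreover have "mat_trace W = 2 * frob_inner Y X"
  proof -
    have X': "mat_adjoint X \<in> carrier_mat n n" using X by simp
    have c: "mat_adjoint X * Y \<in> carrier_mat n n" "Y * mat_adjoint X \<in> carrier_mat n n" using X' Y by auto
    show ?thesis unfolding W_def mat_trace_add[OF c] mat_trace_comm[OF X' Y] frob_inner_def by simp
  qed
  ultimately show "frob_inner X Y = 0" using frob_inner_conj_sym[OF Y X] by simp
qed

lemma bw_weight_diagonalization:
  assumes Y: "Y \<in> carrier_mat n n"
  shows "\<exists>P g. P \<in> unitary_matrices n \<and>
    unitary_conj P Y * mat_adjoint (unitary_conj P Y) + mat_adjoint (unitary_conj P Y) * unitary_conj P Y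
      = mat_diag n (\<lambda>i. complex_of_real (g i)) \<and>
    (\<forall>i j. i \<le> j \<longrightarrow> j < n \<longrightarrow> \<bar>g j\<bar> \<le> \<bar>g i\<bar>)"
proof -
  have Y': "mat_adjoint Y \<in> carrier_mat n n" using Y by simp
  have c: "Y * mat_adjoint Y \<in> carrier_mat n n" "mat_adjoint Y * Y \<in> carrier_mat n n" using Y Y' by auto
  let ?G = "Y * mat_adjoint Y + mat_adjoint Y * Y"
  have G: "?G \<in> carrier_mat n n" using c by simp
  have "mat_adjoint ?G = ?G"
    unfolding mat_adjoint_add[OF c] by (simp add: mat_adjoint_mult[OF Y Y'] mat_adjoint_mult[OF Y' Y])
  then obtain P g where P: "P \<in> unitary_matrices n"
    and diag: "mat_adjoint P * ?G * P = mat_diag n (\<lambda>i. complex_of_real (g i))"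
    and sorted: "\<forall>i j. i \<le> j \<longrightarrow> j < n \<longrightarrow> \<bar>g j\<bar> \<le> \<bar>g i\<bar>"
    by (rule hermitian_spectral[OF G])
  have "unitary_conj P ?G = unitary_conj P Y * mat_adjoint (unitary_conj P Y) + mat_adjoint (unitary_conj P Y) * unitary_conj P Y"
    unfolding unitary_conj_adjoint[OF P Y] unitary_conj_mult[OF P Y Y', symmetric] unitary_conj_mult[OF P Y' Y, symmetric]
    unfolding unitary_conj_def using unitary_carrier[OF P] c
    by (simp add: mult_add_distrib_mat[of _ n n] add_mult_distrib_mat[of _ n n] mult_carrier_square[of _ n])
  then show ?thesis using diag sorted P by (intro exI[of _ P] exI[of _ g]) (simp add: unitary_conj_def)
qed

theorem boettcher_wenzel:
  assumes X: "X \<in> carrier_mat n n" and Y: "Y \<in> carrier_mat n n"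
  shows "comm_sq X Y \<le> 2 * norm_sq X * norm_sq Y"
\<comment> \<open>The inequality for diagonal weights carries a factor \<open>norm_sq Y\<close> that
  has to be cancelled.\<close>
proof (cases "frob_norm Y = 0")
  case True
  then have "Y = 0\<^sub>m n n" by (rule frob_norm_eq_0[OF Y])
  then have "mat_commutator X Y = 0\<^sub>m n n" using X by (simp add: mat_commutator_def)
  then show ?thesis by simp
next
  case False
  obtain P g where P: "P \<in> unitary_matrices n"
    and g: "unitary_conj P Y * mat_adjoint (unitary_conj P Y) + mat_adjoint (unitary_conj P Y) * unitary_conj P Y
      = mat_diag n (\<lambda>i. complex_of_real (g i))"
    using bw_weight_diagonalization[OF Y] by (elim exE conjE)
  show ?thesis
    using bw_inequality_diagonal[OF unitary_conj_carrier[OF P X] unitary_conj_carrier[OF P Y] g] False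
    unfolding unitary_conj_commutator_norm[OF P X Y] unitary_conj_norm[OF P X] unitary_conj_norm[OF P Y] by simp
qed

text \<open>The weights come from \<open>Y\<close>, so the argument yields the trace of
  \<open>X\<close>; that of \<open>Y\<close> follows by exchanging the roles.\<close>

theorem boettcher_wenzel_equality:
  assumes n: "n \<ge> 2" and X: "X \<in> carrier_mat n n" and Y: "Y \<in> carrier_mat n n"
    and nonzero: "frob_norm X \<noteq> 0" "frob_norm Y \<noteq> 0"
    and eq: "comm_sq X Y = 2 * norm_sq X * norm_sq Y"
  obtains P where "P \<in> unitary_matrices n"
    "\<forall>i<n. \<forall>j<n. \<not> (i < 2 \<and> j < 2) \<longrightarrow> unitary_conj P X $$ (i, j) = 0 \<and> unitary_conj P Y $$ (i, j) = 0"
    "mat_trace X = 0" "frob_inner X Y = 0"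
proof -
  obtain P g where P: "P \<in> unitary_matrices n"
    and g: "unitary_conj P Y * mat_adjoint (unitary_conj P Y) + mat_adjoint (unitary_conj P Y) * unitary_conj P Y
      = mat_diag n (\<lambda>i. complex_of_real (g i))"
    and sorted: "\<forall>i j. i \<le> j \<longrightarrow> j < n \<longrightarrow> \<bar>g j\<bar> \<le> \<bar>g i\<bar>"
    using bw_weight_diagonalization[OF Y] by (elim exE conjE)
  note norms = unitary_conj_commutator_norm[OF P X Y] unitary_conj_norm[OF P X] unitary_conj_norm[OF P Y]
  note * = bw_equality_diagonal[OF n unitary_conj_carrier[OF P X] unitary_conj_carrier[OF P Y] g sorted,
      unfolded norms, OF nonzero eq]
  show ?thesis
  proof (rule that[OF P])
    show "\<forall>i<n. \<forall>j<n. \<not> (i < 2 \<and> j < 2) \<longrightarrow> unitary_conj P X $$ (i, j) = 0 \<and> unitary_conj P Y $$ (i, j) = 0"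
      by (intro allI impI) (rule *(1))
    show "mat_trace X = 0" using *(2) by (simp only: unitary_conj_trace[OF P X])
    show "frob_inner X Y = 0" using *(3) by (simp only: unitary_conj_inner[OF P X Y])
  qed
qed

section \<open>Commutators with an orthogonal family\<close>

text \<open>Let \<open>k = card J\<close>. Adding the nonnegative sum of the
  \<open>(l p + k * l j)^2\<close>, divided by \<open>k\<close>, turns the left side into
  \<open>k + 1\<close> times the sum of all squares, minus \<open>k * S\<close>, which is at most
  \<open>S\<close>. The added squares vanish exactly for \<open>l j = - l p / k\<close>, the
  extremal star.\<close>

lemma spread_star_bound:
  fixes l :: "'a \<Rightarrow> real"
  assumes "finite J" "(l p)\<^sup>2 + (\<Sum>j\<in>J. (l j)\<^sup>2) \<le> S"
  shows "(\<Sum>j\<in>J. (l p - l j)\<^sup>2 - S) \<le> S"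
proof (cases "J = {}")
  case True
  then show ?thesis using assms(2) order_trans[OF zero_le_power2[of "l p"], of S] by simp
next
  case False
  define k where "k = real (card J)"
  define Y where "Y = (\<Sum>j\<in>J. l j)"
  define Y2 where "Y2 = (\<Sum>j\<in>J. (l j)\<^sup>2)"
  have k: "k > 0" using False assms(1) by (simp add: k_def card_gt_0_iff)
  have "0 \<le> (\<Sum>j\<in>J. (l p + k * l j)\<^sup>2)" by (simp add: sum_nonneg)
  also have "\<dots> = k * ((l p)\<^sup>2 + 2 * l p * Y + k * Y2)"
  proof -
    have "(\<Sum>j\<in>J. (l p + k * l j)\<^sup>2) = (\<Sum>j\<in>J. (l p)\<^sup>2 + 2 * l p * k * l j + k\<^sup>2 * (l j)\<^sup>2)"
      by (intro sum.cong refl) (simp add: power2_sum power_mult_distrib)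
    also have "\<dots> = k * (l p)\<^sup>2 + 2 * l p * k * Y + k\<^sup>2 * Y2"
      by (simp add: sum.distrib Y_def Y2_def k_def sum_distrib_left)
    finally show ?thesis by (simp add: algebra_simps power2_eq_square)
  qed
  finally have 1: "0 \<le> (l p)\<^sup>2 + 2 * l p * Y + k * Y2" using k by (simp add: zero_le_mult_iff)
  have 2: "(\<Sum>j\<in>J. (l p - l j)\<^sup>2 - S) = k * (l p)\<^sup>2 - 2 * l p * Y + Y2 - k * S"
    by (simp add: power2_diff sum.distrib sum_subtractf Y_def Y2_def k_def sum_distrib_left mult.assoc)
  have "(k + 1) * ((l p)\<^sup>2 + Y2) \<le> (k + 1) * S"
    using assms(2) k by (intro mult_left_mono) (auto simp: Y2_def)
  then show ?thesis using 1 unfolding 2 by (simp add: algebra_simps)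
qed

lemma sum_subset_le:
  fixes f :: "nat \<Rightarrow> real"
  assumes "\<And>k. 0 \<le> f k" "A \<subseteq> {..<n}"
  shows "sum f A \<le> (\<Sum>k<n. f k)"
  using assms by (intro sum_mono2) auto

lemma spread_le:
  fixes l :: "nat \<Rightarrow> real"
  assumes "i < n" "j < n"
  shows "(l i - l j)\<^sup>2 \<le> 2 * (\<Sum>k<n. (l k)\<^sup>2)"
proof (cases "i = j")
  case True
  then show ?thesis by (simp add: sum_nonneg)
next
  case False
  have "(l i - l j)\<^sup>2 \<le> 2 * ((l i)\<^sup>2 + (l j)\<^sup>2)"
    using zero_le_power2[of "l i + l j"] by (simp add: power2_sum power2_diff)
  moreover have "(l i)\<^sup>2 + (l j)\<^sup>2 \<le> (\<Sum>k<n. (l k)\<^sup>2)"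
    using sum_subset_le[of "\<lambda>k. (l k)\<^sup>2" "{i, j}" n] assms False by simp
  then have "2 * ((l i)\<^sup>2 + (l j)\<^sup>2) \<le> 2 * (\<Sum>k<n. (l k)\<^sup>2)" by simp
  ultimately show ?thesis by (rule order_trans)
qed

text \<open>The pairs \<open>(i, j)\<close> with \<open>l i - l j > sqrt S\<close> pairwise share an endpoint on the same side, so they
  form a star.\<close>

lemma spread_excess_sum:
  fixes l :: "nat \<Rightarrow> real" and n :: nat
  defines "S \<equiv> (\<Sum>k<n. (l k)\<^sup>2)"
  shows "(\<Sum>i<n. \<Sum>j<n. max 0 ((l i - l j)\<^sup>2 - S)) \<le> 2 * S"
proof -
  have S: "S \<ge> 0" by (simp add: S_def sum_nonneg)
  define m where "m i j = max 0 ((l i - l j)\<^sup>2 - S)" for i j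
  define E where "E = {e \<in> {..<n} \<times> {..<n}. l (snd e) < l (fst e) \<and> S < (l (fst e) - l (snd e))\<^sup>2}"
  have E: "i < n" "j < n" "l j < l i" "S < (l i - l j)\<^sup>2" if "(i, j) \<in> E" for i j
    using that by (auto simp: E_def)
  have finE: "finite E" by (simp add: E_def)
  have no_disjoint: "i = k \<or> j = p" if e: "(i, j) \<in> E" "(k, p) \<in> E" for i j k p
  proof (rule ccontr)
    assume ne: "\<not> ?thesis"
    note e1 = E[OF e(1)] and e2 = E[OF e(2)]
    \<comment> \<open>Two edges in a row would compose to a difference whose square exceeds
      \<open>4 * S\<close>, against the bound \<open>2 * S\<close> of
      \<open>spread_le\<close>.\<close>
    have chain: "4 * S < 2 * S" if "S < a\<^sup>2" "S < b\<^sup>2" "0 < a" "0 < b" "(a + b)\<^sup>2 \<le> 2 * S" for a b :: real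
    proof -
      have "S < a * b"
      proof (cases "a \<le> b")
        case True
        then have "a * a \<le> a * b" using that by (intro mult_left_mono) auto
        then show ?thesis using that by (metis less_le_trans power2_eq_square)
      next
        case False
        then have "b * b \<le> a * b" using that by (intro mult_right_mono) auto
        then show ?thesis using that by (metis less_le_trans power2_eq_square)
      qed
      then show ?thesis using that by (simp add: power2_sum)
    qed
    have "i \<noteq> p"
      using chain[of "l i - l j" "l k - l p"] spread_le[of k n j l] e1 e2 S by (auto simp flip: S_def)
    moreover have "k \<noteq> j"
      using chain[of "l i - l j" "l k - l p"] spread_le[of i n p l] e1 e2 S by (auto simp flip: S_def)
    moreover have "i \<noteq> j" "k \<noteq> p" using e1 e2 by auto
    \<comment> \<open>With four distinct endpoints the two squared differences together are at most
      \<open>2 * S\<close>, yet each exceeds \<open>S\<close>.\<close>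
    ultimately have "(l i)\<^sup>2 + (l j)\<^sup>2 + (l k)\<^sup>2 + (l p)\<^sup>2 \<le> S"
      using sum_subset_le[of "\<lambda>k. (l k)\<^sup>2" "{i, j, k, p}" n] ne e1 e2 by (simp add: S_def)
    moreover have "(l i - l j)\<^sup>2 \<le> 2 * ((l i)\<^sup>2 + (l j)\<^sup>2)" "(l k - l p)\<^sup>2 \<le> 2 * ((l k)\<^sup>2 + (l p)\<^sup>2)"
      using zero_le_power2[of "l i + l j"] zero_le_power2[of "l k + l p"] by (simp_all add: power2_sum power2_diff)
    ultimately show False using e1(4) e2(4) by (smt (verit))
  qed
  have sumE: "(\<Sum>e\<in>E. (l (fst e) - l (snd e))\<^sup>2 - S) \<le> S"
  proof (cases "\<exists>p. \<forall>e\<in>E. fst e = p")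
    case True
    then obtain p where p: "\<And>e. e \<in> E \<Longrightarrow> fst e = p" by blast
    have inj: "inj_on snd E" using p by (auto simp: inj_on_def prod_eq_iff)
    have "(\<Sum>e\<in>E. (l (fst e) - l (snd e))\<^sup>2 - S) = (\<Sum>j\<in>snd ` E. (l p - l j)\<^sup>2 - S)"
      unfolding sum.reindex[OF inj] using p by (intro sum.cong) auto
    also have "\<dots> \<le> S"
    proof (cases "E = {}")
      case False
      then obtain q where q: "(p, q) \<in> E" using p by (metis ex_in_conv prod.collapse)
      have "p \<notin> snd ` E" using p E by (metis imageE less_irrefl prod.collapse)
      then have "(l p)\<^sup>2 + (\<Sum>j\<in>snd ` E. (l j)\<^sup>2) = (\<Sum>j\<in>insert p (snd ` E). (l j)\<^sup>2)"
        using finE by simp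
      also have "\<dots> \<le> S" unfolding S_def using E(1)[OF q] by (intro sum_subset_le) (auto simp: E_def)
      finally show ?thesis using finE by (intro spread_star_bound) auto
    qed (use S in simp)
    finally show ?thesis .
  next
    case False
    \<comment> \<open>Two edges with different first components share the second one,
      \<open>j\<close>; an edge not ending in \<open>j\<close> would have to begin at both of their
      first components.\<close>
    obtain i j where ij: "(i, j) \<in> E" using False by auto
    obtain k p where kp: "(k, p) \<in> E" "k \<noteq> i" using False by (metis prod.collapse)
    have jp: "p = j" using no_disjoint[OF ij kp(1)] kp(2) by auto
    have q: "snd e = j" if "e \<in> E" for e
    proof (rule ccontr)
      assume ne: "snd e \<noteq> j"
      have "(fst e, snd e) \<in> E" using that by simp
      then have "fst e = i" "fst e = k"
        using no_disjoint[OF ij] no_disjoint[OF kp(1)] ne jp by metis+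
      then show False using kp(2) by simp
    qed
    have inj: "inj_on fst E" using q by (auto simp: inj_on_def prod_eq_iff)
    have "(\<Sum>e\<in>E. (l (fst e) - l (snd e))\<^sup>2 - S) = (\<Sum>i\<in>fst ` E. (l j - l i)\<^sup>2 - S)"
      unfolding sum.reindex[OF inj] using q by (intro sum.cong) (auto simp: power2_commute)
    also have "\<dots> \<le> S"
    proof -
      have "j \<notin> fst ` E" using q E by (metis imageE less_irrefl prod.collapse)
      then have "(l j)\<^sup>2 + (\<Sum>i\<in>fst ` E. (l i)\<^sup>2) = (\<Sum>i\<in>insert j (fst ` E). (l i)\<^sup>2)"
        using finE by simp
      also have "\<dots> \<le> S" unfolding S_def using E(2)[OF ij] by (intro sum_subset_le) (auto simp: E_def)
      finally show ?thesis using finE by (intro spread_star_bound) auto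
    qed
    finally show ?thesis .
  qed
  \<comment> \<open>\<open>E\<close> holds each unordered pair of positive excess once; the sum over
    ordered pairs counts it twice, whence the bound \<open>2 * S\<close>.\<close>
  have half: "(\<Sum>i<n. \<Sum>j<n. if l j < l i then m i j else 0) = (\<Sum>e\<in>E. (l (fst e) - l (snd e))\<^sup>2 - S)"
  proof -
    have "(\<Sum>i<n. \<Sum>j<n. if l j < l i then m i j else 0) =
        (\<Sum>e\<in>{..<n} \<times> {..<n}. if l (snd e) < l (fst e) then m (fst e) (snd e) else 0)"
      by (simp add: sum.cartesian_product split_def)
    also have "\<dots> = (\<Sum>e\<in>{..<n} \<times> {..<n}. if e \<in> E then (l (fst e) - l (snd e))\<^sup>2 - S else 0)"
      by (intro sum.cong refl) (auto simp: E_def m_def)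
    also have "\<dots> = (\<Sum>e\<in>E. (l (fst e) - l (snd e))\<^sup>2 - S)"
      by (intro sum.mono_neutral_cong_right) (auto simp: E_def)
    finally show ?thesis .
  qed
  have "(\<Sum>i<n. \<Sum>j<n. m i j) = (\<Sum>i<n. \<Sum>j<n. (if l j < l i then m i j else 0) + (if l i < l j then m j i else 0))"
    using S by (intro sum.cong refl) (auto simp: m_def power2_commute)
  also have "\<dots> = (\<Sum>i<n. \<Sum>j<n. if l j < l i then m i j else 0) + (\<Sum>i<n. \<Sum>j<n. if l i < l j then m j i else 0)"
    by (simp add: sum.distrib)
  also have "(\<Sum>i<n. \<Sum>j<n. if l i < l j then m j i else 0) = (\<Sum>i<n. \<Sum>j<n. if l j < l i then m i j else 0)"
    by (rule sum.swap)
  finally show ?thesis using half sumE by (simp add: m_def)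
qed

text \<open>Bessel's inequality for the unit vector at \<open>j0\<close>. Its projection
  \<open>y\<close> to the span of the \<open>x s\<close> has coefficients \<open>t s\<close> and
  satisfies \<open>Re (y j0) = Q\<close> and squared norm \<open>Q\<close>, so
  \<open>Q^2 \<le> Q\<close>. Zero vectors contribute nothing, since division by zero gives
  0.\<close>

lemma bessel_coordinate:
  fixes x :: "'s \<Rightarrow> 'j \<Rightarrow> complex"
  assumes fin: "finite I" "finite J" and j0: "j0 \<in> J"
    and orth: "\<And>s t. s \<in> I \<Longrightarrow> t \<in> I \<Longrightarrow> s \<noteq> t \<Longrightarrow> (\<Sum>j\<in>J. x s j * cnj (x t j)) = 0"
  shows "(\<Sum>s\<in>I. (cmod (x s j0))\<^sup>2 / (\<Sum>j\<in>J. (cmod (x s j))\<^sup>2)) \<le> 1"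
proof -
  define N where "N s = (\<Sum>j\<in>J. (cmod (x s j))\<^sup>2)" for s
  define t where "t s = cnj (x s j0) / of_real (N s)" for s
  define y where "y j = (\<Sum>s\<in>I. t s * x s j)" for j
  define Q where "Q = (\<Sum>s\<in>I. (cmod (x s j0))\<^sup>2 / N s)"
  have cross: "Re (y j0) = Q"
  proof -
    have "t s * x s j0 = of_real ((cmod (x s j0))\<^sup>2 / N s)" for s
      by (simp add: t_def complex_norm_square mult.commute del: of_real_power)
    then show ?thesis unfolding y_def Q_def by (simp only: Re_sum Re_complex_of_real)
  qed
  have norm: "(\<Sum>j\<in>J. (cmod (y j))\<^sup>2) = Q"
  proof -
    have "(\<Sum>j\<in>J. (cmod (y j))\<^sup>2) = (\<Sum>j\<in>J. \<Sum>s\<in>I. \<Sum>u\<in>I. Re (t s * x s j * cnj (t u * x u j)))"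
      by (simp only: y_def cmod_sum_sq)
    also have "\<dots> = (\<Sum>s\<in>I. \<Sum>j\<in>J. \<Sum>u\<in>I. Re (t s * x s j * cnj (t u * x u j)))"
      by (rule sum.swap)
    also have "\<dots> = (\<Sum>s\<in>I. \<Sum>u\<in>I. \<Sum>j\<in>J. Re (t s * x s j * cnj (t u * x u j)))"
      by (intro sum.cong refl) (rule sum.swap)
    also have "\<dots> = (\<Sum>s\<in>I. \<Sum>u\<in>I. if u = s then (cmod (x s j0))\<^sup>2 / N s else 0)"
    proof (intro sum.cong refl)
      fix s u assume su: "s \<in> I" "u \<in> I"
      have "(\<Sum>j\<in>J. Re (t s * x s j * cnj (t u * x u j))) = Re (\<Sum>j\<in>J. t s * cnj (t u) * (x s j * cnj (x u j)))"
        unfolding Re_sum by (intro sum.cong refl arg_cong[where f=Re]) (simp add: mult_ac)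
      also have "\<dots> = Re (t s * cnj (t u) * (\<Sum>j\<in>J. x s j * cnj (x u j)))"
        by (simp only: sum_distrib_left)
      also have "\<dots> = (if u = s then (cmod (x s j0))\<^sup>2 / N s else 0)"
      proof (cases "u = s")
        case True
        have "(\<Sum>j\<in>J. x s j * cnj (x s j)) = of_real (N s)"
          by (simp add: N_def complex_norm_square del: of_real_power)
        moreover have "t s * cnj (t s) = of_real ((cmod (t s))\<^sup>2)" by (simp add: complex_norm_square del: of_real_power)
        ultimately have "Re (t s * cnj (t s) * (\<Sum>j\<in>J. x s j * cnj (x s j))) = (cmod (t s))\<^sup>2 * N s"
          by (simp flip: of_real_mult)
        also have "\<dots> = (cmod (x s j0))\<^sup>2 / N s"
          by (simp add: t_def norm_divide power_divide power2_eq_square)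
        finally show ?thesis using True by simp
      next
        case False
        then show ?thesis using orth[OF su] by simp
      qed
      finally show "(\<Sum>j\<in>J. Re (t s * x s j * cnj (t u * x u j))) = (if u = s then (cmod (x s j0))\<^sup>2 / N s else 0)" .
    qed
    also have "\<dots> = Q" unfolding Q_def using fin(1) by (intro sum.cong refl) simp
    finally show ?thesis .
  qed
  have "(cmod (y j0))\<^sup>2 \<le> (\<Sum>j\<in>J. (cmod (y j))\<^sup>2)"
    using fin(2) j0 by (intro member_le_sum) auto
  moreover have "(Re (y j0))\<^sup>2 \<le> (cmod (y j0))\<^sup>2" by (simp add: cmod_power2)
  ultimately have "(Re (y j0))\<^sup>2 \<le> Q" unfolding norm by simp
  then have "Q * Q \<le> Q * 1" unfolding cross by (simp add: power2_eq_square)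
  moreover have "Q \<ge> 0" unfolding Q_def N_def by (intro sum_nonneg divide_nonneg_nonneg) (auto simp: sum_nonneg)
  ultimately have "Q \<le> 1" by (metis mult_le_cancel_left_pos order_le_less zero_le_one)
  then show ?thesis by (simp add: Q_def N_def)
qed

text \<open>Bound \<open>b s\<close> by \<open>v\<close>, plus the surplus \<open>u - v\<close> at
  \<open>s0\<close>: the constant part meets the total weight \<open>2 * c\<close>, the surplus only
  a single weight, at most \<open>c\<close>.\<close>

lemma weighted_top_two:
  fixes b w :: "'s \<Rightarrow> real"
  assumes fin: "finite I" and w: "\<And>s. s \<in> I \<Longrightarrow> 0 \<le> w s" "\<And>s. s \<in> I \<Longrightarrow> w s \<le> c" "(\<Sum>s\<in>I. w s) \<le> 2 * c"
    and uv: "0 \<le> v" "v \<le> u" and c: "0 \<le> c"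
    and b: "b s0 \<le> u" "\<And>s. s \<in> I \<Longrightarrow> s \<noteq> s0 \<Longrightarrow> b s \<le> v"
  shows "(\<Sum>s\<in>I. b s * w s) \<le> c * (u + v)"
proof -
  have "(\<Sum>s\<in>I. b s * w s) \<le> (\<Sum>s\<in>I. v * w s + (if s = s0 then (u - v) * w s0 else 0))"
  proof (rule sum_mono)
    fix s assume "s \<in> I"
    then show "b s * w s \<le> v * w s + (if s = s0 then (u - v) * w s0 else 0)"
      using w(1) b mult_right_mono[of "b s" "if s = s0 then u else v" "w s"] by (auto simp: algebra_simps)
  qed
  also have "\<dots> = v * (\<Sum>s\<in>I. w s) + (if s0 \<in> I then (u - v) * w s0 else 0)"
    using fin by (simp add: sum.distrib sum_distrib_left)
  also have "\<dots> \<le> v * (2 * c) + (u - v) * c"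
    using w uv c by (intro add_mono mult_left_mono) (auto intro!: mult_left_mono)
  finally show ?thesis by (simp add: algebra_simps)
qed

section \<open>Commutators of a diagonal matrix with an orthogonal family\<close>

lemma frob_norm_commutator_diag:
  assumes B: "B \<in> carrier_mat n n"
  shows "comm_sq (mat_diag n (\<lambda>i. complex_of_real (l i))) B =
    (\<Sum>i<n. \<Sum>j<n. (l i - l j)\<^sup>2 * (cmod (B $$ (i, j)))\<^sup>2)"
proof -
  have "mat_commutator (mat_diag n (\<lambda>i. complex_of_real (l i))) B =
      mat n n (\<lambda>(i, j). of_real (l i - l j) * B $$ (i, j))"
    unfolding mat_commutator_def mat_diag_mult_left[OF B] mat_diag_mult_right[OF B]
    by (intro eq_matI) (auto simp: algebra_simps)
  then show ?thesis
    by (simp add: frob_norm_sum[OF mat_carrier] norm_mult power_mult_distrib del: of_real_diff)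
qed

lemma frob_norm_diag: "norm_sq (mat_diag n (\<lambda>i. complex_of_real (l i))) = (\<Sum>i<n. (l i)\<^sup>2)"
proof -
  have "(\<Sum>j<n. (cmod (mat_diag n (\<lambda>i. complex_of_real (l i)) $$ (i, j)))\<^sup>2) = (\<Sum>j<n. if j = i then (l i)\<^sup>2 else 0)"
    if "i < n" for i
    using that by (intro sum.cong refl) (auto simp: mat_diag_def)
  then show ?thesis by (simp add: frob_norm_sum[OF mat_diag_dim])
qed

text \<open>Split \<open>(l i - l j)^2\<close> into at most \<open>S\<close> plus the excess
  \<open>m i j\<close>. The first part gives \<open>S\<close> times the sum of the norms. The second
  gives \<open>b s * w s\<close>, where \<open>w s\<close> averages the excesses over the entries of
  \<open>B s\<close>: so \<open>w s \<le> S\<close>, and Bessel bounds the sum of the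
  \<open>w s\<close> by the total excess \<open>2 * S\<close>. Then \<open>weighted_top_two\<close>
  applies.\<close>

lemma commutator_orthogonal_family_diag:
  fixes B :: "'s \<Rightarrow> complex mat" and l :: "nat \<Rightarrow> real"
  assumes fin: "finite I" and B: "\<And>s. s \<in> I \<Longrightarrow> B s \<in> carrier_mat n n"
    and orth: "\<And>s t. s \<in> I \<Longrightarrow> t \<in> I \<Longrightarrow> s \<noteq> t \<Longrightarrow> frob_inner (B s) (B t) = 0"
    and uv: "0 \<le> v" "v \<le> u" "norm_sq (B s0) \<le> u"
      "\<And>s. s \<in> I \<Longrightarrow> s \<noteq> s0 \<Longrightarrow> norm_sq (B s) \<le> v"
  shows "(\<Sum>s\<in>I. comm_sq (mat_diag n (\<lambda>i. complex_of_real (l i))) (B s))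
    \<le> (\<Sum>i<n. (l i)\<^sup>2) * ((\<Sum>s\<in>I. norm_sq (B s)) + u + v)"
proof -
  define S where "S = (\<Sum>i<n. (l i)\<^sup>2)"
  define m where "m i j = max 0 ((l i - l j)\<^sup>2 - S)" for i j
  define b where "b s = norm_sq (B s)" for s
  define e where "e s i j = (cmod (B s $$ (i, j)))\<^sup>2" for s i j
  define w where "w s = (\<Sum>i<n. \<Sum>j<n. m i j * (e s i j / b s))" for s
  have S: "S \<ge> 0" by (simp add: S_def sum_nonneg)
  have m: "0 \<le> m i j" for i j by (simp add: m_def)
  have mS: "m i j \<le> S" if "i < n" "j < n" for i j
    using spread_le[OF that, of l] S by (simp add: m_def S_def)
  have b: "b s = (\<Sum>i<n. \<Sum>j<n. e s i j)" if "s \<in> I" for s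
    by (simp add: b_def e_def frob_norm_sum[OF B[OF that]])
  have e: "0 \<le> e s i j" for s i j by (simp add: e_def)
  have b0: "0 \<le> b s" for s by (simp add: b_def)
  \<comment> \<open>For \<open>b s = 0\<close> the division in \<open>w s\<close> has the value 0,
    and the right side vanishes with \<open>B s\<close>.\<close>
  have bw: "b s * w s = (\<Sum>i<n. \<Sum>j<n. m i j * e s i j)" if s: "s \<in> I" for s
  proof (cases "b s = 0")
    case True
    then have "B s = 0\<^sub>m n n" using frob_norm_eq_0[OF B[OF s]] by (simp add: b_def)
    then show ?thesis using True by (simp add: e_def)
  next
    case False
    then show ?thesis by (simp add: w_def sum_distrib_left)
  qed
  have "(\<Sum>s\<in>I. comm_sq (mat_diag n (\<lambda>i. complex_of_real (l i))) (B s))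
      = (\<Sum>s\<in>I. \<Sum>i<n. \<Sum>j<n. (l i - l j)\<^sup>2 * e s i j)"
    by (intro sum.cong refl) (simp add: frob_norm_commutator_diag[OF B] e_def)
  also have "\<dots> \<le> (\<Sum>s\<in>I. \<Sum>i<n. \<Sum>j<n. S * e s i j + m i j * e s i j)"
  proof (intro sum_mono)
    fix s i j
    have "(l i - l j)\<^sup>2 \<le> S + m i j" by (simp add: m_def)
    then show "(l i - l j)\<^sup>2 * e s i j \<le> S * e s i j + m i j * e s i j"
      using mult_right_mono[OF _ e] by (simp flip: distrib_right)
  qed
  also have "\<dots> = (\<Sum>s\<in>I. S * b s + b s * w s)"
    by (intro sum.cong refl) (simp add: sum.distrib bw, simp add: b sum_distrib_left)
  also have "\<dots> = S * (\<Sum>s\<in>I. b s) + (\<Sum>s\<in>I. b s * w s)" by (simp add: sum.distrib sum_distrib_left)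
  also have "(\<Sum>s\<in>I. b s * w s) \<le> S * (u + v)"
  proof (rule weighted_top_two[OF fin])
    show "0 \<le> w s" for s unfolding w_def by (intro sum_nonneg mult_nonneg_nonneg divide_nonneg_nonneg m e b0)
    show "w s \<le> S" if s: "s \<in> I" for s
    proof -
      have "w s \<le> (\<Sum>i<n. \<Sum>j<n. S * (e s i j / b s))"
        unfolding w_def by (intro sum_mono mult_right_mono divide_nonneg_nonneg mS e b0) auto
      also have "\<dots> = S * (b s / b s)"
        unfolding sum_distrib_left[symmetric] sum_divide_distrib[symmetric] b[OF s, symmetric] ..
      also have "\<dots> \<le> S" using S by (cases "b s = 0") auto
      finally show ?thesis .
    qed
    have "(\<Sum>s\<in>I. w s) = (\<Sum>i<n. \<Sum>s\<in>I. \<Sum>j<n. m i j * (e s i j / b s))"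
      unfolding w_def by (rule sum.swap)
    also have "\<dots> = (\<Sum>i<n. \<Sum>j<n. \<Sum>s\<in>I. m i j * (e s i j / b s))"
      by (intro sum.cong refl) (rule sum.swap)
    also have "\<dots> = (\<Sum>i<n. \<Sum>j<n. m i j * (\<Sum>s\<in>I. e s i j / b s))"
      by (simp only: sum_distrib_left)
    \<comment> \<open>Bessel for the matrix unit at \<open>(i, j)\<close> against the normalized
      \<open>B s\<close>.\<close>
    also have "\<dots> \<le> (\<Sum>i<n. \<Sum>j<n. m i j * 1)"
    proof (intro sum_mono mult_left_mono m)
      fix i j assume "i \<in> {..<n}" "j \<in> {..<n}"
      then have "(\<Sum>s\<in>I. (cmod (B s $$ (i, j)))\<^sup>2 / (\<Sum>ij\<in>{..<n} \<times> {..<n}. (cmod (B s $$ ij))\<^sup>2)) \<le> 1"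
        using orth B fin
        by (intro bessel_coordinate[where x="\<lambda>s ij. B s $$ ij"])
          (auto simp: frob_inner_sum[of _ n n] sum.cartesian_product split_def)
      moreover have "(\<Sum>ij\<in>{..<n} \<times> {..<n}. (cmod (B s $$ ij))\<^sup>2) = b s" if "s \<in> I" for s
        unfolding b[OF that] e_def by (simp add: sum.cartesian_product split_def)
      ultimately show "(\<Sum>s\<in>I. e s i j / b s) \<le> 1" by (simp add: e_def)
    qed
    also have "\<dots> \<le> 2 * S" using spread_excess_sum[where l=l and n=n] by (simp add: m_def S_def)
    finally show "(\<Sum>s\<in>I. w s) \<le> 2 * S" .
  qed (use uv S b_def in auto)
  finally show ?thesis by (simp add: S_def b_def algebra_simps)
qed

section \<open>Orthogonal Hermitian families\<close>

lemma commutator_orthogonal_family: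
  fixes B :: "'s \<Rightarrow> complex mat"
  assumes A: "A \<in> carrier_mat n n" "mat_adjoint A = A"
    and fin: "finite I" and B: "\<And>s. s \<in> I \<Longrightarrow> B s \<in> carrier_mat n n"
    and orth: "\<And>s t. s \<in> I \<Longrightarrow> t \<in> I \<Longrightarrow> s \<noteq> t \<Longrightarrow> frob_inner (B s) (B t) = 0"
    and uv: "0 \<le> v" "v \<le> u" "s0 \<in> I" "norm_sq (B s0) \<le> u"
      "\<And>s. s \<in> I \<Longrightarrow> s \<noteq> s0 \<Longrightarrow> norm_sq (B s) \<le> v"
  shows "(\<Sum>s\<in>I. comm_sq A (B s))
    \<le> norm_sq A * ((\<Sum>s\<in>I. norm_sq (B s)) + u + v)"
proof -
  obtain P l where P: "P \<in> unitary_matrices n"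
    and diag: "unitary_conj P A = mat_diag n (\<lambda>i. complex_of_real (l i))"
    unfolding unitary_conj_def by (rule hermitian_spectral[OF A])
  have "(\<Sum>s\<in>I. comm_sq (unitary_conj P A) (unitary_conj P (B s)))
    \<le> (\<Sum>i<n. (l i)\<^sup>2) * ((\<Sum>s\<in>I. norm_sq (unitary_conj P (B s))) + u + v)"
    unfolding diag
  proof (rule commutator_orthogonal_family_diag[OF fin _ _ uv(1,2)])
    show "unitary_conj P (B s) \<in> carrier_mat n n" if "s \<in> I" for s
      by (rule unitary_conj_carrier[OF P B[OF that]])
    show "frob_inner (unitary_conj P (B s)) (unitary_conj P (B t)) = 0" if "s \<in> I" "t \<in> I" "s \<noteq> t" for s t
      using orth[OF that] by (simp only: unitary_conj_inner[OF P B[OF that(1)] B[OF that(2)]])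
    show "norm_sq (unitary_conj P (B s0)) \<le> u"
      using uv(4) by (simp only: unitary_conj_norm[OF P B[OF uv(3)]])
    show "norm_sq (unitary_conj P (B s)) \<le> v" if "s \<in> I" "s \<noteq> s0" for s
      using uv(5)[OF that] by (simp only: unitary_conj_norm[OF P B[OF that(1)]])
  qed
  also have "(\<Sum>i<n. (l i)\<^sup>2) = norm_sq A"
    using frob_norm_diag[of n l] unfolding diag[symmetric] unitary_conj_norm[OF P A(1)] ..
  finally show ?thesis
    using B by (simp add: unitary_conj_commutator_norm[OF P A(1)] unitary_conj_norm[OF P] cong: sum.cong)
qed

text \<open>In the deviations \<open>P\<close>, \<open>Q\<close>, \<open>R\<close> of
  \<open>p\<close>, \<open>q\<close>, \<open>r\<close> from \<open>S / 3\<close> the left side is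
  the form \<open>2 P^2 + 2 Q^2 + R^2 - R (P + Q)\<close>; completing squares shows that it vanishes
  only at \<open>p = q = r = S / 3\<close>.\<close>

lemma ddvv_polynomial:
  fixes p q r S :: real
  shows "4 / 3 * S\<^sup>2 - (S\<^sup>2 - (p\<^sup>2 + q\<^sup>2 + r\<^sup>2) + S * (p + q) + p * (r - p) + q * (r - q)) =
    2 * ((p - S / 3) - (r - S / 3) / 4)\<^sup>2 + 2 * ((q - S / 3) - (r - S / 3) / 4)\<^sup>2 + 3 / 4 * (r - S / 3)\<^sup>2"
  by (simp add: power2_eq_square field_simps)

lemma frob_norm_commutator_self [simp]: "A \<in> carrier_mat n n \<Longrightarrow> frob_norm (mat_commutator A A) = 0"
proof -
  assume "A \<in> carrier_mat n n"
  then have "mat_commutator A A = 0\<^sub>m n n" unfolding mat_commutator_def by (intro eq_matI) auto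
  then show ?thesis by simp
qed

lemma sum_commutators_three:
  fixes A :: "nat \<Rightarrow> complex mat"
  defines "c r s \<equiv> comm_sq (A r) (A s)"
  assumes k: "k \<ge> 3" and A: "\<And>r. r < k \<Longrightarrow> A r \<in> carrier_mat n n"
    and Az: "\<And>r. 3 \<le> r \<Longrightarrow> r < k \<Longrightarrow> A r = 0\<^sub>m n n"
  shows "(\<Sum>r<k. \<Sum>s<k. c r s) = 2 * (c 0 1 + c 0 2 + c 1 2)"
proof -
  have cz: "c r s = 0" if "r < k" "s < k" "3 \<le> r \<or> 3 \<le> s" for r s
  proof -
    have "mat_commutator (A r) (A s) = 0\<^sub>m n n"
      using that Az A[OF that(1)] A[OF that(2)] by (auto simp: mat_commutator_def)
    then show ?thesis by (simp add: c_def)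
  qed
  have "(\<Sum>r<k. \<Sum>s<k. c r s) = (\<Sum>r<3. \<Sum>s<k. c r s)"
    using k cz by (intro sum.mono_neutral_right) (auto intro!: sum.neutral)
  also have "\<dots> = (\<Sum>r<3. \<Sum>s<3. c r s)"
    using k cz by (intro sum.cong refl sum.mono_neutral_right) auto
  also have "\<dots> = 2 * (c 0 1 + c 0 2 + c 1 2)"
  proof -
    have sym: "c (Suc 0) 0 = c 0 (Suc 0)" "c 2 0 = c 0 2" "c 2 (Suc 0) = c (Suc 0) 2"
      unfolding c_def
      using k by (simp_all add: frob_norm_commutator_commute[of "A 0" n "A (Suc 0)"] A
          frob_norm_commutator_commute[of "A 0" n "A 2"] frob_norm_commutator_commute[of "A (Suc 0)" n "A 2"])
    have diag: "c r r = 0" if "r < k" for r using A[OF that] by (simp add: c_def)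
    have "{..<3} = {0, 1, 2 :: nat}" by auto
    then show ?thesis using k by (simp add: sym diag)
  qed
  finally show ?thesis .
qed

context
  fixes k n :: nat and A :: "nat \<Rightarrow> complex mat"
  assumes k: "k \<ge> 3"
    and A: "\<And>r. r < k \<Longrightarrow> A r \<in> carrier_mat n n" "\<And>r. r < k \<Longrightarrow> mat_adjoint (A r) = A r"
    and orth: "\<And>r s. r < k \<Longrightarrow> s < k \<Longrightarrow> r \<noteq> s \<Longrightarrow> frob_inner (A r) (A s) = 0"
    and sorted: "\<And>r s. r \<le> s \<Longrightarrow> s < k \<Longrightarrow> norm_sq (A s) \<le> norm_sq (A r)"
begin

private abbreviation (input) "a r \<equiv> norm_sq (A r)"
private abbreviation (input) "c r s \<equiv> comm_sq (A r) (A s)"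
private abbreviation (input) "S \<equiv> (\<Sum>r<k. a r)"

lemma sorted_norm: "r \<le> s \<Longrightarrow> s < k \<Longrightarrow> frob_norm (A s) \<le> frob_norm (A r)"
  using sorted[of r s] by simp

lemma ddvv_row:
  assumes r: "r < k" and u: "v \<le> u" "0 \<le> v" and s0: "s0 < k" "s0 \<noteq> r" "a s0 \<le> u"
    and v: "\<And>s. s < k \<Longrightarrow> s \<noteq> r \<Longrightarrow> s \<noteq> s0 \<Longrightarrow> a s \<le> v"
  shows "(\<Sum>s<k. c r s) \<le> a r * (S - a r + u + v)"
proof -
  have "(\<Sum>s<k. c r s) = (\<Sum>s\<in>{..<k} - {r}. c r s)"
    using A(1)[OF r] r by (simp add: sum.remove[of "{..<k}" r])
  also have "\<dots> \<le> a r * ((\<Sum>s\<in>{..<k} - {r}. a s) + u + v)"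
    using A orth u s0 v by (intro commutator_orthogonal_family[OF A(1)[OF r] A(2)[OF r], where ?s0.0=s0]) auto
  also have "(\<Sum>s\<in>{..<k} - {r}. a s) = S - a r"
    using r by (simp add: sum.remove[of "{..<k}" r])
  finally show ?thesis .
qed

text \<open>The two largest of the other norms are \<open>a 0\<close> and \<open>a 1\<close> for
  every row but two: row 0 has \<open>a 1\<close> and \<open>a 2\<close>, row 1 has
  \<open>a 0\<close> and \<open>a 2\<close>, whence the corrections \<open>a 2 - a 0\<close> and
  \<open>a 2 - a 1\<close>. Of the subtracted squares only the first three are kept.\<close>

lemma ddvv_sum_le:
  "(\<Sum>r<k. \<Sum>s<k. c r s) \<le> S\<^sup>2 - ((a 0)\<^sup>2 + (a 1)\<^sup>2 + (a 2)\<^sup>2) + S * (a 0 + a 1) + a 0 * (a 2 - a 0) + a 1 * (a 2 - a 1)"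
proof -
  have "(\<Sum>r<k. \<Sum>s<k. c r s) \<le> (\<Sum>r<k. a r * (S - a r + ((a 0 + a 1)
      + (if r = 0 then a 2 - a 0 else 0) + (if r = 1 then a 2 - a 1 else 0))))"
  proof (rule sum_mono)
    fix r assume "r \<in> {..<k}"
    then have r: "r < k" by simp
    consider "r = 0" | "r = 1" | "r \<ge> 2" by linarith
    then show "(\<Sum>s<k. c r s) \<le> a r * (S - a r + ((a 0 + a 1)
      + (if r = 0 then a 2 - a 0 else 0) + (if r = 1 then a 2 - a 1 else 0)))"
    proof cases
      case 1
      have "(\<Sum>s<k. c 0 s) \<le> a 0 * (S - a 0 + a 1 + a 2)"
        using k by (intro ddvv_row[where ?s0.0=1]) (auto intro!: sorted_norm)
      then show ?thesis using 1 by (simp add: algebra_simps)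
    next
      case 2
      have "(\<Sum>s<k. c 1 s) \<le> a 1 * (S - a 1 + a 0 + a 2)"
        using k by (intro ddvv_row[where ?s0.0=0]) (auto intro!: sorted_norm)
      then show ?thesis using 2 by (simp add: algebra_simps)
    next
      case 3
      have "(\<Sum>s<k. c r s) \<le> a r * (S - a r + a 0 + a 1)"
        using k r 3 by (intro ddvv_row[where ?s0.0=0]) (auto intro!: sorted_norm)
      then show ?thesis using 3 by (simp add: algebra_simps)
    qed
  qed
  also have "\<dots> = (\<Sum>r<k. a r * S - (a r)\<^sup>2 + a r * (a 0 + a 1)
      + (if r = 0 then a 0 * (a 2 - a 0) else 0) + (if r = 1 then a 1 * (a 2 - a 1) else 0))"
    by (intro sum.cong refl) (auto simp: algebra_simps power2_eq_square)
  also have "\<dots> = S * S - (\<Sum>r<k. (a r)\<^sup>2) + S * (a 0 + a 1) + a 0 * (a 2 - a 0) + a 1 * (a 2 - a 1)"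
    using k by (simp add: sum.distrib sum_subtractf flip: sum_distrib_right)
  also have "\<dots> \<le> S\<^sup>2 - ((a 0)\<^sup>2 + (a 1)\<^sup>2 + (a 2)\<^sup>2) + S * (a 0 + a 1) + a 0 * (a 2 - a 0) + a 1 * (a 2 - a 1)"
    using sum_subset_le[of "\<lambda>r. (a r)\<^sup>2" "{0, 1, 2}" k] k by (simp add: power2_eq_square)
  finally show ?thesis .
qed

lemma ddvv_orthogonal: "(\<Sum>r<k. \<Sum>s<k. c r s) \<le> 4 / 3 * S\<^sup>2"
proof (rule order_trans[OF ddvv_sum_le])
  have "0 \<le> 4 / 3 * S\<^sup>2 - (S\<^sup>2 - ((a 0)\<^sup>2 + (a 1)\<^sup>2 + (a 2)\<^sup>2) + S * (a 0 + a 1)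
      + a 0 * (a 2 - a 0) + a 1 * (a 2 - a 1))"
    unfolding ddvv_polynomial by simp
  then show "S\<^sup>2 - ((a 0)\<^sup>2 + (a 1)\<^sup>2 + (a 2)\<^sup>2) + S * (a 0 + a 1)
      + a 0 * (a 2 - a 0) + a 1 * (a 2 - a 1) \<le> 4 / 3 * S\<^sup>2"
    by (rule diff_ge_0_iff_ge[THEN iffD1])
qed

text \<open>The sum of squares vanishes, so the first three norms exhaust \<open>S\<close> and all
  other matrices are zero. The three remaining commutators then add up to the sum of their
  Boettcher-Wenzel bounds, so each attains its bound; the two that involve \<open>A 0\<close>
  suffice for the normal form, where \<open>A 0\<close> is diagonalized.\<close>

lemma ddvv_orthogonal_equality:
  assumes eq: "(\<Sum>r<k. \<Sum>s<k. c r s) = 4 / 3 * S\<^sup>2"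
  shows "a 0 = S / 3" "a 1 = S / 3" "a 2 = S / 3"
    and "\<And>r. 3 \<le> r \<Longrightarrow> r < k \<Longrightarrow> A r = 0\<^sub>m n n"
    and "c 0 1 = 2 * a 0 * a 1" "c 0 2 = 2 * a 0 * a 2"
proof -
  define x where "x = (a 0 - S / 3) - (a 2 - S / 3) / 4"
  define y where "y = (a 1 - S / 3) - (a 2 - S / 3) / 4"
  define z where "z = a 2 - S / 3"
  have "2 * x\<^sup>2 + 2 * y\<^sup>2 + 3 / 4 * z\<^sup>2 \<le> 0"
    unfolding x_def y_def z_def ddvv_polynomial[symmetric] eq[symmetric] diff_le_0_iff_le by (rule ddvv_sum_le)
  moreover have "0 \<le> 2 * x\<^sup>2 + 2 * y\<^sup>2 + 3 / 4 * z\<^sup>2" by simp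
  ultimately have "2 * x\<^sup>2 + 2 * y\<^sup>2 + 3 / 4 * z\<^sup>2 = 0" by (rule antisym)
  then have xyz: "x = 0" "y = 0" "z = 0" by (simp_all add: add_nonneg_eq_0_iff)
  show a: "a 0 = S / 3" "a 1 = S / 3" "a 2 = S / 3" using xyz by (auto simp: x_def y_def z_def)
  show Az: "A r = 0\<^sub>m n n" if r: "3 \<le> r" "r < k" for r
  proof -
    have "sum a {0, 1, 2, r} \<le> S" using r k by (intro sum_subset_le) auto
    then have "a 0 + (a 1 + (a 2 + a r)) \<le> S" using r by simp
    moreover have "x / 3 + (x / 3 + (x / 3 + y)) = x + y" for x y :: real by simp
    ultimately have "a r \<le> 0" unfolding a by simp
    then have "a r = 0" by (intro antisym) simp_all
    then show ?thesis using frob_norm_eq_0[OF A(1)[OF r(2)]] by simp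
  qed
  have sum: "2 * (c 0 1 + c 0 2 + c 1 2) = 4 / 3 * S\<^sup>2"
    using sum_commutators_three[of k A n] k A(1) Az eq by simp
  have bw: "c r s \<le> 2 * a r * a s" if "r < k" "s < k" for r s
    using boettcher_wenzel A(1) that by blast
  have "2 * a 0 * a 1 + 2 * a 0 * a 2 + 2 * a 1 * a 2 = 2 / 3 * S\<^sup>2"
    unfolding a by (simp add: power2_eq_square)
  then have total: "c 0 1 + c 0 2 + c 1 2 = 2 * a 0 * a 1 + 2 * a 0 * a 2 + 2 * a 1 * a 2" using sum by simp
  have extremal: "x = x' \<and> y = y'" if "x + y + z = x' + y' + z'" "x \<le> x'" "y \<le> y'" "z \<le> z'"
    for x y z x' y' z' :: real
    using that by simp
  show "c 0 1 = 2 * a 0 * a 1" "c 0 2 = 2 * a 0 * a 2"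
    using extremal[OF total bw bw bw] k by auto
qed

end

section \<open>Extremal pairs of eigenvalues and antidiagonal support\<close>

lemma sum_two_antidiagonal:
  fixes f :: "nat \<Rightarrow> nat \<Rightarrow> 'a::comm_monoid_add"
  assumes "n \<ge> 2" "\<And>i j. i < n \<Longrightarrow> j < n \<Longrightarrow> \<not> (i = 0 \<and> j = 1) \<Longrightarrow> \<not> (i = 1 \<and> j = 0) \<Longrightarrow> f i j = 0"
  shows "(\<Sum>i<n. \<Sum>j<n. f i j) = f 0 1 + f 1 0"
proof -
  have "(\<Sum>i<n. \<Sum>j<n. f i j) = (\<Sum>(i, j)\<in>{..<n} \<times> {..<n}. f i j)"
    by (simp add: sum.cartesian_product)
  also have "\<dots> = (\<Sum>(i, j)\<in>{(0, 1), (1, 0)}. f i j)"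
  proof (rule sum.mono_neutral_right)
    show "\<forall>x\<in>{..<n} \<times> {..<n} - {(0, 1), (1, 0)}. (case x of (i, j) \<Rightarrow> f i j) = 0"
    proof
      fix x assume x: "x \<in> {..<n} \<times> {..<n} - {(0, 1), (1, 0)}"
      obtain i j where "x = (i, j)" by fastforce
      then show "(case x of (i, j) \<Rightarrow> f i j) = 0" using x assms(2)[of i j] by auto
    qed
  qed (use assms(1) in auto)
  finally show ?thesis by simp
qed

text \<open>Equality case of \<open>spread_le\<close>: in
  \<open>2 (l i)^2 + 2 (l j)^2 - (l i + l j)^2\<close> the last square must vanish and the first two
  must exhaust the sum.\<close>

lemma extreme_spread:
  fixes l :: "nat \<Rightarrow> real"
  assumes ij: "i < n" "j < n" and pos: "(\<Sum>k<n. (l k)\<^sup>2) > 0"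
    and eq: "(l i - l j)\<^sup>2 = 2 * (\<Sum>k<n. (l k)\<^sup>2)"
  shows "i \<noteq> j" "l i = - l j" "l i \<noteq> 0" "\<And>k. k < n \<Longrightarrow> k \<noteq> i \<Longrightarrow> k \<noteq> j \<Longrightarrow> l k = 0"
proof -
  show ne: "i \<noteq> j" using pos eq by auto
  have id: "(l i - l j)\<^sup>2 = 2 * (l i)\<^sup>2 + 2 * (l j)\<^sup>2 - (l i + l j)\<^sup>2" by (simp add: power2_sum power2_diff)
  have le: "(l i)\<^sup>2 + (l j)\<^sup>2 \<le> (\<Sum>k<n. (l k)\<^sup>2)"
    using sum_subset_le[of "\<lambda>k. (l k)\<^sup>2" "{i, j}" n] ij ne by simp
  then have "(l i + l j)\<^sup>2 = 0" using id eq zero_le_power2[of "l i + l j"] by (smt (verit))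
  then show neg: "l i = - l j" by simp
  then have full: "(l i)\<^sup>2 + (l j)\<^sup>2 = (\<Sum>k<n. (l k)\<^sup>2)" using id eq by simp
  then show "l i \<noteq> 0" using pos neg by auto
  show "l k = 0" if "k < n" "k \<noteq> i" "k \<noteq> j" for k
  proof -
    have "(l k)\<^sup>2 + ((l i)\<^sup>2 + (l j)\<^sup>2) \<le> (\<Sum>k<n. (l k)\<^sup>2)"
      using sum_subset_le[of "\<lambda>k. (l k)\<^sup>2" "{k, i, j}" n] ij ne that by simp
    then show ?thesis using full by simp
  qed
qed

text \<open>The squared norm of the commutator weighs the entry \<open>(i, j)\<close> with
  \<open>(l i - l j)^2\<close>, at most twice the sum of the squares. Equality therefore confines
  \<open>B\<close> to extremal pairs of eigenvalues, and the order allows only the pair 0,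
  1.\<close>

lemma extreme_commutator_support:
  fixes l :: "nat \<Rightarrow> real"
  assumes n: "n \<ge> 2" and B: "B \<in> carrier_mat n n" and pos: "(\<Sum>k<n. (l k)\<^sup>2) > 0"
    and sorted: "\<forall>i j. i \<le> j \<longrightarrow> j < n \<longrightarrow> \<bar>l j\<bar> \<le> \<bar>l i\<bar>"
    and eq: "comm_sq (mat_diag n (\<lambda>i. complex_of_real (l i))) B
      = 2 * (\<Sum>k<n. (l k)\<^sup>2) * norm_sq B"
    and ij: "i < n" "j < n" "B $$ (i, j) \<noteq> 0"
  shows "(i = 0 \<and> j = 1 \<or> i = 1 \<and> j = 0) \<and> l 1 = - l 0 \<and> l 0 \<noteq> 0 \<and> (\<forall>k<n. 2 \<le> k \<longrightarrow> l k = 0)"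
proof -
  define S where "S = (\<Sum>k<n. (l k)\<^sup>2)"
  let ?d = "\<lambda>i j. (2 * S - (l i - l j)\<^sup>2) * (cmod (B $$ (i, j)))\<^sup>2"
  have nn: "0 \<le> ?d i j" if "i < n" "j < n" for i j
    using spread_le[OF that, of l] by (simp add: S_def)
  have "(\<Sum>i<n. \<Sum>j<n. ?d i j) = 2 * S * norm_sq B - (\<Sum>i<n. \<Sum>j<n. (l i - l j)\<^sup>2 * (cmod (B $$ (i, j)))\<^sup>2)"
    by (simp add: frob_norm_sum[OF B] left_diff_distrib sum_subtractf sum_distrib_left)
  also have "\<dots> = 0" using eq unfolding frob_norm_commutator_diag[OF B] S_def by simp
  finally have "(\<Sum>i<n. \<Sum>j<n. ?d i j) = 0" .
  then have "(\<Sum>j<n. ?d i j) = 0"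
    using ij(1) by (subst (asm) sum_nonneg_eq_0_iff) (auto intro!: sum_nonneg nn)
  then have "?d i j = 0" using ij by (subst (asm) sum_nonneg_eq_0_iff) (auto intro!: nn)
  then have "(l i - l j)\<^sup>2 = 2 * (\<Sum>k<n. (l k)\<^sup>2)" using ij(3) by (simp add: S_def)
  note e = extreme_spread[OF ij(1,2) pos this]
  have in0: "i = 0 \<or> j = 0"
  proof (rule ccontr)
    assume "\<not> ?thesis"
    then have "l 0 = 0" using e(4)[of 0] n by auto
    then show False using sorted[rule_format, of 0 i] ij e(3) by simp
  qed
  have in1: "i = 1 \<or> j = 1"
  proof (rule ccontr)
    assume as: "\<not> ?thesis"
    then have z: "l 1 = 0" using e(4)[of 1] n by auto
    have "i \<ge> 1 \<or> j \<ge> 1" using e(1) by auto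
    then show False using sorted[rule_format, of 1 i] sorted[rule_format, of 1 j] ij e z by auto
  qed
  have pos: "i = 0 \<and> j = 1 \<or> i = 1 \<and> j = 0" using in0 in1 by auto
  then have "l 1 = - l 0" "l 0 \<noteq> 0" using e(2,3) by auto
  moreover have "l k = 0" if "k < n" "2 \<le> k" for k using e(4)[OF that(1)] pos that by auto
  ultimately show ?thesis using pos by blast
qed

section \<open>The extremal triple\<close>

lemma diag_zero_eq:
  assumes "H \<in> carrier_mat 2 2" "n \<ge> 2"
  shows "diag_zero n H = mat n n (\<lambda>(i, j). if i < 2 \<and> j < 2 then H $$ (i, j) else 0)"
  using assms by (intro eq_matI) (auto simp: diag_zero_def Let_def)

text \<open>\<open>pauli_z\<close>, \<open>pauli_x\<close>, \<open>pauli_y\<close> stand for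
  \<open>diag(H_1, 0)\<close>, \<open>diag(H_2, 0)\<close>, \<open>diag(H_3, 0)\<close> of the
  theorem, with \<open>c\<close> for lambda.\<close>

definition pauli_z :: "nat \<Rightarrow> real \<Rightarrow> complex mat" where
  "pauli_z n c = diag_zero n (mat_of_rows_list 2 [[of_real c, 0], [0, - of_real c]])"

definition pauli_x :: "nat \<Rightarrow> real \<Rightarrow> complex mat" where
  "pauli_x n c = diag_zero n (mat_of_rows_list 2 [[0, of_real c], [of_real c, 0]])"

definition pauli_y :: "nat \<Rightarrow> real \<Rightarrow> complex mat" where
  "pauli_y n c = diag_zero n (mat_of_rows_list 2 [[0, - of_real c * \<i>], [of_real c * \<i>, 0]])"

definition pauli_family :: "nat \<Rightarrow> real \<Rightarrow> nat \<Rightarrow> complex mat" where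
  "pauli_family n c l =
    (if l = 0 then pauli_z n c else if l = 1 then pauli_x n c else if l = 2 then pauli_y n c else 0\<^sub>m n n)"

lemma mat_of_rows_list_2_carrier: "mat_of_rows_list 2 [[a, b], [c, d]] \<in> carrier_mat 2 2"
  by (auto simp: mat_of_rows_list_def)

lemma mat_of_rows_list_2_index:
  "i < 2 \<Longrightarrow> j < 2 \<Longrightarrow> mat_of_rows_list 2 [[a, b], [c, d]] $$ (i, j) =
    (if i = 0 then (if j = 0 then a else b) else (if j = 0 then c else d))"
  by (auto simp: mat_of_rows_list_def less_2_cases_iff)

lemma pauli_z_eq:
  "n \<ge> 2 \<Longrightarrow> pauli_z n c = mat n n (\<lambda>(i, j). if i = 0 \<and> j = 0 then of_real c else if i = 1 \<and> j = 1 then - of_real c else 0)"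
  unfolding pauli_z_def diag_zero_eq[OF mat_of_rows_list_2_carrier]
  by (intro eq_matI) (auto simp: mat_of_rows_list_2_index)

lemma pauli_x_eq:
  "n \<ge> 2 \<Longrightarrow> pauli_x n c = mat n n (\<lambda>(i, j). if i = 0 \<and> j = 1 \<or> i = 1 \<and> j = 0 then of_real c else 0)"
  unfolding pauli_x_def diag_zero_eq[OF mat_of_rows_list_2_carrier]
  by (intro eq_matI) (auto simp: mat_of_rows_list_2_index)

lemma pauli_y_eq:
  "n \<ge> 2 \<Longrightarrow> pauli_y n c = mat n n (\<lambda>(i, j). if i = 0 \<and> j = 1 then - of_real c * \<i> else if i = 1 \<and> j = 0 then of_real c * \<i> else 0)"
  unfolding pauli_y_def diag_zero_eq[OF mat_of_rows_list_2_carrier]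
  by (intro eq_matI) (auto simp: mat_of_rows_list_2_index)

lemma mat_square_cong: "(\<And>i j. i < n \<Longrightarrow> j < n \<Longrightarrow> f (i, j) = g (i, j)) \<Longrightarrow> mat n n f = mat n n g"
  by (intro eq_matI) auto

lemma smult_mat_square: "a \<cdot>\<^sub>m mat n n f = mat n n (\<lambda>ij. a * f ij)"
  by (intro eq_matI) auto

lemma mat_diag_unitary:
  assumes "\<And>i. i < n \<Longrightarrow> cmod (v i) = 1"
  shows "mat_diag n v \<in> unitary_matrices n"
    and "\<And>M. M \<in> carrier_mat n n \<Longrightarrow> unitary_conj (mat_diag n v) M = mat n n (\<lambda>(i, j). cnj (v i) * M $$ (i, j) * v j)"
proof -
  have adj: "mat_adjoint (mat_diag n v) = mat_diag n (\<lambda>i. cnj (v i))"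
    by (intro eq_matI) (auto simp: mat_diag_def)
  have 1: "v i * cnj (v i) = 1" if "i < n" for i
    using assms[OF that] by (simp flip: complex_norm_square)
  show "mat_diag n v \<in> unitary_matrices n"
    unfolding unitary_matrices_def adj mem_Collect_eq mat_diag_diag
    by (auto simp: mat_diag_def 1 mult.commute[of "cnj _"] intro!: eq_matI)
  show "unitary_conj (mat_diag n v) M = mat n n (\<lambda>(i, j). cnj (v i) * M $$ (i, j) * v j)"
    if M: "M \<in> carrier_mat n n" for M
    unfolding unitary_conj_def adj mat_diag_mult_left[OF M] mat_diag_mult_right[OF mat_carrier]
    by (intro eq_matI) auto
qed

lemma unitary_conj_compose:
  assumes "P \<in> unitary_matrices n" "Q \<in> unitary_matrices n" "A \<in> carrier_mat n n"
  shows "unitary_conj (P * Q) A = unitary_conj Q (unitary_conj P A)"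
proof -
  note c = unitary_carrier[OF assms(1)] unitary_carrier[OF assms(2)]
  note c' = mat_adjoint_carrier[OF c(1)] mat_adjoint_carrier[OF c(2)]
  show ?thesis
    unfolding unitary_conj_def mat_adjoint_mult[OF c] using c c' assms(3)
    by (simp add: assoc_mult_square[of _ n] mult_carrier_square[of _ n])
qed

text \<open>Once \<open>A0\<close> is diagonal, extremality makes it a multiple of
  \<open>pauli_z\<close> and makes \<open>A1\<close>, \<open>A2\<close> antidiagonal on the block. A
  diagonal unitary matrix makes the entries of \<open>A1\<close> positive; orthogonality then leaves
  only a sign for \<open>A2\<close>. The signs \<open>e0\<close> and \<open>e2\<close> are left to
  the orthogonal mixing.\<close>

lemma pauli_normal_form:
  assumes n: "n \<ge> 2"
    and A: "A0 \<in> carrier_mat n n" "mat_adjoint A0 = A0" "A1 \<in> carrier_mat n n" "mat_adjoint A1 = A1"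
      "A2 \<in> carrier_mat n n" "mat_adjoint A2 = A2"
    and norms: "norm_sq A0 = a" "norm_sq A1 = a" "norm_sq A2 = a" and a: "a > 0"
    and comm: "comm_sq A0 A1 = 2 * a * a" "comm_sq A0 A2 = 2 * a * a"
    and orth: "frob_inner A1 A2 = 0"
  shows "\<exists>P\<in>unitary_matrices n. \<exists>e0\<in>{1, -1}. \<exists>e2\<in>{1, -1}. \<exists>c\<ge>0.
    unitary_conj P A0 = complex_of_real e0 \<cdot>\<^sub>m pauli_z n c \<and> unitary_conj P A1 = pauli_x n c \<and>
    unitary_conj P A2 = complex_of_real e2 \<cdot>\<^sub>m pauli_y n c"
proof -
  obtain P l where P: "P \<in> unitary_matrices n"
    and diag: "unitary_conj P A0 = mat_diag n (\<lambda>i. complex_of_real (l i))"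
    and sorted: "\<forall>i j. i \<le> j \<longrightarrow> j < n \<longrightarrow> \<bar>l j\<bar> \<le> \<bar>l i\<bar>"
    unfolding unitary_conj_def by (rule hermitian_spectral[OF A(1,2)])
  define B1 where "B1 = unitary_conj P A1"
  define B2 where "B2 = unitary_conj P A2"
  have B1: "B1 \<in> carrier_mat n n" and B2: "B2 \<in> carrier_mat n n"
    unfolding B1_def B2_def by (rule unitary_conj_carrier[OF P A(3)], rule unitary_conj_carrier[OF P A(5)])
  have lsum: "(\<Sum>k<n. (l k)\<^sup>2) = a"
    using frob_norm_diag[of n l] unfolding diag[symmetric] unitary_conj_norm[OF P A(1)] norms(1) by simp
  then have lpos: "(\<Sum>k<n. (l k)\<^sup>2) > 0" using a by simp
  have nB: "norm_sq B1 = a" "norm_sq B2 = a"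
    unfolding B1_def B2_def unitary_conj_norm[OF P A(3)] unitary_conj_norm[OF P A(5)] by (fact norms)+
  have cB: "comm_sq (mat_diag n (\<lambda>i. complex_of_real (l i))) B1 = 2 * (\<Sum>k<n. (l k)\<^sup>2) * norm_sq B1"
    "comm_sq (mat_diag n (\<lambda>i. complex_of_real (l i))) B2 = 2 * (\<Sum>k<n. (l k)\<^sup>2) * norm_sq B2"
    unfolding lsum nB unfolding diag[symmetric] B1_def B2_def
      unitary_conj_commutator_norm[OF P A(1) A(3)] unitary_conj_commutator_norm[OF P A(1) A(5)] by (fact comm)+
  note s1 = extreme_commutator_support[OF n B1 lpos sorted cB(1)]
  note s2 = extreme_commutator_support[OF n B2 lpos sorted cB(2)]
  have herm: "B1 $$ (1, 0) = cnj (B1 $$ (0, 1))" "B2 $$ (1, 0) = cnj (B2 $$ (0, 1))"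
  proof -
    have "mat_adjoint B1 $$ (1, 0) = B1 $$ (1, 0)" "mat_adjoint B2 $$ (1, 0) = B2 $$ (1, 0)"
      unfolding B1_def B2_def unitary_conj_adjoint[OF P A(3)] unitary_conj_adjoint[OF P A(5)] A by simp_all
    then show "B1 $$ (1, 0) = cnj (B1 $$ (0, 1))" "B2 $$ (1, 0) = cnj (B2 $$ (0, 1))"
      using B1 B2 n by simp_all
  qed
  have z1: "B1 $$ (i, j) = 0" "B2 $$ (i, j) = 0" if "i < n" "j < n" "\<not> (i = 0 \<and> j = 1)" "\<not> (i = 1 \<and> j = 0)" for i j
    using s1[OF that(1,2)] s2[OF that(1,2)] that(3,4) by blast+
  define z where "z = B1 $$ (0, 1)"
  define w where "w = B2 $$ (0, 1)"
  \<comment> \<open>Each of the three matrices ends up with two nonzero entries of modulus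
    \<open>c\<close>, so \<open>a = 2 c^2\<close>.\<close>
  define c where "c = sqrt (a / 2)"
  have c: "c > 0" "c\<^sup>2 = a / 2" using a by (auto simp: c_def)
  have "norm_sq B1 = (cmod (B1 $$ (0, 1)))\<^sup>2 + (cmod (B1 $$ (1, 0)))\<^sup>2"
    unfolding frob_norm_sum[OF B1] by (rule sum_two_antidiagonal[OF n]) (simp add: z1)
  then have "(cmod z)\<^sup>2 = c\<^sup>2" unfolding nB herm c z_def by simp
  then have cz: "cmod z = c" by (rule power2_eq_imp_eq) (use c in auto)
  have "norm_sq B2 = (cmod (B2 $$ (0, 1)))\<^sup>2 + (cmod (B2 $$ (1, 0)))\<^sup>2"
    unfolding frob_norm_sum[OF B2] by (rule sum_two_antidiagonal[OF n]) (simp add: z1)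
  then have "(cmod w)\<^sup>2 = c\<^sup>2" unfolding nB herm c w_def by simp
  then have cw: "cmod w = c" by (rule power2_eq_imp_eq) (use c in auto)
  have "frob_inner B1 B2 = B1 $$ (0, 1) * cnj (B2 $$ (0, 1)) + B1 $$ (1, 0) * cnj (B2 $$ (1, 0))"
    unfolding frob_inner_sum[OF B1 B2] by (rule sum_two_antidiagonal[OF n]) (simp add: z1)
  moreover have "frob_inner B1 B2 = 0" unfolding B1_def B2_def unitary_conj_inner[OF P A(3) A(5)] by (rule orth)
  ultimately have "z * cnj w + cnj z * w = 0" by (simp add: herm[unfolded One_nat_def] z_def w_def)
  \<comment> \<open>Thus \<open>w\<close> is a real multiple of \<open>\<i> * z\<close>.\<close>
  then have re: "Re (w * cnj z) = 0" by (simp add: complex_eq_iff algebra_simps)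
  have "B1 $$ (0, 1) \<noteq> 0" using cz c by (auto simp: z_def)
  then have l: "l 1 = - l 0" "\<forall>k<n. 2 \<le> k \<longrightarrow> l k = 0" using s1[of 0 1] n by auto
  have "(\<Sum>k<n. (l k)\<^sup>2) = (\<Sum>k<2. (l k)\<^sup>2)" using n l(2) by (intro sum.mono_neutral_right) auto
  then have "(l 0)\<^sup>2 = c\<^sup>2" unfolding lsum c using l(1) by (simp add: numeral_2_eq_2)
  then obtain e0 where e0: "e0 \<in> {1, -1}" "l 0 = e0 * c"
    using that[of 1] that[of "-1"] by (auto simp: power2_eq_iff)
  \<comment> \<open>The phase that turns \<open>z\<close> into \<open>c\<close>.\<close>
  define u where "u = cnj z / of_real c"
  have cu: "cmod u = 1" using cz c by (simp add: u_def norm_divide)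
  have zu: "z * u = of_real c"
  proof -
    have "z * u = of_real (c\<^sup>2) / of_real c" unfolding u_def cz[symmetric] complex_norm_square by simp
    then show ?thesis using c by (simp add: power2_eq_square)
  qed
  have "Re (w * u) = 0" using re by (simp add: u_def Re_divide_of_real)
  moreover have "cmod (w * u) = c" by (simp add: norm_mult cw cu)
  ultimately have "(Im (w * u))\<^sup>2 = c\<^sup>2" by (metis add_0 cmod_power2 zero_power2)
  \<comment> \<open>The minus sign matches the entry \<open>- of_real c * \<i>\<close> of
    \<open>pauli_y\<close> at \<open>(0, 1)\<close>.\<close>
  then obtain e2 where e2: "e2 \<in> {1, -1}" "Im (w * u) = - e2 * c"
    using that[of 1] that[of "-1"] by (auto simp: power2_eq_iff simp del: times_complex.sel)
  have wu: "w * u = - (of_real e2 * of_real c * \<i>)"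
    using e2 \<open>Re (w * u) = 0\<close> by (simp add: complex_eq_iff)
  \<comment> \<open>Conjugation with this diagonal matrix multiplies the entry \<open>(0, 1)\<close>
    by \<open>u\<close>, the entry \<open>(1, 0)\<close> by \<open>cnj u\<close>, and fixes the
    diagonal.\<close>
  define v where "v i = (if i = 1 then u else 1)" for i :: nat
  have v: "cmod (v i) = 1" for i by (simp add: v_def cu)
  define V where "V = mat_diag n v"
  have V: "V \<in> unitary_matrices n" unfolding V_def by (rule mat_diag_unitary(1)) (rule v)
  have VM: "unitary_conj V M = mat n n (\<lambda>(i, j). cnj (v i) * M $$ (i, j) * v j)" if "M \<in> carrier_mat n n" for M
    unfolding V_def using v that by (rule mat_diag_unitary(2))
  have uu: "cnj u * u = 1" using cu by (metis complex_norm_square mult.commute of_real_1 power_one)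
  have r0: "unitary_conj (P * V) A0 = complex_of_real e0 \<cdot>\<^sub>m pauli_z n c"
    unfolding unitary_conj_compose[OF P V A(1)] diag VM[OF mat_diag_dim] pauli_z_eq[OF n] smult_mat_square
  proof (rule mat_square_cong, unfold prod.case)
    fix i j assume ij: "i < n" "j < n"
    consider "i \<noteq> j" | "i = 0" "j = 0" | "i = 1" "j = 1" | "i = j" "i \<ge> 2" by linarith
    then show "cnj (v i) * mat_diag n (\<lambda>i. complex_of_real (l i)) $$ (i, j) * v j = complex_of_real e0 *
        (if i = 0 \<and> j = 0 then of_real c else if i = 1 \<and> j = 1 then - of_real c else 0)"
      using ij l e0(2) uu by cases (auto simp: mat_diag_def v_def)
  qed
  have r1: "unitary_conj (P * V) A1 = pauli_x n c"
    unfolding unitary_conj_compose[OF P V A(3)] B1_def[symmetric] VM[OF B1] pauli_x_eq[OF n]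
  proof (rule mat_square_cong, unfold prod.case)
    fix i j assume ij: "i < n" "j < n"
    have "cnj z * cnj u = of_real c" using arg_cong[OF zu, of cnj] by simp
    then show "cnj (v i) * B1 $$ (i, j) * v j = (if i = 0 \<and> j = 1 \<or> i = 1 \<and> j = 0 then of_real c else 0)"
      using ij zu z1(1)[OF ij] herm by (auto simp: v_def z_def mult.commute)
  qed
  have r2: "unitary_conj (P * V) A2 = complex_of_real e2 \<cdot>\<^sub>m pauli_y n c"
    unfolding unitary_conj_compose[OF P V A(5)] B2_def[symmetric] VM[OF B2] pauli_y_eq[OF n] smult_mat_square
  proof (rule mat_square_cong, unfold prod.case)
    fix i j assume ij: "i < n" "j < n"
    have "cnj w * cnj u = of_real e2 * of_real c * \<i>" using arg_cong[OF wu, of cnj] by simp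
    then show "cnj (v i) * B2 $$ (i, j) * v j = complex_of_real e2 *
        (if i = 0 \<and> j = 1 then - of_real c * \<i> else if i = 1 \<and> j = 0 then of_real c * \<i> else 0)"
      using ij wu z1(2)[OF ij] herm by (auto simp: v_def w_def mult.commute mult.left_commute)
  qed
  show ?thesis
    using unitary_mult[OF P V] e0(1) e2(1) less_imp_le[OF c(1)] r0 r1 r2 by blast
qed

section \<open>Two matrices\<close>

lemma sum_block_2:
  fixes f :: "nat \<Rightarrow> nat \<Rightarrow> 'a::comm_monoid_add"
  assumes "n \<ge> 2" "\<And>i j. i < n \<Longrightarrow> j < n \<Longrightarrow> \<not> (i < 2 \<and> j < 2) \<Longrightarrow> f i j = 0"
  shows "(\<Sum>i<n. \<Sum>j<n. f i j) = (\<Sum>i<2. \<Sum>j<2. f i j)"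
proof -
  have "(\<Sum>i<n. \<Sum>j<n. f i j) = (\<Sum>i<2. \<Sum>j<n. f i j)"
    using assms by (intro sum.mono_neutral_right) (auto intro!: sum.neutral)
  also have "\<dots> = (\<Sum>i<2. \<Sum>j<2. f i j)"
    using assms by (intro sum.cong refl sum.mono_neutral_right) auto
  finally show ?thesis .
qed

context
  fixes n :: nat
  assumes n: "n \<ge> 2"
begin

lemma diag_zero_carrier: "C \<in> carrier_mat 2 2 \<Longrightarrow> diag_zero n C \<in> carrier_mat n n"
  using n by (simp add: diag_zero_eq)

lemma frob_norm_diag_zero:
  assumes C: "C \<in> carrier_mat 2 2"
  shows "frob_norm (diag_zero n C) = frob_norm C"
proof -
  have "norm_sq (diag_zero n C) = (\<Sum>i<2. \<Sum>j<2. (cmod (diag_zero n C $$ (i, j)))\<^sup>2)"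
    unfolding frob_norm_sum[OF diag_zero_carrier[OF C]] using n
    by (intro sum_block_2) (auto simp: diag_zero_eq[OF C n])
  also have "\<dots> = norm_sq C"
    unfolding frob_norm_sum[OF C] using n by (intro sum.cong refl) (simp add: diag_zero_eq[OF C n])
  finally show ?thesis by simp
qed

lemma frob_inner_diag_zero:
  assumes C: "C \<in> carrier_mat 2 2" and D: "D \<in> carrier_mat 2 2"
  shows "frob_inner (diag_zero n C) (diag_zero n D) = frob_inner C D"
proof -
  have "frob_inner (diag_zero n C) (diag_zero n D) = (\<Sum>i<2. \<Sum>j<2. diag_zero n C $$ (i, j) * cnj (diag_zero n D $$ (i, j)))"
    unfolding frob_inner_sum[OF diag_zero_carrier[OF C] diag_zero_carrier[OF D]] using n
    by (intro sum_block_2) (auto simp: diag_zero_eq[OF C n])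
  also have "\<dots> = frob_inner C D"
    unfolding frob_inner_sum[OF C D] using n by (intro sum.cong refl) (simp add: diag_zero_eq[OF C n] diag_zero_eq[OF D n])
  finally show ?thesis .
qed

lemma mat_trace_diag_zero:
  assumes C: "C \<in> carrier_mat 2 2"
  shows "mat_trace (diag_zero n C) = mat_trace C"
proof -
  have "mat_trace (diag_zero n C) = (\<Sum>i<n. if i < 2 then C $$ (i, i) else 0)"
    unfolding mat_trace_def using n by (simp add: diag_zero_eq[OF C n])
  also have "\<dots> = (\<Sum>i<2. C $$ (i, i))"
    using n by (intro sum.mono_neutral_cong_right) auto
  finally show ?thesis using C by (simp add: mat_trace_def)
qed

lemma diag_zero_mult:
  assumes C: "C \<in> carrier_mat 2 2" and D: "D \<in> carrier_mat 2 2"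
  shows "diag_zero n C * diag_zero n D = diag_zero n (C * D)"
proof (rule eq_matI)
  have CD: "C * D \<in> carrier_mat 2 2" using C D by auto
  fix i j assume "i < dim_row (diag_zero n (C * D))" "j < dim_col (diag_zero n (C * D))"
  then have ij: "i < n" "j < n" using diag_zero_carrier[OF CD] by auto
  have "(diag_zero n C * diag_zero n D) $$ (i, j) = (\<Sum>k<n. diag_zero n C $$ (i, k) * diag_zero n D $$ (k, j))"
    using ij diag_zero_carrier[OF C] diag_zero_carrier[OF D] by (simp add: scalar_prod_def atLeast0LessThan)
  also have "\<dots> = (\<Sum>k<2. if i < 2 \<and> j < 2 then C $$ (i, k) * D $$ (k, j) else 0)"
    using n ij by (intro sum.mono_neutral_cong_right) (auto simp: diag_zero_eq[OF C n] diag_zero_eq[OF D n])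
  also have "\<dots> = diag_zero n (C * D) $$ (i, j)"
    using ij C D by (cases "i < 2 \<and> j < 2") (auto simp: diag_zero_eq[OF CD n] scalar_prod_def atLeast0LessThan)
  finally show "(diag_zero n C * diag_zero n D) $$ (i, j) = diag_zero n (C * D) $$ (i, j)" .
qed (use C D n in \<open>auto simp: diag_zero_eq diag_zero_eq[OF mult_carrier_mat[OF C D]]\<close>)

lemma diag_zero_commutator:
  assumes C: "C \<in> carrier_mat 2 2" and D: "D \<in> carrier_mat 2 2"
  shows "mat_commutator (diag_zero n C) (diag_zero n D) = diag_zero n (mat_commutator C D)"
proof -
  have CD: "C * D \<in> carrier_mat 2 2" "D * C \<in> carrier_mat 2 2" using C D by auto
  then show ?thesis
    unfolding mat_commutator_def diag_zero_mult[OF C D] diag_zero_mult[OF D C]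
    unfolding diag_zero_eq[OF CD(1) n] diag_zero_eq[OF CD(2) n] diag_zero_eq[OF minus_carrier_mat[OF CD(2)] n]
    by (intro eq_matI) (use C D n in auto)
qed

end

text \<open>Lagrange's identity for the coordinates \<open>(sqrt 2 a, b, c)\<close> of a traceless matrix with rows
  \<open>(a, b)\<close> and \<open>(c, -a)\<close>.\<close>

lemma lagrange_traceless:
  fixes a b c d e f :: complex
  shows "2 * (cmod (b * f - c * e))\<^sup>2 + 4 * (cmod (a * e - b * d))\<^sup>2 + 4 * (cmod (c * d - a * f))\<^sup>2 =
    2 * ((2 * (cmod a)\<^sup>2 + (cmod b)\<^sup>2 + (cmod c)\<^sup>2) * (2 * (cmod d)\<^sup>2 + (cmod e)\<^sup>2 + (cmod f)\<^sup>2)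
      - (cmod (2 * a * cnj d + b * cnj e + c * cnj f))\<^sup>2)"
proof -
  \<comment> \<open>Over the complex numbers each squared modulus is \<open>z * cnj z\<close>, so
    the claim becomes a polynomial identity.\<close>
  have "complex_of_real (2 * (cmod (b * f - c * e))\<^sup>2 + 4 * (cmod (a * e - b * d))\<^sup>2 + 4 * (cmod (c * d - a * f))\<^sup>2) =
    of_real (2 * ((2 * (cmod a)\<^sup>2 + (cmod b)\<^sup>2 + (cmod c)\<^sup>2) * (2 * (cmod d)\<^sup>2 + (cmod e)\<^sup>2 + (cmod f)\<^sup>2)
      - (cmod (2 * a * cnj d + b * cnj e + c * cnj f))\<^sup>2))"
    by (simp only: of_real_add of_real_diff of_real_mult of_real_numeral complex_norm_square)
      (simp add: algebra_simps)
  then show ?thesis using of_real_eq_iff by blast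
qed

text \<open>For traceless matrices of size two the entries of the commutator are the components of a
  cross product of the coordinates, up to factors. Lagrange's identity then shows that orthogonal
  pairs attain the Boettcher-Wenzel bound.\<close>

lemma traceless_commutator_norm:
  assumes C: "C \<in> carrier_mat 2 2" "mat_trace C = 0" and D: "D \<in> carrier_mat 2 2" "mat_trace D = 0"
  shows "comm_sq C D = 2 * (norm_sq C * norm_sq D - (cmod (frob_inner C D))\<^sup>2)"
proof -
  define a b c where "a = C $$ (0, 0)" and "b = C $$ (0, 1)" and "c = C $$ (1, 0)"
  define d e f where "d = D $$ (0, 0)" and "e = D $$ (0, 1)" and "f = D $$ (1, 0)"
  have C11: "C $$ (Suc 0, Suc 0) = - a" and D11: "D $$ (Suc 0, Suc 0) = - d"
    using C D by (auto simp: mat_trace_def a_def d_def numeral_2_eq_2 add_eq_0_iff)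
  note abs = a_def[symmetric] b_def[unfolded One_nat_def, symmetric] c_def[unfolded One_nat_def, symmetric]
    d_def[symmetric] e_def[unfolded One_nat_def, symmetric] f_def[unfolded One_nat_def, symmetric] C11 D11
  have CD: "C * D \<in> carrier_mat 2 2" "D * C \<in> carrier_mat 2 2" using C D by auto
  have nC: "norm_sq C = 2 * (cmod a)\<^sup>2 + (cmod b)\<^sup>2 + (cmod c)\<^sup>2"
    unfolding frob_norm_sum[OF C(1)] by (simp add: numeral_2_eq_2 abs)
  have nD: "norm_sq D = 2 * (cmod d)\<^sup>2 + (cmod e)\<^sup>2 + (cmod f)\<^sup>2"
    unfolding frob_norm_sum[OF D(1)] by (simp add: numeral_2_eq_2 abs)
  have i: "frob_inner C D = 2 * a * cnj d + b * cnj e + c * cnj f"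
    unfolding frob_inner_sum[OF C(1) D(1)] by (simp add: numeral_2_eq_2 abs)
  have entry: "mat_commutator C D $$ (i, j) =
      C $$ (i, 0) * D $$ (0, j) + C $$ (i, Suc 0) * D $$ (Suc 0, j)
      - (D $$ (i, 0) * C $$ (0, j) + D $$ (i, Suc 0) * C $$ (Suc 0, j))" if "i < 2" "j < 2" for i j
    unfolding mat_commutator_def using that C D CD by (simp add: scalar_prod_def numeral_2_eq_2)
  have "comm_sq C D =
      (cmod (b * f - c * e))\<^sup>2 + (cmod (2 * (a * e - b * d)))\<^sup>2 + (cmod (2 * (c * d - a * f)))\<^sup>2 + (cmod (c * e - b * f))\<^sup>2"
    unfolding frob_norm_sum[OF mat_commutator_carrier[OF C(1) D(1)]]
    by (simp add: numeral_2_eq_2 entry abs) (simp add: algebra_simps)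
  also have "\<dots> = 2 * (cmod (b * f - c * e))\<^sup>2 + 4 * (cmod (a * e - b * d))\<^sup>2 + 4 * (cmod (c * d - a * f))\<^sup>2"
    by (simp only: norm_mult norm_numeral power_mult_distrib norm_minus_commute[of "c * e"]) simp
  finally show ?thesis unfolding nC nD i lagrange_traceless .
qed

lemma traceless_diag_zero_commutator_norm:
  assumes n: "n \<ge> 2" and C: "C \<in> carrier_mat 2 2" "mat_trace C = 0" and D: "D \<in> carrier_mat 2 2" "mat_trace D = 0"
    and orth: "frob_inner C D = 0"
  shows "comm_sq (diag_zero n C) (diag_zero n D) = 2 * norm_sq C * norm_sq D"
  unfolding diag_zero_commutator[OF n C(1) D(1)] frob_norm_diag_zero[OF n mat_commutator_carrier[OF C(1) D(1)]]
    traceless_commutator_norm[OF C D] orth by simp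

lemma two_matrix_sum:
  assumes "X \<in> carrier_mat n n" "Y \<in> carrier_mat n n"
  shows "comm_sq X X + comm_sq X Y
    + (comm_sq Y X + comm_sq Y Y) = 2 * comm_sq X Y"
  using assms frob_norm_commutator_commute[OF assms] by simp

lemma two_matrix_inequality:
  assumes "X \<in> carrier_mat n n" "Y \<in> carrier_mat n n"
  shows "2 * comm_sq X Y \<le> (norm_sq X + norm_sq Y)\<^sup>2"
proof -
  have "2 * (2 * x * y) \<le> (x + y)\<^sup>2" for x y :: real
    using zero_le_power2[of "x - y"] by (simp add: power2_sum power2_diff)
  then show ?thesis using boettcher_wenzel[OF assms] by (meson mult_left_mono order_trans zero_le_numeral)
qed

text \<open>Equality must hold both in Boettcher-Wenzel and in \<open>4 x y \<le> (x + y)^2\<close>: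
  the first gives the common block, the traces and orthogonality, the second the equal
  norms.\<close>

lemma two_matrix_equality:
  assumes n: "n \<ge> 2" and X: "X \<in> carrier_mat n n" and Y: "Y \<in> carrier_mat n n"
  shows "2 * comm_sq X Y = (norm_sq X + norm_sq Y)\<^sup>2 \<longleftrightarrow>
    (\<exists>U C1 C2. U \<in> unitary_matrices n \<and> C1 \<in> carrier_mat 2 2 \<and> C2 \<in> carrier_mat 2 2 \<and>
      X = mat_adjoint U * diag_zero n C1 * U \<and> Y = mat_adjoint U * diag_zero n C2 * U \<and>
      frob_norm C1 = frob_norm C2 \<and> frob_inner C1 C2 = 0 \<and> mat_trace C1 = 0 \<and> mat_trace C2 = 0)"
    (is "?L \<longleftrightarrow> ?R")
proof
  assume ?R
  then obtain U C1 C2 where U: "U \<in> unitary_matrices n" and C: "C1 \<in> carrier_mat 2 2" "C2 \<in> carrier_mat 2 2"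
    and XY: "X = unitary_conj U (diag_zero n C1)" "Y = unitary_conj U (diag_zero n C2)"
    and eqs: "frob_norm C1 = frob_norm C2" "frob_inner C1 C2 = 0" "mat_trace C1 = 0" "mat_trace C2 = 0"
    unfolding unitary_conj_def by (elim exE conjE)
  note c = diag_zero_carrier[OF n C(1)] diag_zero_carrier[OF n C(2)]
  show ?L
    unfolding XY unitary_conj_commutator_norm[OF U c] unitary_conj_norm[OF U c(1)] unitary_conj_norm[OF U c(2)]
      frob_norm_diag_zero[OF n C(1)] frob_norm_diag_zero[OF n C(2)]
      traceless_diag_zero_commutator_norm[OF n C(1) eqs(3) C(2) eqs(4) eqs(2)] eqs(1)
    by (simp add: power2_eq_square algebra_simps)
next
  assume eq: ?L
  define x y where "x = norm_sq X" and "y = norm_sq Y"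
  have bw: "comm_sq X Y \<le> 2 * x * y" using boettcher_wenzel[OF X Y] by (simp add: x_def y_def)
  have "(x - y)\<^sup>2 = (x + y)\<^sup>2 - 4 * x * y" by (simp add: power2_sum power2_diff)
  also have "\<dots> \<le> 0" using bw eq by (simp add: x_def y_def)
  finally have xy: "x = y" by simp
  then have ext: "comm_sq X Y = 2 * x * y"
  proof -
    have "2 * comm_sq X Y = (y + y)\<^sup>2" using eq xy by (simp only: x_def y_def)
    also have "(y + y)\<^sup>2 = 2 * (2 * y * y)" by (simp add: power2_eq_square)
    finally show ?thesis using xy by simp
  qed
  show ?R
  \<comment> \<open>The equality case of Boettcher-Wenzel concerns nonzero matrices; two zero
    matrices are covered by zero blocks.\<close>
  proof (cases "frob_norm X = 0")
    case True
    then have "frob_norm Y = 0" using xy by (simp add: x_def y_def)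
    then have XY: "X = 0\<^sub>m n n" "Y = 0\<^sub>m n n" using True frob_norm_eq_0 X Y by blast+
    have "1\<^sub>m n \<in> unitary_matrices n" by (simp add: unitary_matrices_def)
    moreover have "diag_zero n (0\<^sub>m 2 2) = 0\<^sub>m n n"
      unfolding diag_zero_eq[OF zero_carrier_mat n] by (intro eq_matI) auto
    ultimately show ?thesis unfolding XY
      by (intro exI[of _ "1\<^sub>m n"] exI[of _ "0\<^sub>m 2 2"]) (simp add: frob_inner_sum[of _ 2 2] mat_trace_def)
  next
    case False
    then have nz: "frob_norm X \<noteq> 0" "frob_norm Y \<noteq> 0" using xy by (auto simp: x_def y_def)
    obtain P where P: "P \<in> unitary_matrices n"
      and supp: "\<forall>i<n. \<forall>j<n. \<not> (i < 2 \<and> j < 2) \<longrightarrow> unitary_conj P X $$ (i, j) = 0 \<and> unitary_conj P Y $$ (i, j) = 0"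
      and trX: "mat_trace X = 0" and orth: "frob_inner X Y = 0"
      by (rule boettcher_wenzel_equality[OF n X Y nz ext[unfolded x_def y_def]])
    have "comm_sq Y X = 2 * norm_sq Y * norm_sq X"
      using ext by (simp add: frob_norm_commutator_commute[OF X Y] x_def y_def)
    then have trY: "mat_trace Y = 0"
      by (rule boettcher_wenzel_equality[OF n Y X nz(2,1)])
    define C where "C M = mat 2 2 (\<lambda>ij. unitary_conj P M $$ ij)" for M
    have C: "C M \<in> carrier_mat 2 2" for M by (simp add: C_def)
    note XYc = unitary_conj_carrier[OF P X] unitary_conj_carrier[OF P Y]
    have dX: "diag_zero n (C X) = unitary_conj P X"
      unfolding diag_zero_eq[OF C n] using XYc supp by (intro eq_matI) (auto simp: C_def)
    have dY: "diag_zero n (C Y) = unitary_conj P Y"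
      unfolding diag_zero_eq[OF C n] using XYc supp by (intro eq_matI) (auto simp: C_def)
    have "X = mat_adjoint (mat_adjoint P) * diag_zero n (C X) * mat_adjoint P"
      unfolding dX by (rule unitary_conj_inverse[OF P X, symmetric])
    moreover have "Y = mat_adjoint (mat_adjoint P) * diag_zero n (C Y) * mat_adjoint P"
      unfolding dY by (rule unitary_conj_inverse[OF P Y, symmetric])
    moreover have "frob_norm X = frob_norm Y" using xy by (simp add: x_def y_def)
    then have "frob_norm (C X) = frob_norm (C Y)"
      unfolding frob_norm_diag_zero[OF n C, symmetric] dX dY unitary_conj_norm[OF P X] unitary_conj_norm[OF P Y] .
    moreover have "frob_inner (C X) (C Y) = 0"
      unfolding frob_inner_diag_zero[OF n C C, symmetric] dX dY unitary_conj_inner[OF P X Y] by (rule orth)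
    moreover have "mat_trace (C X) = 0"
      unfolding mat_trace_diag_zero[OF n C, symmetric] dX unitary_conj_trace[OF P X] by (rule trX)
    moreover have "mat_trace (C Y) = 0"
      unfolding mat_trace_diag_zero[OF n C, symmetric] dY unitary_conj_trace[OF P Y] by (rule trY)
    ultimately show ?thesis using unitary_adjoint[OF P] C by blast
  qed
qed

section \<open>Orthogonal mixing\<close>

text \<open>The orthogonal half of \<open>K_action\<close>, on functions of the index instead of
  lists.\<close>

definition rotate_family :: "nat \<Rightarrow> nat \<Rightarrow> real mat \<Rightarrow> (nat \<Rightarrow> complex mat) \<Rightarrow> nat \<Rightarrow> complex mat" where
  "rotate_family n k R A l = mat n n (\<lambda>ij. \<Sum>j<k. of_real (R $$ (j, l)) * A j $$ ij)"

lemma rotate_family_carrier [simp]: "rotate_family n k R A l \<in> carrier_mat n n"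
  by (simp add: rotate_family_def)

lemma rotate_family_index:
  "i < n \<Longrightarrow> j < n \<Longrightarrow> rotate_family n k R A l $$ (i, j) = (\<Sum>u<k. of_real (R $$ (u, l)) * A u $$ (i, j))"
  by (simp add: rotate_family_def)

lemma frob_norm_sum_pairs:
  "A \<in> carrier_mat n k \<Longrightarrow> norm_sq A = (\<Sum>ij\<in>{..<n} \<times> {..<k}. (cmod (A $$ ij))\<^sup>2)"
  by (simp add: frob_norm_sum sum.cartesian_product split_def)

lemma orthogonal_rows:
  assumes R: "R \<in> orthogonal_matrices k" and "i < k" "j < k"
  shows "(\<Sum>l<k. R $$ (i, l) * R $$ (j, l)) = (if i = j then 1 else 0)"
proof -
  have "R * transpose_mat R = 1\<^sub>m k" "R \<in> carrier_mat k k" using R by (auto simp: orthogonal_matrices_def)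
  then have "(R * transpose_mat R) $$ (i, j) = (if i = j then 1 else 0)" using assms by simp
  then show ?thesis using \<open>R \<in> carrier_mat k k\<close> assms by (simp add: scalar_prod_def atLeast0LessThan)
qed

lemma Re_mult_cnj: "Re (z * cnj z) = (cmod z)\<^sup>2"
  unfolding cmod_power2 by (simp add: power2_eq_square)

text \<open>Applied to the family of values at a fixed matrix entry, this gives the invariance of
  the norms and of the commutators.\<close>

lemma orthogonal_isometry:
  fixes f :: "nat \<Rightarrow> complex"
  assumes R: "R \<in> orthogonal_matrices k"
  shows "(\<Sum>l<k. (cmod (\<Sum>j<k. of_real (R $$ (j, l)) * f j))\<^sup>2) = (\<Sum>j<k. (cmod (f j))\<^sup>2)"
proof -
  have "(\<Sum>l<k. (cmod (\<Sum>j<k. of_real (R $$ (j, l)) * f j))\<^sup>2) =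
      (\<Sum>l<k. \<Sum>i<k. \<Sum>j<k. R $$ (i, l) * R $$ (j, l) * Re (f i * cnj (f j)))"
    unfolding cmod_sum_sq by (intro sum.cong refl) (simp add: algebra_simps)
  also have "\<dots> = (\<Sum>i<k. \<Sum>l<k. \<Sum>j<k. R $$ (i, l) * R $$ (j, l) * Re (f i * cnj (f j)))"
    by (rule sum.swap)
  also have "\<dots> = (\<Sum>i<k. \<Sum>j<k. \<Sum>l<k. R $$ (i, l) * R $$ (j, l) * Re (f i * cnj (f j)))"
    by (rule sum.cong[OF refl], rule sum.swap)
  also have "\<dots> = (\<Sum>i<k. \<Sum>j<k. (if i = j then 1 else 0) * Re (f i * cnj (f j)))"
    by (intro sum.cong refl) (simp add: orthogonal_rows[OF R, symmetric] sum_distrib_right)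
  also have "\<dots> = (\<Sum>i<k. \<Sum>j<k. if j = i then (cmod (f i))\<^sup>2 else 0)"
    by (intro sum.cong refl) (auto simp only: Re_mult_cnj mult_1 mult_zero_left if_True if_False split: if_split)
  also have "\<dots> = (\<Sum>i<k. (cmod (f i))\<^sup>2)" by simp
  finally show ?thesis .
qed

lemma rotate_family_norm_sum:
  assumes R: "R \<in> orthogonal_matrices k" and A: "\<And>j. j < k \<Longrightarrow> A j \<in> carrier_mat n n"
  shows "(\<Sum>l<k. norm_sq (rotate_family n k R A l)) = (\<Sum>j<k. norm_sq (A j))"
proof -
  have "(\<Sum>l<k. norm_sq (rotate_family n k R A l)) =
      (\<Sum>l<k. \<Sum>ij\<in>{..<n} \<times> {..<n}. (cmod (\<Sum>j<k. of_real (R $$ (j, l)) * A j $$ ij))\<^sup>2)"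
    unfolding frob_norm_sum_pairs[OF rotate_family_carrier]
    by (intro sum.cong refl) (auto simp: rotate_family_index)
  also have "\<dots> = (\<Sum>ij\<in>{..<n} \<times> {..<n}. \<Sum>l<k. (cmod (\<Sum>j<k. of_real (R $$ (j, l)) * A j $$ ij))\<^sup>2)"
    by (rule sum.swap)
  also have "\<dots> = (\<Sum>ij\<in>{..<n} \<times> {..<n}. \<Sum>j<k. (cmod (A j $$ ij))\<^sup>2)"
    by (simp only: orthogonal_isometry[OF R])
  also have "\<dots> = (\<Sum>j<k. \<Sum>ij\<in>{..<n} \<times> {..<n}. (cmod (A j $$ ij))\<^sup>2)"
    by (rule sum.swap)
  also have "\<dots> = (\<Sum>j<k. norm_sq (A j))"
    using A by (intro sum.cong refl) (simp add: frob_norm_sum_pairs[of _ n n])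
  finally show ?thesis .
qed

lemma commutator_index:
  assumes "A \<in> carrier_mat n n" "B \<in> carrier_mat n n" "i < n" "j < n"
  shows "mat_commutator A B $$ (i, j) = (\<Sum>p<n. A $$ (i, p) * B $$ (p, j) - B $$ (i, p) * A $$ (p, j))"
  using assms by (simp add: mat_commutator_def scalar_prod_def atLeast0LessThan sum_subtractf)

lemma rotate_family_commutator:
  assumes A: "\<And>j. j < k \<Longrightarrow> A j \<in> carrier_mat n n" and ij: "i < n" "j < n"
  shows "mat_commutator (rotate_family n k R A l) (rotate_family n k R A m) $$ (i, j) =
    (\<Sum>u<k. of_real (R $$ (u, l)) * (\<Sum>v<k. of_real (R $$ (v, m)) * mat_commutator (A u) (A v) $$ (i, j)))"
proof -
  let ?r = "\<lambda>u l. complex_of_real (R $$ (u, l))"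
  have "mat_commutator (rotate_family n k R A l) (rotate_family n k R A m) $$ (i, j) =
      (\<Sum>p<n. (\<Sum>u<k. ?r u l * A u $$ (i, p)) * (\<Sum>v<k. ?r v m * A v $$ (p, j))
        - (\<Sum>v<k. ?r v m * A v $$ (i, p)) * (\<Sum>u<k. ?r u l * A u $$ (p, j)))"
    unfolding commutator_index[OF rotate_family_carrier rotate_family_carrier ij]
    using ij by (intro sum.cong refl) (simp add: rotate_family_def)
  also have "\<dots> = (\<Sum>p<n. \<Sum>u<k. \<Sum>v<k. ?r u l * (?r v m * (A u $$ (i, p) * A v $$ (p, j) - A v $$ (i, p) * A u $$ (p, j))))"
  proof (intro sum.cong refl)
    fix p
    have "(\<Sum>v<k. ?r v m * A v $$ (i, p)) * (\<Sum>u<k. ?r u l * A u $$ (p, j)) =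
        (\<Sum>u<k. \<Sum>v<k. (?r v m * A v $$ (i, p)) * (?r u l * A u $$ (p, j)))"
      unfolding sum_product by (rule sum.swap)
    then show "(\<Sum>u<k. ?r u l * A u $$ (i, p)) * (\<Sum>v<k. ?r v m * A v $$ (p, j))
        - (\<Sum>v<k. ?r v m * A v $$ (i, p)) * (\<Sum>u<k. ?r u l * A u $$ (p, j)) =
        (\<Sum>u<k. \<Sum>v<k. ?r u l * (?r v m * (A u $$ (i, p) * A v $$ (p, j) - A v $$ (i, p) * A u $$ (p, j))))"
      unfolding sum_product by (simp only: sum_subtractf[symmetric]) (simp add: algebra_simps)
  qed
  also have "\<dots> = (\<Sum>u<k. \<Sum>p<n. \<Sum>v<k. ?r u l * (?r v m * (A u $$ (i, p) * A v $$ (p, j) - A v $$ (i, p) * A u $$ (p, j))))"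
    by (rule sum.swap)
  also have "\<dots> = (\<Sum>u<k. \<Sum>v<k. \<Sum>p<n. ?r u l * (?r v m * (A u $$ (i, p) * A v $$ (p, j) - A v $$ (i, p) * A u $$ (p, j))))"
    by (rule sum.cong[OF refl], rule sum.swap)
  also have "\<dots> = (\<Sum>u<k. ?r u l * (\<Sum>v<k. ?r v m * mat_commutator (A u) (A v) $$ (i, j)))"
    using A ij by (intro sum.cong refl) (simp add: commutator_index[of _ n] sum_distrib_left)
  finally show ?thesis .
qed

text \<open>The commutator is bilinear, so the doubly indexed family of commutators is mixed by
  \<open>R\<close> in each index; the isometry is applied once per index.\<close>

lemma rotate_family_commutator_sum:
  assumes R: "R \<in> orthogonal_matrices k" and A: "\<And>j. j < k \<Longrightarrow> A j \<in> carrier_mat n n"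
  shows "(\<Sum>l<k. \<Sum>m<k. comm_sq (rotate_family n k R A l) (rotate_family n k R A m)) =
    (\<Sum>u<k. \<Sum>v<k. comm_sq (A u) (A v))"
proof -
  let ?I = "{..<n} \<times> {..<n}"
  let ?F = "\<lambda>u v ij. mat_commutator (A u) (A v) $$ ij"
  let ?r = "\<lambda>u l. complex_of_real (R $$ (u, l))"
  have norm: "comm_sq X Y = (\<Sum>ij\<in>?I. (cmod (mat_commutator X Y $$ ij))\<^sup>2)"
    if "X \<in> carrier_mat n n" "Y \<in> carrier_mat n n" for X Y
    using frob_norm_sum[OF mat_commutator_carrier[OF that]] by (simp add: sum.cartesian_product split_def)
  have iso: "(\<Sum>l<k. \<Sum>m<k. (cmod (\<Sum>u<k. ?r u l * (\<Sum>v<k. ?r v m * f u v)))\<^sup>2) = (\<Sum>u<k. \<Sum>v<k. (cmod (f u v))\<^sup>2)"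
    for f :: "nat \<Rightarrow> nat \<Rightarrow> complex"
  proof -
    have "(\<Sum>l<k. \<Sum>m<k. (cmod (\<Sum>u<k. ?r u l * (\<Sum>v<k. ?r v m * f u v)))\<^sup>2) =
        (\<Sum>m<k. \<Sum>l<k. (cmod (\<Sum>u<k. ?r u l * (\<Sum>v<k. ?r v m * f u v)))\<^sup>2)"
      by (rule sum.swap)
    also have "\<dots> = (\<Sum>m<k. \<Sum>u<k. (cmod (\<Sum>v<k. ?r v m * f u v))\<^sup>2)"
      by (simp only: orthogonal_isometry[OF R])
    also have "\<dots> = (\<Sum>u<k. \<Sum>m<k. (cmod (\<Sum>v<k. ?r v m * f u v))\<^sup>2)"
      by (rule sum.swap)
    also have "\<dots> = (\<Sum>u<k. \<Sum>v<k. (cmod (f u v))\<^sup>2)"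
      by (simp only: orthogonal_isometry[OF R])
    finally show ?thesis .
  qed
  have "(\<Sum>l<k. \<Sum>m<k. comm_sq (rotate_family n k R A l) (rotate_family n k R A m)) =
      (\<Sum>l<k. \<Sum>m<k. \<Sum>ij\<in>?I. (cmod (\<Sum>u<k. ?r u l * (\<Sum>v<k. ?r v m * ?F u v ij)))\<^sup>2)"
    unfolding norm[OF rotate_family_carrier rotate_family_carrier]
    by (intro sum.cong refl) (auto simp: rotate_family_commutator[OF A])
  also have "\<dots> = (\<Sum>l<k. \<Sum>ij\<in>?I. \<Sum>m<k. (cmod (\<Sum>u<k. ?r u l * (\<Sum>v<k. ?r v m * ?F u v ij)))\<^sup>2)"
    by (rule sum.cong[OF refl], rule sum.swap)
  also have "\<dots> = (\<Sum>ij\<in>?I. \<Sum>l<k. \<Sum>m<k. (cmod (\<Sum>u<k. ?r u l * (\<Sum>v<k. ?r v m * ?F u v ij)))\<^sup>2)"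
    by (rule sum.swap)
  also have "\<dots> = (\<Sum>ij\<in>?I. \<Sum>u<k. \<Sum>v<k. (cmod (?F u v ij))\<^sup>2)"
    by (simp only: iso)
  also have "\<dots> = (\<Sum>u<k. \<Sum>ij\<in>?I. \<Sum>v<k. (cmod (?F u v ij))\<^sup>2)"
    by (rule sum.swap)
  also have "\<dots> = (\<Sum>u<k. \<Sum>v<k. \<Sum>ij\<in>?I. (cmod (?F u v ij))\<^sup>2)"
    by (rule sum.cong[OF refl], rule sum.swap)
  also have "\<dots> = (\<Sum>u<k. \<Sum>v<k. comm_sq (A u) (A v))"
    using A by (intro sum.cong refl) (simp add: norm)
  finally show ?thesis .
qed

lemma rotate_family_hermitian:
  assumes A: "\<And>j. j < k \<Longrightarrow> A j \<in> carrier_mat n n" "\<And>j. j < k \<Longrightarrow> mat_adjoint (A j) = A j"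
  shows "mat_adjoint (rotate_family n k R A l) = rotate_family n k R A l"
proof (rule eq_matI)
  fix i j assume "i < dim_row (rotate_family n k R A l)" "j < dim_col (rotate_family n k R A l)"
  then have ij: "i < n" "j < n" by (auto simp: rotate_family_def)
  have "cnj (A u $$ (j, i)) = A u $$ (i, j)" if "u < k" for u
    using arg_cong[OF A(2)[OF that], of "\<lambda>M. M $$ (i, j)"] A(1)[OF that] ij by simp
  then show "mat_adjoint (rotate_family n k R A l) $$ (i, j) = rotate_family n k R A l $$ (i, j)"
    using ij by (simp add: rotate_family_def)
qed (auto simp: rotate_family_def)

lemma rotate_family_inner:
  assumes A: "\<And>j. j < k \<Longrightarrow> A j \<in> carrier_mat n n"
  shows "frob_inner (rotate_family n k R A l) (rotate_family n k R A m) =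
    (\<Sum>u<k. \<Sum>v<k. of_real (R $$ (u, l) * R $$ (v, m)) * frob_inner (A u) (A v))"
proof -
  let ?I = "{..<n} \<times> {..<n}"
  let ?r = "\<lambda>u l. complex_of_real (R $$ (u, l))"
  have inner: "frob_inner X Y = (\<Sum>ij\<in>?I. X $$ ij * cnj (Y $$ ij))"
    if "X \<in> carrier_mat n n" "Y \<in> carrier_mat n n" for X Y
    using frob_inner_sum[OF that] by (simp add: sum.cartesian_product split_def)
  have "frob_inner (rotate_family n k R A l) (rotate_family n k R A m) =
      (\<Sum>ij\<in>?I. (\<Sum>u<k. ?r u l * A u $$ ij) * cnj (\<Sum>v<k. ?r v m * A v $$ ij))"
    unfolding inner[OF rotate_family_carrier rotate_family_carrier]
    by (intro sum.cong refl) (auto simp: rotate_family_def)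
  also have "\<dots> = (\<Sum>ij\<in>?I. \<Sum>u<k. \<Sum>v<k. ?r u l * ?r v m * (A u $$ ij * cnj (A v $$ ij)))"
    unfolding cnj_sum sum_product by (intro sum.cong refl) (simp add: mult_ac)
  also have "\<dots> = (\<Sum>u<k. \<Sum>ij\<in>?I. \<Sum>v<k. ?r u l * ?r v m * (A u $$ ij * cnj (A v $$ ij)))"
    by (rule sum.swap)
  also have "\<dots> = (\<Sum>u<k. \<Sum>v<k. \<Sum>ij\<in>?I. ?r u l * ?r v m * (A u $$ ij * cnj (A v $$ ij)))"
    by (rule sum.cong[OF refl], rule sum.swap)
  also have "\<dots> = (\<Sum>u<k. \<Sum>v<k. of_real (R $$ (u, l) * R $$ (v, m)) * frob_inner (A u) (A v))"
    using A by (intro sum.cong refl) (simp add: inner sum_distrib_left)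
  finally show ?thesis .
qed

lemma unitary_conj_index:
  assumes "P \<in> carrier_mat n n" "M \<in> carrier_mat n n" "i < n" "j < n"
  shows "unitary_conj P M $$ (i, j) = (\<Sum>q<n. \<Sum>p<n. cnj (P $$ (p, i)) * M $$ (p, q) * P $$ (q, j))"
proof -
  have "mat_adjoint P * M \<in> carrier_mat n n" using assms by auto
  then show ?thesis
    using assms by (simp add: unitary_conj_def scalar_prod_def atLeast0LessThan sum_distrib_right)
qed

text \<open>Conjugation is linear, so mixing and conjugation commute: the orthogonal matrix found
  first and the unitary one found afterwards fit a single \<open>K_action\<close>.\<close>

lemma unitary_conj_rotate_family:
  assumes P: "P \<in> carrier_mat n n" and A: "\<And>j. j < k \<Longrightarrow> A j \<in> carrier_mat n n"
  shows "unitary_conj P (rotate_family n k R A l) = rotate_family n k R (\<lambda>j. unitary_conj P (A j)) l"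
proof (rule eq_matI)
  fix i j assume "i < dim_row (rotate_family n k R (\<lambda>j. unitary_conj P (A j)) l)"
    "j < dim_col (rotate_family n k R (\<lambda>j. unitary_conj P (A j)) l)"
  then have ij: "i < n" "j < n" by (auto simp: rotate_family_def)
  let ?r = "\<lambda>u. complex_of_real (R $$ (u, l))"
  have "unitary_conj P (rotate_family n k R A l) $$ (i, j) =
      (\<Sum>q<n. \<Sum>p<n. \<Sum>u<k. ?r u * (cnj (P $$ (p, i)) * A u $$ (p, q) * P $$ (q, j)))"
    unfolding unitary_conj_index[OF P rotate_family_carrier ij]
    by (intro sum.cong refl) (auto simp: rotate_family_def sum_distrib_left sum_distrib_right mult_ac intro!: sum.cong)
  also have "\<dots> = (\<Sum>q<n. \<Sum>u<k. \<Sum>p<n. ?r u * (cnj (P $$ (p, i)) * A u $$ (p, q) * P $$ (q, j)))"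
    by (rule sum.cong[OF refl], rule sum.swap)
  also have "\<dots> = (\<Sum>u<k. \<Sum>q<n. \<Sum>p<n. ?r u * (cnj (P $$ (p, i)) * A u $$ (p, q) * P $$ (q, j)))"
    by (rule sum.swap)
  also have "\<dots> = (\<Sum>u<k. ?r u * unitary_conj P (A u) $$ (i, j))"
    using A ij by (intro sum.cong refl) (simp add: unitary_conj_index[OF P] sum_distrib_left)
  also have "\<dots> = rotate_family n k R (\<lambda>j. unitary_conj P (A j)) l $$ (i, j)"
    using ij by (simp add: rotate_family_def)
  finally show "unitary_conj P (rotate_family n k R A l) $$ (i, j) =
    rotate_family n k R (\<lambda>j. unitary_conj P (A j)) l $$ (i, j)" .
qed (use P in \<open>auto simp: rotate_family_def unitary_conj_def\<close>)

lemma K_action_rotate_family: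
  assumes P: "P \<in> unitary_matrices n" and As: "set As \<subseteq> carrier_mat n n"
  shows "K_action n (P, R) As =
    map (rotate_family n (length As) R (\<lambda>j. unitary_conj P (As ! j))) [0..<length As]"
proof -
  have "unitary_conj P (As ! j) \<in> carrier_mat n n" if "j < length As" for j
    using that As by (intro unitary_conj_carrier[OF P]) (meson nth_mem subsetD)
  then have "dim_row (unitary_conj P (As ! j)) = n \<and> dim_col (unitary_conj P (As ! j)) = n"
    if "j < length As" for j using that by blast
  then show ?thesis
    unfolding K_action_def rotate_family_def mat_sum_def unitary_conj_def[symmetric] prod.case
    by (intro map_cong refl eq_matI) (auto intro!: sum.cong)
qed

section \<open>Hermitian families\<close>

lemma mat_mult_index_sum:
  "A \<in> carrier_mat r k \<Longrightarrow> B \<in> carrier_mat k c \<Longrightarrow> i < r \<Longrightarrow> j < c \<Longrightarrow>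
    (A * B) $$ (i, j) = (\<Sum>v<k. A $$ (i, v) * B $$ (v, j))"
  by (simp add: scalar_prod_def atLeast0LessThan)

lemma sum_less_2: "(\<Sum>i<2. f i) = f 0 + f (1 :: nat)"
  by (simp add: numeral_2_eq_2)

lemma frob_norm_inner: "norm_sq A = Re (frob_inner A A)"
  by (simp add: frob_norm_trace frob_inner_def)

lemma hermitian_inner_commute:
  assumes "A \<in> carrier_mat n n" "mat_adjoint A = A" "B \<in> carrier_mat n n" "mat_adjoint B = B"
  shows "frob_inner A B = frob_inner B A"
  unfolding frob_inner_def assms(2,4) by (rule mat_trace_comm[OF assms(1,3)])

lemma hermitian_inner_real:
  assumes "A \<in> carrier_mat n n" "mat_adjoint A = A" "B \<in> carrier_mat n n" "mat_adjoint B = B"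
  shows "frob_inner A B = of_real (Re (frob_inner A B))"
  using hermitian_inner_commute[OF assms] frob_inner_conj_sym[OF assms(1,3)] by (simp add: complex_eq_iff)

context
  fixes k n :: nat and A :: "nat \<Rightarrow> complex mat"
  assumes A: "\<And>r. r < k \<Longrightarrow> A r \<in> carrier_mat n n" "\<And>r. r < k \<Longrightarrow> mat_adjoint (A r) = A r"
begin

text \<open>Mixing by \<open>R\<close> changes the Gram matrix \<open>G\<close> to
  \<open>transpose_mat R * G * R\<close>. For Hermitian matrices \<open>G\<close> is real and
  symmetric; a diagonalizing \<open>R\<close> makes the family orthogonal, with the ordered
  eigenvalues as squared norms.\<close>

lemma gram_orthogonalization:
  "\<exists>R\<in>orthogonal_matrices k.
    (\<forall>l<k. \<forall>m<k. l \<noteq> m \<longrightarrow> frob_inner (rotate_family n k R A l) (rotate_family n k R A m) = 0) \<and>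
    (\<forall>l m. l \<le> m \<longrightarrow> m < k \<longrightarrow> norm_sq (rotate_family n k R A m) \<le> norm_sq (rotate_family n k R A l))"
proof -
  define G where "G = mat k k (\<lambda>(u, v). Re (frob_inner (A u) (A v)))"
  have G: "G \<in> carrier_mat k k" by (simp add: G_def)
  have "transpose_mat G = G"
    using A by (intro eq_matI) (auto simp: G_def hermitian_inner_commute[of _ n])
  then obtain R \<mu> where R: "R \<in> orthogonal_matrices k"
    and diag: "transpose_mat R * G * R = mat_diag k \<mu>"
    and sorted: "\<forall>i j. i \<le> j \<longrightarrow> j < k \<longrightarrow> \<mu> j \<le> \<mu> i"
    by (rule symmetric_spectral[OF G])
  have Rc: "R \<in> carrier_mat k k" using R by (simp add: orthogonal_matrices_def)
  have inner: "frob_inner (rotate_family n k R A l) (rotate_family n k R A m) = (if l = m then of_real (\<mu> l) else 0)"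
    if lm: "l < k" "m < k" for l m
  proof -
    have RG: "transpose_mat R * G \<in> carrier_mat k k" using Rc G by auto
    have "mat_diag k \<mu> $$ (l, m) = (\<Sum>v<k. (\<Sum>u<k. R $$ (u, l) * G $$ (u, v)) * R $$ (v, m))"
      unfolding diag[symmetric] mat_mult_index_sum[OF RG Rc lm] using Rc G lm(1)
      by (intro sum.cong refl) (simp add: scalar_prod_def atLeast0LessThan)
    also have "\<dots> = (\<Sum>v<k. \<Sum>u<k. R $$ (u, l) * R $$ (v, m) * Re (frob_inner (A u) (A v)))"
      by (intro sum.cong refl) (simp add: G_def sum_distrib_left sum_distrib_right mult_ac)
    also have "\<dots> = (\<Sum>u<k. \<Sum>v<k. R $$ (u, l) * R $$ (v, m) * Re (frob_inner (A u) (A v)))"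
      by (rule sum.swap)
    finally have e: "mat_diag k \<mu> $$ (l, m) = (\<Sum>u<k. \<Sum>v<k. R $$ (u, l) * R $$ (v, m) * Re (frob_inner (A u) (A v)))" .
    have "frob_inner (rotate_family n k R A l) (rotate_family n k R A m) =
        (\<Sum>u<k. \<Sum>v<k. of_real (R $$ (u, l) * R $$ (v, m) * Re (frob_inner (A u) (A v))))"
      proof (rule trans[OF rotate_family_inner], rule A(1), assumption, intro sum.cong refl)
      fix u v assume "u \<in> {..<k}" "v \<in> {..<k}"
      then have "frob_inner (A u) (A v) = of_real (Re (frob_inner (A u) (A v)))"
        using A by (intro hermitian_inner_real[of _ n]) auto
      then show "of_real (R $$ (u, l) * R $$ (v, m)) * frob_inner (A u) (A v) =
          of_real (R $$ (u, l) * R $$ (v, m) * Re (frob_inner (A u) (A v)))"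
        by (metis of_real_mult)
    qed
    also have "\<dots> = of_real (mat_diag k \<mu> $$ (l, m))" unfolding e by (simp only: of_real_sum)
    finally show ?thesis using lm by (simp add: mat_diag_def)
  qed
  have "norm_sq (rotate_family n k R A l) = \<mu> l" if "l < k" for l
    unfolding frob_norm_inner using inner[OF that that] by simp
  then show ?thesis using R inner sorted by (intro bexI[of _ R]) auto
qed

theorem hermitian_ddvv:
  assumes k: "k \<ge> 3"
  shows "(\<Sum>r<k. \<Sum>s<k. comm_sq (A r) (A s)) \<le> 4 / 3 * (\<Sum>r<k. norm_sq (A r))\<^sup>2"
proof -
  obtain R where R: "R \<in> orthogonal_matrices k"
    and orth: "\<forall>l<k. \<forall>m<k. l \<noteq> m \<longrightarrow> frob_inner (rotate_family n k R A l) (rotate_family n k R A m) = 0"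
    and sorted: "\<forall>l m. l \<le> m \<longrightarrow> m < k \<longrightarrow> norm_sq (rotate_family n k R A m) \<le> norm_sq (rotate_family n k R A l)"
    using gram_orthogonalization by (elim bexE conjE)
  have "(\<Sum>r<k. \<Sum>s<k. comm_sq (rotate_family n k R A r) (rotate_family n k R A s))
      \<le> 4 / 3 * (\<Sum>r<k. norm_sq (rotate_family n k R A r))\<^sup>2"
    by (rule ddvv_orthogonal[OF k rotate_family_carrier rotate_family_hermitian[OF A]])
      (use orth sorted in auto)
  then show ?thesis
    by (simp only: rotate_family_commutator_sum[OF R A(1)] rotate_family_norm_sum[OF R A(1)])
qed

text \<open>The orthogonalized family is extremal too, so it consists of three matrices in the
  situation of \<open>pauli_normal_form\<close>, followed by zeros.\<close>

lemma hermitian_ddvv_normal_form: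
  assumes k: "k \<ge> 3" and n: "n \<ge> 2"
    and eq: "(\<Sum>r<k. \<Sum>s<k. comm_sq (A r) (A s)) = 4 / 3 * (\<Sum>r<k. norm_sq (A r))\<^sup>2"
  shows "\<exists>P\<in>unitary_matrices n. \<exists>R\<in>orthogonal_matrices k. \<exists>c\<ge>0. \<forall>l<k.
    rotate_family n k R (\<lambda>j. unitary_conj P (A j)) l =
      pauli_family n c l"
proof -
  obtain R where R: "R \<in> orthogonal_matrices k"
    and orth: "\<forall>l<k. \<forall>m<k. l \<noteq> m \<longrightarrow> frob_inner (rotate_family n k R A l) (rotate_family n k R A m) = 0"
    and sorted: "\<forall>l m. l \<le> m \<longrightarrow> m < k \<longrightarrow> norm_sq (rotate_family n k R A m) \<le> norm_sq (rotate_family n k R A l)"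
    using gram_orthogonalization by (elim bexE conjE)
  define F where "F = rotate_family n k R A"
  define S where "S = (\<Sum>r<k. norm_sq (F r))"
  have Fc: "F l \<in> carrier_mat n n" for l by (simp add: F_def)
  have Fh: "mat_adjoint (F l) = F l" for l unfolding F_def by (rule rotate_family_hermitian[OF A])
  have orth': "frob_inner (F l) (F m) = 0" if "l < k" "m < k" "l \<noteq> m" for l m using orth that by (simp add: F_def)
  have sorted': "norm_sq (F m) \<le> norm_sq (F l)" if "l \<le> m" "m < k" for l m
    using sorted that by (simp add: F_def)
  have eqF: "(\<Sum>r<k. \<Sum>s<k. comm_sq (F r) (F s)) = 4 / 3 * (\<Sum>r<k. norm_sq (F r))\<^sup>2"
    using eq by (simp only: F_def rotate_family_commutator_sum[OF R A(1)] rotate_family_norm_sum[OF R A(1)])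
  have eqF': "norm_sq (F 0) = S / 3" "norm_sq (F 1) = S / 3" "norm_sq (F 2) = S / 3"
    "comm_sq (F 0) (F 1) = 2 * norm_sq (F 0) * norm_sq (F 1)"
    "comm_sq (F 0) (F 2) = 2 * norm_sq (F 0) * norm_sq (F 2)"
    unfolding S_def
    by (rule ddvv_orthogonal_equality(1,2,3,5,6)[where k=k and A=F and n=n, OF k Fc Fh orth' sorted' eqF], assumption+)+
  have rest: "F r = 0\<^sub>m n n" if "3 \<le> r" "r < k" for r
    by (rule ddvv_orthogonal_equality(4)[where k=k and A=F and n=n, OF k Fc Fh orth' sorted' eqF]) (use that in auto)
  have "\<exists>P\<in>unitary_matrices n. \<exists>e0\<in>{1, -1}. \<exists>e2\<in>{1, -1}. \<exists>c\<ge>0.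
    unitary_conj P (F 0) = complex_of_real e0 \<cdot>\<^sub>m pauli_z n c \<and> unitary_conj P (F 1) = pauli_x n c \<and>
    unitary_conj P (F 2) = complex_of_real e2 \<cdot>\<^sub>m pauli_y n c"
  \<comment> \<open>The normal form requires a positive norm; the zero family takes
    \<open>c = 0\<close>.\<close>
  proof (cases "S = 0")
    case True
    have F0: "F 0 = 0\<^sub>m n n" "F 1 = 0\<^sub>m n n" "F 2 = 0\<^sub>m n n"
      by (rule frob_norm_eq_0[OF Fc], use eqF' True in simp)+
    have "1\<^sub>m n \<in> unitary_matrices n" by (simp add: unitary_matrices_def)
    moreover have "unitary_conj (1\<^sub>m n) (0\<^sub>m n n) = 0\<^sub>m n n" by (simp add: unitary_conj_def)
    moreover have "pauli_z n 0 = 0\<^sub>m n n" "pauli_x n 0 = 0\<^sub>m n n" "pauli_y n 0 = 0\<^sub>m n n"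
      unfolding pauli_z_eq[OF n] pauli_x_eq[OF n] pauli_y_eq[OF n] by (auto intro!: eq_matI)
    ultimately show ?thesis unfolding F0
      by (intro bexI[of _ "1\<^sub>m n"] bexI[of _ 1] exI[of _ 0]) auto
  next
    case False
    moreover have "S \<ge> 0" by (simp add: S_def sum_nonneg)
    ultimately have pos: "S / 3 > 0" by simp
    have "frob_inner (F 1) (F 2) = 0" using k by (intro orth') auto
    with eqF'(4,5) show ?thesis unfolding eqF'(1,2,3)
      by (intro pauli_normal_form[OF n Fc Fh Fc Fh Fc Fh eqF'(1,2,3) pos])
  qed
  then obtain P e0 e2 c where P: "P \<in> unitary_matrices n" and e: "e0 \<in> {1, -1}" "e2 \<in> {1, -1}" and c: "c \<ge> 0"
    and form: "unitary_conj P (F 0) = complex_of_real e0 \<cdot>\<^sub>m pauli_z n c" "unitary_conj P (F 1) = pauli_x n c"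
      "unitary_conj P (F 2) = complex_of_real e2 \<cdot>\<^sub>m pauli_y n c"
    by (elim bexE exE conjE)
  \<comment> \<open>The leftover signs form an orthogonal diagonal matrix \<open>D\<close>, and
    \<open>R * D\<close> replaces \<open>R\<close>.\<close>
  define \<epsilon> where "\<epsilon> l = (if l = 0 then e0 else if l = 2 then e2 else 1)" for l :: nat
  have \<epsilon>: "\<epsilon> l * \<epsilon> l = 1" for l using e by (auto simp: \<epsilon>_def)
  have Rc: "R \<in> carrier_mat k k" using R by (simp add: orthogonal_matrices_def)
  define D where "D = mat_diag k \<epsilon>"
  have D: "D \<in> carrier_mat k k" "transpose_mat D = D"
    by (auto simp: D_def mat_diag_def intro!: eq_matI)
  have DD: "D * D = 1\<^sub>m k"
    unfolding D_def mat_diag_diag \<epsilon> by (auto simp: mat_diag_def intro!: eq_matI)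
  define Q where "Q = R * D"
  have Q: "Q \<in> orthogonal_matrices k"
  proof -
    have RR: "transpose_mat R * R = 1\<^sub>m k" "R * transpose_mat R = 1\<^sub>m k" using R by (auto simp: orthogonal_matrices_def)
    have RT: "transpose_mat R \<in> carrier_mat k k" using Rc by simp
    have "D * transpose_mat R * (R * D) = D * (transpose_mat R * R) * D"
      using Rc RT D(1) by (simp add: assoc_mult_square[of _ k] mult_carrier_square[of _ k])
    then have 1: "D * transpose_mat R * (R * D) = 1\<^sub>m k" using D by (simp add: RR DD)
    have "R * D * (D * transpose_mat R) = R * (D * D) * transpose_mat R"
      using Rc RT D(1) by (simp add: assoc_mult_square[of _ k] mult_carrier_square[of _ k])
    then have 2: "R * D * (D * transpose_mat R) = 1\<^sub>m k" using D Rc by (simp add: RR DD)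
    show ?thesis
      unfolding Q_def orthogonal_matrices_def mem_Collect_eq transpose_mult[OF Rc D(1)] D(2)
      using 1 2 Rc D(1) by (simp add: mult_carrier_square[of _ k])
  qed
  have Qi: "Q $$ (j, l) = \<epsilon> l * R $$ (j, l)" if "j < k" "l < k" for j l
    unfolding Q_def D_def mat_diag_mult_right[OF Rc] using that by simp
  have uF: "unitary_conj P (F l) = rotate_family n k R (\<lambda>j. unitary_conj P (A j)) l" for l
    unfolding F_def by (rule unitary_conj_rotate_family[OF unitary_carrier[OF P]]) (rule A(1))
  have rot: "rotate_family n k Q (\<lambda>j. unitary_conj P (A j)) l = of_real (\<epsilon> l) \<cdot>\<^sub>m unitary_conj P (F l)" if l: "l < k" for l
    unfolding uF using l by (intro eq_matI) (auto simp: rotate_family_def Qi sum_distrib_left mult_ac)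
  have "rotate_family n k Q (\<lambda>j. unitary_conj P (A j)) l =
      pauli_family n c l" if l: "l < k" for l
  proof -
    have sm: "complex_of_real e \<cdot>\<^sub>m (complex_of_real e \<cdot>\<^sub>m M) = M" if "e \<in> {1, -1}" for e M
      using that by (intro eq_matI) auto
    have one: "1 \<cdot>\<^sub>m M = M" for M :: "complex mat" by (intro eq_matI) auto
    consider "l = 0" | "l = 1" | "l = 2" | "l \<ge> 3" by linarith
    then show ?thesis
    proof cases
      case 1
      show ?thesis unfolding rot[OF l] using 1 sm[OF e(1)] by (simp add: form \<epsilon>_def pauli_family_def)
    next
      case 2
      show ?thesis unfolding rot[OF l] using 2 form(2) by (simp add: \<epsilon>_def one pauli_family_def)
    next
      case 3
      show ?thesis unfolding rot[OF l] using 3 sm[OF e(2)] by (simp add: form \<epsilon>_def pauli_family_def)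
    next
      case 4
      have "unitary_conj P (0\<^sub>m n n) = 0\<^sub>m n n" using unitary_carrier[OF P] by (simp add: unitary_conj_def)
      then show ?thesis unfolding rot[OF l] rest[OF 4 l] using 4 by (simp add: \<epsilon>_def pauli_family_def)
    qed
  qed
  then show ?thesis using P Q c by blast
qed

end

text \<open>Three traceless, pairwise orthogonal blocks of squared norm \<open>2 c^2\<close>: each
  commutator has squared norm \<open>8 c^4\<close>, and six ordered pairs give
  \<open>48 c^4 = 4/3 (6 c^2)^2\<close>.\<close>

lemma pauli_extremal:
  fixes F :: "nat \<Rightarrow> complex mat"
  assumes k: "k \<ge> 3" and n: "n \<ge> 2"
    and F: "\<forall>l<k. F l = pauli_family n c l"
  shows "(\<Sum>r<k. \<Sum>s<k. comm_sq (F r) (F s)) = 4 / 3 * (\<Sum>r<k. norm_sq (F r))\<^sup>2"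
proof -
  note car = mat_of_rows_list_2_carrier
  have F012: "F 0 = pauli_z n c" "F 1 = pauli_x n c" "F 2 = pauli_y n c" using F k by (auto simp: pauli_family_def)
  have rest: "F r = 0\<^sub>m n n" if "3 \<le> r" "r < k" for r using F that by (auto simp: pauli_family_def)
  have Fc: "F r \<in> carrier_mat n n" if "r < k" for r
    using F that diag_zero_carrier[OF n car] by (auto simp: pauli_family_def pauli_x_def pauli_y_def pauli_z_def)
  note sums = sum_less_2 mat_of_rows_list_2_index
  have nrm: "norm_sq (mat_of_rows_list 2 [[of_real c, 0], [0, - of_real c]]) = 2 * c\<^sup>2"
    "norm_sq (mat_of_rows_list 2 [[0, of_real c], [of_real c, 0]]) = 2 * c\<^sup>2"
    "norm_sq (mat_of_rows_list 2 [[0, - of_real c * \<i>], [of_real c * \<i>, 0]]) = 2 * c\<^sup>2"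
    unfolding frob_norm_sum[OF car] by (simp_all add: sums norm_mult)
  have tr: "mat_trace (mat_of_rows_list 2 [[of_real c, 0], [0, - of_real c]]) = 0"
    "mat_trace (mat_of_rows_list 2 [[0, of_real c], [of_real c, 0]]) = 0"
    "mat_trace (mat_of_rows_list 2 [[0, - of_real c * \<i>], [of_real c * \<i>, 0]]) = 0"
    unfolding mat_trace_def by (simp_all add: carrier_matD(1)[OF car] sums)
  have inn: "frob_inner (mat_of_rows_list 2 [[of_real c, 0], [0, - of_real c]]) (mat_of_rows_list 2 [[0, of_real c], [of_real c, 0]]) = 0"
    "frob_inner (mat_of_rows_list 2 [[of_real c, 0], [0, - of_real c]]) (mat_of_rows_list 2 [[0, - of_real c * \<i>], [of_real c * \<i>, 0]]) = 0"
    "frob_inner (mat_of_rows_list 2 [[0, of_real c], [of_real c, 0]]) (mat_of_rows_list 2 [[0, - of_real c * \<i>], [of_real c * \<i>, 0]]) = 0"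
    unfolding frob_inner_sum[OF car car] by (simp_all add: sums)
  have nF: "norm_sq (F 0) = 2 * c\<^sup>2" "norm_sq (F 1) = 2 * c\<^sup>2" "norm_sq (F 2) = 2 * c\<^sup>2"
    unfolding F012 pauli_x_def pauli_y_def pauli_z_def frob_norm_diag_zero[OF n car] nrm by simp_all
  have cF: "comm_sq (F 0) (F 1) = 2 * (2 * c\<^sup>2) * (2 * c\<^sup>2)"
    "comm_sq (F 0) (F 2) = 2 * (2 * c\<^sup>2) * (2 * c\<^sup>2)"
    "comm_sq (F 1) (F 2) = 2 * (2 * c\<^sup>2) * (2 * c\<^sup>2)"
    unfolding F012 pauli_x_def pauli_y_def pauli_z_def
      traceless_diag_zero_commutator_norm[OF n car tr(1) car tr(2) inn(1)]
      traceless_diag_zero_commutator_norm[OF n car tr(1) car tr(3) inn(2)]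
      traceless_diag_zero_commutator_norm[OF n car tr(2) car tr(3) inn(3)] nrm by simp_all
  have "(\<Sum>r<k. norm_sq (F r)) = (\<Sum>r<3. norm_sq (F r))"
    using k rest by (intro sum.mono_neutral_right) auto
  also have "\<dots> = 6 * c\<^sup>2"
    using nF by (simp add: numeral_3_eq_3 numeral_2_eq_2)
  finally have S: "(\<Sum>r<k. norm_sq (F r)) = 6 * c\<^sup>2" .
  have "(\<Sum>r<k. \<Sum>s<k. comm_sq (F r) (F s)) = 2 * (comm_sq (F 0) (F 1)
      + comm_sq (F 0) (F 2) + comm_sq (F 1) (F 2))"
    by (rule sum_commutators_three[OF k, where n=n]) (use Fc rest in auto)
  also have "\<dots> = 2 * (3 * (2 * (2 * c\<^sup>2) * (2 * c\<^sup>2)))" unfolding cF by simp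
  finally show ?thesis unfolding S by (simp add: power2_eq_square)
qed

section \<open>Complex families\<close>

lemma mat_commutator_dim [simp]:
  "dim_row (mat_commutator A B) = dim_row B" "dim_col (mat_commutator A B) = dim_col A"
  by (simp_all add: mat_commutator_def)

lemma commutator_add:
  assumes "A \<in> carrier_mat n n" "B \<in> carrier_mat n n" "M \<in> carrier_mat n n"
  shows "mat_commutator (A + B) M = mat_commutator A M + mat_commutator B M"
proof (rule eq_matI)
  fix i j assume "i < dim_row (mat_commutator A M + mat_commutator B M)" "j < dim_col (mat_commutator A M + mat_commutator B M)"
  then have ij: "i < n" "j < n" using mat_commutator_carrier[OF assms(1,3)] mat_commutator_carrier[OF assms(2,3)] by auto
  have AB: "A + B \<in> carrier_mat n n" using assms by simp
  have "(mat_commutator A M + mat_commutator B M) $$ (i, j) = mat_commutator A M $$ (i, j) + mat_commutator B M $$ (i, j)"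
    using ij assms by simp
  also have "\<dots> = mat_commutator (A + B) M $$ (i, j)"
    unfolding commutator_index[OF AB assms(3) ij] commutator_index[OF assms(1,3) ij]
      commutator_index[OF assms(2,3) ij] sum.distrib[symmetric]
    using ij assms by (intro sum.cong refl) (simp add: algebra_simps)
  finally show "mat_commutator (A + B) M $$ (i, j) = (mat_commutator A M + mat_commutator B M) $$ (i, j)" ..
qed (use assms in auto)

lemma commutator_smult:
  assumes "A \<in> carrier_mat n n" "M \<in> carrier_mat n n"
  shows "mat_commutator (a \<cdot>\<^sub>m A) M = a \<cdot>\<^sub>m mat_commutator A M"
proof (rule eq_matI)
  have aA: "a \<cdot>\<^sub>m A \<in> carrier_mat n n" using assms by simp
  fix i j assume "i < dim_row (a \<cdot>\<^sub>m mat_commutator A M)" "j < dim_col (a \<cdot>\<^sub>m mat_commutator A M)"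
  then have ij: "i < n" "j < n" using mat_commutator_carrier[OF assms] by auto
  have "(a \<cdot>\<^sub>m mat_commutator A M) $$ (i, j) = a * mat_commutator A M $$ (i, j)"
    using ij assms by simp
  also have "\<dots> = mat_commutator (a \<cdot>\<^sub>m A) M $$ (i, j)"
    unfolding commutator_index[OF aA assms(2) ij] commutator_index[OF assms ij] sum_distrib_left
    using ij assms by (intro sum.cong refl) (simp add: algebra_simps)
  finally show "mat_commutator (a \<cdot>\<^sub>m A) M $$ (i, j) = (a \<cdot>\<^sub>m mat_commutator A M) $$ (i, j)" ..
qed (use assms in auto)

lemma adjoint_commutator:
  assumes "A \<in> carrier_mat n n" "B \<in> carrier_mat n n"
  shows "mat_adjoint (mat_commutator A B) = mat_commutator (mat_adjoint B) (mat_adjoint A)"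
  unfolding mat_commutator_def
  using mat_adjoint_minus[OF mult_carrier_mat[OF assms] mult_carrier_mat[OF assms(2,1)]]
  by (simp add: mat_adjoint_mult[OF assms] mat_adjoint_mult[OF assms(2,1)])

lemma adjoint_commutator_norm:
  assumes "A \<in> carrier_mat n n" "B \<in> carrier_mat n n"
  shows "frob_norm (mat_commutator (mat_adjoint A) (mat_adjoint B)) = frob_norm (mat_commutator A B)"
  using frob_norm_adjoint[OF mat_commutator_carrier[OF assms(2,1)]]
  by (simp add: adjoint_commutator[OF assms(2,1)] frob_norm_commutator_commute[OF assms])

section \<open>Hermitian and skew-Hermitian parts\<close>

context
  fixes n :: nat and B :: "complex mat"
  assumes B: "B \<in> carrier_mat n n"
begin

lemma herm_part_hermitian: "herm_part B \<in> carrier_mat n n" "mat_adjoint (herm_part B) = herm_part B"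
  using B by (auto simp: herm_part_def intro!: eq_matI)

lemma skew_part_hermitian: "\<i> \<cdot>\<^sub>m skew_part B \<in> carrier_mat n n" "mat_adjoint (\<i> \<cdot>\<^sub>m skew_part B) = \<i> \<cdot>\<^sub>m skew_part B"
  using B by (auto simp: skew_part_def algebra_simps intro!: eq_matI minus_carrier_mat)

lemma parts_norm_sum:
  "norm_sq (herm_part B) + norm_sq (\<i> \<cdot>\<^sub>m skew_part B) = norm_sq B"
  unfolding herm_part_def skew_part_def frob_norm_smult
  using frob_norm_parallelogram[OF B mat_adjoint_carrier[OF B]]
  by (simp add: frob_norm_adjoint[OF B] power_divide norm_divide)

text \<open>Up to a unit factor the two commutators are half the sum and half the difference of
  \<open>mat_commutator B M\<close> and \<open>mat_commutator (mat_adjoint B) M\<close>, so the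
  parallelogram law applies.\<close>

lemma parts_commutator_sum:
  assumes M: "M \<in> carrier_mat n n"
  shows "comm_sq (herm_part B) M + comm_sq (\<i> \<cdot>\<^sub>m skew_part B) M =
    (comm_sq B M + comm_sq (mat_adjoint B) M) / 2"
proof -
  have B': "mat_adjoint B \<in> carrier_mat n n" using B by simp
  have minus: "B - mat_adjoint B = B + (-1) \<cdot>\<^sub>m mat_adjoint B" using B by (intro eq_matI) auto
  have c: "B + mat_adjoint B \<in> carrier_mat n n" "B + (-1) \<cdot>\<^sub>m mat_adjoint B \<in> carrier_mat n n" using B by auto
  have h: "mat_commutator (herm_part B) M = (1 / 2) \<cdot>\<^sub>m (mat_commutator B M + mat_commutator (mat_adjoint B) M)"
    unfolding herm_part_def commutator_smult[OF c(1) M] commutator_add[OF B B' M] ..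
  have "mat_commutator B M + (-1) \<cdot>\<^sub>m mat_commutator (mat_adjoint B) M = mat_commutator B M - mat_commutator (mat_adjoint B) M"
    using mat_commutator_carrier[OF B M] mat_commutator_carrier[OF B' M] by (intro eq_matI) auto
  then have s: "mat_commutator (\<i> \<cdot>\<^sub>m skew_part B) M =
      \<i> \<cdot>\<^sub>m ((1 / 2) \<cdot>\<^sub>m (mat_commutator B M - mat_commutator (mat_adjoint B) M))"
    unfolding skew_part_def minus commutator_smult[OF smult_carrier_mat[OF c(2)] M] commutator_smult[OF c(2) M]
      commutator_add[OF B smult_carrier_mat[OF B'] M] commutator_smult[OF B' M] by simp
  show ?thesis
    unfolding h s frob_norm_smult
    using frob_norm_parallelogram[OF mat_commutator_carrier[OF B M] mat_commutator_carrier[OF B' M]]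
    by (simp add: power_divide norm_divide)
qed

end

text \<open>Splitting both arguments produces a quarter of four squared norms, which coincide in
  pairs by taking adjoints; \<open>frob_norm_commutator_adjoint\<close> compares the two values
  left.\<close>

lemma parts_pair_commutator_sum:
  assumes B: "B \<in> carrier_mat n n" and C: "C \<in> carrier_mat n n"
  defines "X \<equiv> herm_part B" and "Z \<equiv> \<i> \<cdot>\<^sub>m skew_part B" and "X' \<equiv> herm_part C" and "Z' \<equiv> \<i> \<cdot>\<^sub>m skew_part C"
  shows "comm_sq X X' + comm_sq X Z'
      + (comm_sq Z X' + comm_sq Z Z') =
    comm_sq B C
      + Re (frob_inner (mat_commutator B (mat_adjoint B)) (mat_commutator C (mat_adjoint C))) / 2"
proof -
  have c: "X \<in> carrier_mat n n" "Z \<in> carrier_mat n n" "X' \<in> carrier_mat n n" "Z' \<in> carrier_mat n n"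
    unfolding X_def Z_def X'_def Z'_def
    by (rule herm_part_hermitian[OF B] skew_part_hermitian[OF B] herm_part_hermitian[OF C] skew_part_hermitian[OF C])+
  have B': "mat_adjoint B \<in> carrier_mat n n" and C': "mat_adjoint C \<in> carrier_mat n n" using B C by auto
  have right: "comm_sq M X' + comm_sq M Z' =
      (comm_sq M C + comm_sq M (mat_adjoint C)) / 2"
    if M: "M \<in> carrier_mat n n" for M
    using parts_commutator_sum[OF C M] c C C' M
    by (simp add: X'_def Z'_def frob_norm_commutator_commute[of M n])
  have adj: "frob_norm (mat_commutator (mat_adjoint B) C) = frob_norm (mat_commutator B (mat_adjoint C))"
    using adjoint_commutator_norm[OF B C'] by simp
  have self: "mat_adjoint (mat_commutator C (mat_adjoint C)) = mat_commutator C (mat_adjoint C)"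
    using adjoint_commutator[OF C C'] by simp
  have l: "comm_sq X M + comm_sq Z M =
      (comm_sq B M + comm_sq (mat_adjoint B) M) / 2"
    if "M \<in> carrier_mat n n" for M
    unfolding X_def Z_def by (rule parts_commutator_sum[OF B that])
  have "comm_sq X X' + comm_sq X Z'
      + (comm_sq Z X' + comm_sq Z Z') =
      (comm_sq X C + comm_sq Z C
      + (comm_sq X (mat_adjoint C) + comm_sq Z (mat_adjoint C))) / 2"
    unfolding right[OF c(1)] right[OF c(2)] by (simp add: add_divide_distrib)
  also have "\<dots> = (comm_sq B C + comm_sq B (mat_adjoint C)) / 2"
    unfolding l[OF C] l[OF C'] adj adjoint_commutator_norm[OF B C] by (simp add: add_divide_distrib)
  also have "\<dots> = comm_sq B C
      + Re (frob_inner (mat_commutator B (mat_adjoint B)) (mat_commutator C (mat_adjoint C))) / 2"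
    unfolding frob_norm_commutator_adjoint[OF B C] frob_inner_def self by (simp add: add_divide_distrib)
  finally show ?thesis .
qed

lemma mat_sum_norm:
  assumes "\<And>r. r < m \<Longrightarrow> C r \<in> carrier_mat n n"
  shows "norm_sq (mat_sum n C {..<m}) = (\<Sum>r<m. \<Sum>s<m. Re (frob_inner (C r) (C s)))"
proof -
  let ?I = "{..<n} \<times> {..<n}"
  have "mat_sum n C {..<m} \<in> carrier_mat n n" by (simp add: mat_sum_def)
  then have "norm_sq (mat_sum n C {..<m}) = (\<Sum>ij\<in>?I. (cmod (mat_sum n C {..<m} $$ ij))\<^sup>2)"
    by (rule frob_norm_sum_pairs)
  also have "\<dots> = (\<Sum>ij\<in>?I. (cmod (\<Sum>r<m. C r $$ ij))\<^sup>2)"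
    by (intro sum.cong refl) (auto simp: mat_sum_def)
  also have "\<dots> = (\<Sum>ij\<in>?I. \<Sum>r<m. \<Sum>s<m. Re (C r $$ ij * cnj (C s $$ ij)))"
    unfolding cmod_sum_sq ..
  also have "\<dots> = (\<Sum>r<m. \<Sum>ij\<in>?I. \<Sum>s<m. Re (C r $$ ij * cnj (C s $$ ij)))"
    by (rule sum.swap)
  also have "\<dots> = (\<Sum>r<m. \<Sum>s<m. \<Sum>ij\<in>?I. Re (C r $$ ij * cnj (C s $$ ij)))"
    by (rule sum.cong[OF refl], rule sum.swap)
  also have "\<dots> = (\<Sum>r<m. \<Sum>s<m. Re (frob_inner (C r) (C s)))"
    using assms by (intro sum.cong refl) (simp add: frob_inner_sum[of _ n n] sum.cartesian_product split_def)
  finally show ?thesis .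
qed

lemma sum_nth_append_map:
  fixes F :: "'b \<Rightarrow> 'c::comm_monoid_add"
  shows "(\<Sum>i<2 * length B. F ((map f B @ map g B) ! i)) = (\<Sum>r<length B. F (f (B ! r)) + F (g (B ! r)))"
proof -
  have *: "(\<Sum>i<length xs. F (xs ! i)) = sum_list (map F xs)" for xs
    by (simp add: sum_list_sum_nth atLeast0LessThan)
  have "(\<Sum>i<2 * length B. F ((map f B @ map g B) ! i)) = sum_list (map F (map f B @ map g B))"
    unfolding *[symmetric] by (simp add: mult_2)
  also have "\<dots> = sum_list (map F (map f B)) + sum_list (map F (map g B))" by simp
  also have "\<dots> = (\<Sum>r<length B. F (f (B ! r)) + F (g (B ! r)))"
    unfolding *[symmetric] by (simp add: sum.distrib)
  finally show ?thesis .
qed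

definition hermitian_parts :: "complex mat list \<Rightarrow> complex mat list" where
  "hermitian_parts B = map herm_part B @ map (\<lambda>b. \<i> \<cdot>\<^sub>m skew_part b) B"

context
  fixes n :: nat and B :: "complex mat list"
  assumes B: "set B \<subseteq> carrier_mat n n"
begin

lemma nth_carrier: "r < length B \<Longrightarrow> B ! r \<in> carrier_mat n n"
  using B nth_mem by blast

lemma hermitian_parts_carrier: "set (hermitian_parts B) \<subseteq> carrier_mat n n"
  using B herm_part_hermitian(1) skew_part_hermitian(1) by (auto simp: hermitian_parts_def)

lemma hermitian_parts_hermitian: "A \<in> set (hermitian_parts B) \<Longrightarrow> mat_adjoint A = A"
  using B herm_part_hermitian(2) skew_part_hermitian(2) by (auto simp: hermitian_parts_def)

lemma hermitian_parts_norm_sum: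
  "(\<Sum>i<2 * length B. norm_sq (hermitian_parts B ! i)) = (\<Sum>r<length B. norm_sq (B ! r))"
  unfolding hermitian_parts_def sum_nth_append_map[where F="\<lambda>A. norm_sq A"]
  by (intro sum.cong refl parts_norm_sum[of _ n] nth_carrier) simp

text \<open>The correction terms of the pairs are inner products of self-commutators; their double
  sum is the squared norm of one matrix.\<close>

lemma hermitian_parts_commutator_sum:
  "(\<Sum>i<2 * length B. \<Sum>j<2 * length B. comm_sq (hermitian_parts B ! i) (hermitian_parts B ! j)) =
    (\<Sum>r<length B. \<Sum>s<length B. comm_sq (B ! r) (B ! s))
    + norm_sq (mat_sum n (\<lambda>r. mat_commutator (B ! r) (mat_adjoint (B ! r))) {..<length B}) / 2"
proof -
  let ?F = "\<lambda>X Y. comm_sq X Y"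
  let ?h = "herm_part" and ?k = "\<lambda>b. \<i> \<cdot>\<^sub>m skew_part b"
  let ?C = "\<lambda>r. mat_commutator (B ! r) (mat_adjoint (B ! r))"
  have "(\<Sum>i<2 * length B. \<Sum>j<2 * length B. ?F (hermitian_parts B ! i) (hermitian_parts B ! j)) =
      (\<Sum>i<2 * length B. \<Sum>s<length B. ?F (hermitian_parts B ! i) (?h (B ! s)) + ?F (hermitian_parts B ! i) (?k (B ! s)))"
    unfolding hermitian_parts_def by (rule sum.cong[OF refl], rule sum_nth_append_map)
  also have "\<dots> = (\<Sum>r<length B. (\<Sum>s<length B. ?F (?h (B ! r)) (?h (B ! s)) + ?F (?h (B ! r)) (?k (B ! s)))
      + (\<Sum>s<length B. ?F (?k (B ! r)) (?h (B ! s)) + ?F (?k (B ! r)) (?k (B ! s))))"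
    unfolding hermitian_parts_def
    by (rule sum_nth_append_map[where F="\<lambda>A. \<Sum>s<length B. ?F A (?h (B ! s)) + ?F A (?k (B ! s))"])
  also have "\<dots> = (\<Sum>r<length B. \<Sum>s<length B. ?F (B ! r) (B ! s) + Re (frob_inner (?C r) (?C s)) / 2)"
    unfolding sum.distrib[symmetric]
    by (intro sum.cong refl parts_pair_commutator_sum[of _ n] nth_carrier) auto
  also have "\<dots> = (\<Sum>r<length B. \<Sum>s<length B. ?F (B ! r) (B ! s))
      + (\<Sum>r<length B. \<Sum>s<length B. Re (frob_inner (?C r) (?C s))) / 2"
    by (simp add: sum.distrib sum_divide_distrib)
  also have "(\<Sum>r<length B. \<Sum>s<length B. Re (frob_inner (?C r) (?C s))) = norm_sq (mat_sum n ?C {..<length B})"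
    by (intro mat_sum_norm[symmetric] mat_commutator_carrier nth_carrier mat_adjoint_carrier)
  finally show ?thesis .
qed

end

lemma K_action_pauli_iff:
  assumes n: "n \<ge> 2" and k: "length As \<ge> 3" and As: "set As \<subseteq> carrier_mat n n" and P: "P \<in> unitary_matrices n"
  shows "K_action n (P, R) As = [pauli_z n c, pauli_x n c, pauli_y n c] @ replicate (length As - 3) (0\<^sub>m n n) \<longleftrightarrow>
    (\<forall>l<length As. rotate_family n (length As) R (\<lambda>j. unitary_conj P (As ! j)) l =
      pauli_family n c l)"
proof -
  let ?L = "[pauli_z n c, pauli_x n c, pauli_y n c] @ replicate (length As - 3) (0\<^sub>m n n)"
  have "?L ! l = pauli_family n c l"
    if "l < length As" for l
  proof -
    consider "l = 0" | "l = 1" | "l = 2" | "l \<ge> 3" by linarith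
    then show ?thesis using that by cases (auto simp: pauli_family_def nth_append nth_Cons')
  qed
  moreover have "length ?L = length As" using k by simp
  ultimately show ?thesis
    unfolding K_action_rotate_family[OF P As] list_eq_iff_nth_eq by auto
qed

text \<open>With \<open>M\<close> the sum of the self-commutators and \<open>TA\<close> the
  Hermitian sum, \<open>T \<le> TA \<le> 4 / 3 * S^2\<close>. The first inequality is an equality
  exactly for \<open>M = 0\<close>, the second exactly for the normal form.\<close>

theorem complex_ddvv:
  assumes n: "n \<ge> 2" and m: "length B \<ge> 3" and B: "set B \<subseteq> carrier_mat n n"
  defines "T \<equiv> (\<Sum>r<length B. \<Sum>s<length B. comm_sq (B ! r) (B ! s))"
    and "S \<equiv> (\<Sum>r<length B. norm_sq (B ! r))"
  shows "T \<le> 4 / 3 * S\<^sup>2"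
    and "T = 4 / 3 * S\<^sup>2 \<longleftrightarrow>
      mat_sum n (\<lambda>r. mat_commutator (B ! r) (mat_adjoint (B ! r))) {..<length B} = 0\<^sub>m n n \<and>
      (\<exists>P R. (P, R) \<in> K_group n (2 * length B) \<and> (\<exists>c::real. c \<ge> 0 \<and>
        K_action n (P, R) (hermitian_parts B) =
          [pauli_z n c, pauli_x n c, pauli_y n c] @ replicate (2 * length B - 3) (0\<^sub>m n n)))"
proof -
  define k where "k = 2 * length B"
  define A where "A = (\<lambda>i. hermitian_parts B ! i)"
  define M where "M = mat_sum n (\<lambda>r. mat_commutator (B ! r) (mat_adjoint (B ! r))) {..<length B}"
  have k: "k \<ge> 3" using m by (simp add: k_def)
  have len: "length (hermitian_parts B) = k" by (simp add: hermitian_parts_def k_def)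
  have mem: "A r \<in> set (hermitian_parts B)" if "r < k" for r using that by (simp add: A_def len[symmetric])
  have A: "A r \<in> carrier_mat n n" "mat_adjoint (A r) = A r" if "r < k" for r
    using mem[OF that] hermitian_parts_carrier[OF B] hermitian_parts_hermitian[OF B] by blast+
  define TA where "TA = (\<Sum>r<k. \<Sum>s<k. comm_sq (A r) (A s))"
  have TA: "TA = T + norm_sq M / 2"
    unfolding TA_def T_def M_def k_def A_def by (rule hermitian_parts_commutator_sum[OF B])
  have SA: "(\<Sum>r<k. norm_sq (A r)) = S"
    unfolding S_def k_def A_def by (rule hermitian_parts_norm_sum[OF B])
  have "TA \<le> 4 / 3 * (\<Sum>r<k. norm_sq (A r))\<^sup>2"
    unfolding TA_def by (rule hermitian_ddvv[OF A k])
  then have le: "TA \<le> 4 / 3 * S\<^sup>2" unfolding SA .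
  have TT: "T \<le> TA" unfolding TA by simp
  show "T \<le> 4 / 3 * S\<^sup>2" using TT le by (rule order_trans)
  have M: "M \<in> carrier_mat n n" by (simp add: M_def mat_sum_def)
  have split: "T = 4 / 3 * S\<^sup>2 \<longleftrightarrow> M = 0\<^sub>m n n \<and> TA = 4 / 3 * S\<^sup>2"
  proof
    assume T: "T = 4 / 3 * S\<^sup>2"
    then have eq: "TA = T" using le TT by simp
    then have "frob_norm M = 0" unfolding TA by simp
    then show "M = 0\<^sub>m n n \<and> TA = 4 / 3 * S\<^sup>2" using frob_norm_eq_0[OF M] eq T by simp
  next
    assume *: "M = 0\<^sub>m n n \<and> TA = 4 / 3 * S\<^sup>2"
    then have "TA = T" unfolding TA by simp
    then show "T = 4 / 3 * S\<^sup>2" using * by simp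
  qed
  have normal_form: "TA = 4 / 3 * S\<^sup>2 \<longleftrightarrow> (\<exists>P R. (P, R) \<in> K_group n k \<and> (\<exists>c::real. c \<ge> 0 \<and>
    K_action n (P, R) (hermitian_parts B) = [pauli_z n c, pauli_x n c, pauli_y n c] @ replicate (k - 3) (0\<^sub>m n n)))"
    (is "_ \<longleftrightarrow> ?R")
  proof
    assume "TA = 4 / 3 * S\<^sup>2"
    then have eq: "(\<Sum>r<k. \<Sum>s<k. comm_sq (A r) (A s)) = 4 / 3 * (\<Sum>r<k. norm_sq (A r))\<^sup>2"
      unfolding SA TA_def .
    have "\<exists>P\<in>unitary_matrices n. \<exists>R\<in>orthogonal_matrices k. \<exists>c\<ge>0. \<forall>l<k.
      rotate_family n k R (\<lambda>j. unitary_conj P (A j)) l =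
        pauli_family n c l"
      by (rule hermitian_ddvv_normal_form[OF A k n eq])
    then obtain P R c where P: "P \<in> unitary_matrices n" and R: "R \<in> orthogonal_matrices k" and c: "c \<ge> 0"
      and form: "\<forall>l<k. rotate_family n k R (\<lambda>j. unitary_conj P (A j)) l =
        pauli_family n c l"
      by (elim bexE exE conjE)
    have "K_action n (P, R) (hermitian_parts B) = [pauli_z n c, pauli_x n c, pauli_y n c] @ replicate (k - 3) (0\<^sub>m n n)"
      using form K_action_pauli_iff[OF n _ hermitian_parts_carrier[OF B] P, unfolded len, OF k] by (simp add: A_def)
    then show ?R using P R c by (auto simp: K_group_def)
  next
    assume ?R
    then obtain P R c where P: "P \<in> unitary_matrices n" and R: "R \<in> orthogonal_matrices k"
      and form: "K_action n (P, R) (hermitian_parts B) = [pauli_z n c, pauli_x n c, pauli_y n c] @ replicate (k - 3) (0\<^sub>m n n)"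
      by (auto simp: K_group_def)
    \<comment> \<open>Mixing and conjugation preserve both sides of the Hermitian equality, so it
      may be checked on the triple itself.\<close>
    define F where "F = rotate_family n k R (\<lambda>j. unitary_conj P (A j))"
    have "\<forall>l<k. F l = pauli_family n c l"
      using form K_action_pauli_iff[OF n _ hermitian_parts_carrier[OF B] P, unfolded len, OF k] by (simp add: A_def F_def)
    then have "(\<Sum>r<k. \<Sum>s<k. comm_sq (F r) (F s)) = 4 / 3 * (\<Sum>r<k. norm_sq (F r))\<^sup>2"
      by (rule pauli_extremal[OF k n])
    moreover have "(\<Sum>r<k. \<Sum>s<k. comm_sq (F r) (F s)) = TA"
    proof -
      have "(\<Sum>r<k. \<Sum>s<k. comm_sq (F r) (F s)) =
          (\<Sum>r<k. \<Sum>s<k. comm_sq (unitary_conj P (A r)) (unitary_conj P (A s)))"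
        unfolding F_def by (rule rotate_family_commutator_sum[OF R]) (rule unitary_conj_carrier[OF P A(1)])
      also have "\<dots> = TA"
        unfolding TA_def using A(1) by (intro sum.cong refl) (simp add: unitary_conj_commutator_norm[OF P])
      finally show ?thesis .
    qed
    moreover have "(\<Sum>r<k. norm_sq (F r)) = S"
    proof -
      have "(\<Sum>r<k. norm_sq (F r)) = (\<Sum>r<k. norm_sq (unitary_conj P (A r)))"
        unfolding F_def by (rule rotate_family_norm_sum[OF R]) (rule unitary_conj_carrier[OF P A(1)])
      also have "\<dots> = (\<Sum>r<k. norm_sq (A r))"
        using A(1) by (intro sum.cong refl) (simp add: unitary_conj_norm[OF P])
      finally show ?thesis unfolding SA .
    qed
    ultimately show "TA = 4 / 3 * S\<^sup>2" by simp
  qed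
  show "T = 4 / 3 * S\<^sup>2 \<longleftrightarrow>
      mat_sum n (\<lambda>r. mat_commutator (B ! r) (mat_adjoint (B ! r))) {..<length B} = 0\<^sub>m n n \<and>
      (\<exists>P R. (P, R) \<in> K_group n (2 * length B) \<and> (\<exists>c::real. c \<ge> 0 \<and>
        K_action n (P, R) (hermitian_parts B) =
          [pauli_z n c, pauli_x n c, pauli_y n c] @ replicate (2 * length B - 3) (0\<^sub>m n n)))"
    unfolding split normal_form M_def k_def ..
qed

theorem theorem2p3:
  fixes n m :: nat and B :: "complex mat list"
  assumes "n \<ge> 2"
    and "length B = m"
    and "set B \<subseteq> carrier_mat n n"
  shows
    "(m \<ge> 3 \<longrightarrow>
       (\<Sum>r<m. \<Sum>s<m. (frob_norm (mat_commutator (B ! r) (B ! s)))\<^sup>2)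
         \<le> 4 / 3 * (\<Sum>r<m. (frob_norm (B ! r))\<^sup>2)\<^sup>2 \<and>
       ((\<Sum>r<m. \<Sum>s<m. (frob_norm (mat_commutator (B ! r) (B ! s)))\<^sup>2)
         = 4 / 3 * (\<Sum>r<m. (frob_norm (B ! r))\<^sup>2)\<^sup>2
        \<longleftrightarrow>
        mat_sum n (\<lambda>r. mat_commutator (B ! r) (mat_adjoint (B ! r))) {..<m} = 0\<^sub>m n n \<and>
        (\<exists>P R. (P, R) \<in> K_group n (2 * m) \<and>
          (\<exists>c::real. c \<ge> 0 \<and>
            K_action n (P, R) (map herm_part B @ map (\<lambda>b. \<i> \<cdot>\<^sub>m skew_part b) B) =
              [diag_zero n (mat_of_rows_list 2 [[of_real c, 0], [0, - of_real c]]),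
               diag_zero n (mat_of_rows_list 2 [[0, of_real c], [of_real c, 0]]),
               diag_zero n (mat_of_rows_list 2 [[0, - of_real c * \<i>], [of_real c * \<i>, 0]])]
              @ replicate (2 * m - 3) (0\<^sub>m n n)))))
     \<and>
     (m = 2 \<longrightarrow>
       (\<Sum>r<2. \<Sum>s<2. (frob_norm (mat_commutator (B ! r) (B ! s)))\<^sup>2)
         \<le> (\<Sum>r<2. (frob_norm (B ! r))\<^sup>2)\<^sup>2 \<and>
       ((\<Sum>r<2. \<Sum>s<2. (frob_norm (mat_commutator (B ! r) (B ! s)))\<^sup>2)
         = (\<Sum>r<2. (frob_norm (B ! r))\<^sup>2)\<^sup>2
        \<longleftrightarrow>
        (\<exists>U C1 C2. U \<in> unitary_matrices n \<and>
          C1 \<in> carrier_mat 2 2 \<and> C2 \<in> carrier_mat 2 2 \<and>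
          B ! 0 = mat_adjoint U * diag_zero n C1 * U \<and>
          B ! 1 = mat_adjoint U * diag_zero n C2 * U \<and>
          frob_norm C1 = frob_norm C2 \<and>
          frob_inner C1 C2 = 0 \<and>
          mat_trace C1 = 0 \<and> mat_trace C2 = 0)))"
proof -
  note B = assms(3)
  have B01: "B ! 0 \<in> carrier_mat n n" "B ! 1 \<in> carrier_mat n n" if "m = 2"
    using assms that by (auto intro!: nth_carrier[OF B])
  have sums: "(\<Sum>r<2. \<Sum>s<2. comm_sq (B ! r) (B ! s)) = 2 * comm_sq (B ! 0) (B ! 1)" if "m = 2"
    unfolding sum_less_2 by (rule two_matrix_sum[OF B01[OF that]])
  show ?thesis
  proof (intro conjI impI, goal_cases)
    case 1
    then have m: "length B \<ge> 3" using assms(2) by simp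
    show ?case using complex_ddvv(1)[OF assms(1) m B] unfolding assms(2) .
  next
    case 2
    then have m: "length B \<ge> 3" using assms(2) by simp
    show ?case
      using complex_ddvv(2)[OF assms(1) m B]
      unfolding assms(2) hermitian_parts_def pauli_z_def pauli_x_def pauli_y_def .
  next
    case 3
    show ?case
      unfolding sums[OF 3] unfolding sum_less_2 by (rule two_matrix_inequality[OF B01[OF 3]])
  next
    case 4
    show ?case
      unfolding sums[OF 4] unfolding sum_less_2 by (rule two_matrix_equality[OF assms(1) B01[OF 4]])
  qed
qed

end
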